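(* Let $k$ be a commutative ring and let $(T,\mu)$ be a $k$-torsor such that $T$ is faithfully flat as a $k$-module. Then $(T,\mu)$ has a Grunspan map, i.e. there exists a $k$-algebra endomorphism $\theta$ of $T$ satisfying $$(T\otimes T^{\mathrm{op}}\otimes\theta\otimes T^{\mathrm{op}}\otimes T)(\mu\otimes T^{\mathrm{op}}\otimes T)\mu=(T\otimes\mu^{\mathrm{op}}\otimes T)\mu$$ and $$(\theta\otimes\theta\otimes\theta)\mu=\mu\theta,$$ where $\mu^{\mathrm{op}}(x)=x^{(3)}\otimes x^{(2)}\otimes x^{(1)}$ if $\mu(x)=x^{(1)}\otimes x^{(2)}\otimes x^{(3)}$.
   Context: All algebras are associative and unital over the commutative base ring $k$; $\otimes$ means $\otimes_k$; $T^{\mathrm{op}}$ is the opposite algebra of $T$. An object name in a tensor product of maps denotes its identity map. An element of a tensor product is written $v\otimes w$ even when it is not a simple tensor. A (noncommutative) $k$-torsor is a $k$-algebra $T$ with an algebra map $\mu\colon T\to T\otimes T^{\mathrm{op}}\otimes T$, written $\mu(x)=x^{(1)}\otimes x^{(2)}\otimes x^{(3)}$, such that for all $x\in T$: (i) $\mu(x^{(1)})\otimes x^{(2)}\otimes x^{(3)}=x^{(1)}\otimes x^{(2)}\otimes\mu(x^{(3)})$; (ii) $x^{(1)}x^{(2)}\otimes x^{(3)}=1\otimes x$ in $T\otimes T$; (iii) $x^{(1)}\otimes x^{(2)}x^{(3)}=x\otimes 1$ in $T\otimes T$. (The products in (ii) and (iii) are taken in $T$.) *)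

theory Defs
  imports "HOL-Algebra.Algebra"
begin

section \<open>Modules and noncommutative algebras over a commutative ring\<close>

text \<open>The locale \<^locale>\<open>algebra\<close> of the library is about commutative algebras only.\<close>

locale assoc_algebra = module R A + ring A for R (structure) and A (structure) +
  assumes smult_mult_left:
      "\<lbrakk>r \<in> carrier R; x \<in> carrier A; y \<in> carrier A\<rbrakk> \<Longrightarrow>
        (r \<odot>\<^bsub>A\<^esub> x) \<otimes>\<^bsub>A\<^esub> y = r \<odot>\<^bsub>A\<^esub> (x \<otimes>\<^bsub>A\<^esub> y)"
    and smult_mult_right:
      "\<lbrakk>r \<in> carrier R; x \<in> carrier A; y \<in> carrier A\<rbrakk> \<Longrightarrow>
        x \<otimes>\<^bsub>A\<^esub> (r \<odot>\<^bsub>A\<^esub> y) = r \<odot>\<^bsub>A\<^esub> (x \<otimes>\<^bsub>A\<^esub> y)"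

definition linear_maps ::
  "('k, 'r) ring_scheme \<Rightarrow> ('k, 'a, 'x) module_scheme \<Rightarrow> ('k, 'b, 'y) module_scheme \<Rightarrow> ('a \<Rightarrow> 'b) set" where
  "linear_maps R M N =
     {f \<in> hom (add_monoid M) (add_monoid N).
        \<forall>r\<in>carrier R. \<forall>x\<in>carrier M. f (r \<odot>\<^bsub>M\<^esub> x) = r \<odot>\<^bsub>N\<^esub> f x}"

definition algebra_homs ::
  "('k, 'r) ring_scheme \<Rightarrow> ('k, 'a, 'x) module_scheme \<Rightarrow> ('k, 'b, 'y) module_scheme \<Rightarrow> ('a \<Rightarrow> 'b) set" where
  "algebra_homs R A B = ring_hom A B \<inter> linear_maps R A B"

definition opp :: "('k, 'a, 'x) module_scheme \<Rightarrow> ('k, 'a, 'x) module_scheme" where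
  "opp A = A\<lparr>monoid.mult := (\<lambda>x y. y \<otimes>\<^bsub>A\<^esub> x)\<rparr>"


section \<open>Tensor products\<close>

definition tensor_rels ::
  "('k, 'r) ring_scheme \<Rightarrow> ('k, 'a, 'x) module_scheme \<Rightarrow> ('k, 'b, 'y) module_scheme \<Rightarrow> ('a \<times> 'b \<Rightarrow>\<^sub>0 int) set" where
  "tensor_rels R M N =
     {frag_of (x \<oplus>\<^bsub>M\<^esub> x', y) - frag_of (x, y) - frag_of (x', y) | x x' y.
        x \<in> carrier M \<and> x' \<in> carrier M \<and> y \<in> carrier N} \<union>
     {frag_of (x, y \<oplus>\<^bsub>N\<^esub> y') - frag_of (x, y) - frag_of (x, y') | x y y'.
        x \<in> carrier M \<and> y \<in> carrier N \<and> y' \<in> carrier N} \<union>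
     {frag_of (r \<odot>\<^bsub>M\<^esub> x, y) - frag_of (x, r \<odot>\<^bsub>N\<^esub> y) | r x y.
        r \<in> carrier R \<and> x \<in> carrier M \<and> y \<in> carrier N}"

definition tensor_kernel ::
  "('k, 'r) ring_scheme \<Rightarrow> ('k, 'a, 'x) module_scheme \<Rightarrow> ('k, 'b, 'y) module_scheme \<Rightarrow> ('a \<times> 'b \<Rightarrow>\<^sub>0 int) set" where
  "tensor_kernel R M N = generate (free_Abelian_group (carrier M \<times> carrier N)) (tensor_rels R M N)"

definition tensor_group ::
  "('k, 'r) ring_scheme \<Rightarrow> ('k, 'a, 'x) module_scheme \<Rightarrow> ('k, 'b, 'y) module_scheme \<Rightarrow> ('a \<times> 'b \<Rightarrow>\<^sub>0 int) set monoid" where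
  "tensor_group R M N = free_Abelian_group (carrier M \<times> carrier N) Mod tensor_kernel R M N"

definition pure_tensor ::
  "('k, 'r) ring_scheme \<Rightarrow> ('k, 'a, 'x) module_scheme \<Rightarrow> ('k, 'b, 'y) module_scheme \<Rightarrow> 'a \<Rightarrow> 'b \<Rightarrow> ('a \<times> 'b \<Rightarrow>\<^sub>0 int) set" where
  "pure_tensor R M N x y =
     tensor_kernel R M N #>\<^bsub>free_Abelian_group (carrier M \<times> carrier N)\<^esub> frag_of (x, y)"

text \<open>The additive map out of the tensor product that is induced by a balanced biadditive map into
  an abelian group (written multiplicatively); see \<open>tensor_lift_unique\<close> below.\<close>

definition tensor_lift ::
  "('k, 'r) ring_scheme \<Rightarrow> ('k, 'a, 'x) module_scheme \<Rightarrow> ('k, 'b, 'y) module_scheme \<Rightarrow> ('c, 'g) monoid_scheme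
    \<Rightarrow> ('a \<Rightarrow> 'b \<Rightarrow> 'c) \<Rightarrow> ('a \<times> 'b \<Rightarrow>\<^sub>0 int) set \<Rightarrow> 'c" where
  "tensor_lift R M N G \<beta> =
     (THE h. h \<in> hom (tensor_group R M N) G \<inter> extensional (carrier (tensor_group R M N)) \<and>
        (\<forall>x\<in>carrier M. \<forall>y\<in>carrier N. h (pure_tensor R M N x y) = \<beta> x y))"

text \<open>The universal property of the tensor product; it shows that the description in
  \<open>tensor_lift_def\<close> determines a map.\<close>

lemma tensor_lift_unique:
  assumes "comm_group G" "module R M" "module R N"
    and closed: "\<And>x y. \<lbrakk>x \<in> carrier M; y \<in> carrier N\<rbrakk> \<Longrightarrow> \<beta> x y \<in> carrier G"
    and add_left: "\<And>x x' y. \<lbrakk>x \<in> carrier M; x' \<in> carrier M; y \<in> carrier N\<rbrakk> \<Longrightarrow>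
      \<beta> (x \<oplus>\<^bsub>M\<^esub> x') y = \<beta> x y \<otimes>\<^bsub>G\<^esub> \<beta> x' y"
    and add_right: "\<And>x y y'. \<lbrakk>x \<in> carrier M; y \<in> carrier N; y' \<in> carrier N\<rbrakk> \<Longrightarrow>
      \<beta> x (y \<oplus>\<^bsub>N\<^esub> y') = \<beta> x y \<otimes>\<^bsub>G\<^esub> \<beta> x y'"
    and balanced: "\<And>r x y. \<lbrakk>r \<in> carrier R; x \<in> carrier M; y \<in> carrier N\<rbrakk> \<Longrightarrow>
      \<beta> (r \<odot>\<^bsub>M\<^esub> x) y = \<beta> x (r \<odot>\<^bsub>N\<^esub> y)"
  shows "\<exists>!h. h \<in> hom (tensor_group R M N) G \<inter> extensional (carrier (tensor_group R M N)) \<and>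
      (\<forall>x\<in>carrier M. \<forall>y\<in>carrier N. h (pure_tensor R M N x y) = \<beta> x y)"
proof -
  interpret G: comm_group G by fact
  interpret M: module R M by fact
  interpret N: module R N by fact
  let ?S = "carrier M \<times> carrier N"
  let ?F = "free_Abelian_group ?S"
  let ?K = "tensor_kernel R M N"
  interpret F: comm_group ?F by (rule abelian_free_Abelian_group)
  have minus: "a - b \<in> carrier ?F" if "a \<in> carrier ?F" "b \<in> carrier ?F" for a b
    using that keys_diff[of a b] by auto
  have rels: "tensor_rels R M N \<subseteq> carrier ?F"
    unfolding tensor_rels_def by (auto intro!: minus)
  have sub: "subgroup ?K ?F"
    unfolding tensor_kernel_def by (rule F.generate_is_subgroup[OF rels])
  then have nrm: "?K \<lhd> ?F" by (simp add: F.subgroup_imp_normal)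
  interpret T: group "tensor_group R M N"
    unfolding tensor_group_def using nrm by (rule normal.factorgroup_is_group)
  have carT: "carrier (tensor_group R M N) = (\<lambda>c. ?K #>\<^bsub>?F\<^esub> c) ` carrier ?F"
    by (auto simp: tensor_group_def FactGroup_def RCOSETS_def)
  have proj: "(\<lambda>c. ?K #>\<^bsub>?F\<^esub> c) \<in> hom ?F (tensor_group R M N)"
    unfolding tensor_group_def by (rule normal.r_coset_hom_Mod[OF nrm])
  have "(\<lambda>(x, y). \<beta> x y) ` ?S \<subseteq> carrier G" using closed by auto
  then obtain k where k: "k \<in> hom ?F G" and "\<And>z. z \<in> ?S \<Longrightarrow> k (frag_of z) = (\<lambda>(x, y). \<beta> x y) z"
    using G.free_Abelian_group_universal by blast
  then have kof: "k (frag_of (x, y)) = \<beta> x y" if "x \<in> carrier M" "y \<in> carrier N" for x y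
    using that by auto
  interpret k: group_hom ?F G k using k by (simp add: group_hom_def group_hom_axioms_def)
  have minus_hom: "f (a - b) = f a \<otimes>\<^bsub>G\<^esub> inv\<^bsub>G\<^esub> f b"
    if f: "f \<in> hom ?F G" and a: "a \<in> carrier ?F" and b: "b \<in> carrier ?F" for f a b
  proof -
    interpret f: group_hom ?F G f using f by (simp add: group_hom_def group_hom_axioms_def)
    have "-b \<in> carrier ?F" using b by (simp add: keys_minus)
    then show ?thesis using f.hom_mult[OF a, of "-b"] f.hom_inv[OF b] b by simp
  qed
  note kminus = minus_hom[OF k]
  have cancel: "u \<otimes>\<^bsub>G\<^esub> v \<otimes>\<^bsub>G\<^esub> inv\<^bsub>G\<^esub> u \<otimes>\<^bsub>G\<^esub> inv\<^bsub>G\<^esub> v = \<one>\<^bsub>G\<^esub>"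
    if "u \<in> carrier G" "v \<in> carrier G" for u v
    using that by (metis G.inv_closed G.m_assoc G.m_closed G.m_comm G.r_inv G.r_one)
  have "tensor_rels R M N \<subseteq> kernel ?F G k"
    unfolding tensor_rels_def kernel_def
    by (auto simp del: carrier_free_Abelian_group_iff intro!: minus
        simp: kminus minus kof closed add_left add_right balanced cancel)
  then have "?K \<subseteq> kernel ?F G k"
    unfolding tensor_kernel_def by (rule F.generate_subgroup_incl[OF _ k.subgroup_kernel])
  from k.FactGroup_universal_kernel[OF nrm this]
  obtain g where g: "g \<in> hom (tensor_group R M N) G"
    and gK: "\<And>c. c \<in> carrier ?F \<Longrightarrow> g (?K #>\<^bsub>?F\<^esub> c) = k c"
    unfolding tensor_group_def by blast
  let ?g = "restrict g (carrier (tensor_group R M N))"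
  show ?thesis
  proof (rule ex1I[of _ ?g])
    have "?g \<in> hom (tensor_group R M N) G"
      using g by (auto simp: hom_def)
    moreover have "?g (pure_tensor R M N x y) = \<beta> x y" if "x \<in> carrier M" "y \<in> carrier N" for x y
      using that by (auto simp: pure_tensor_def carT gK kof)
    ultimately show "?g \<in> hom (tensor_group R M N) G \<inter> extensional (carrier (tensor_group R M N)) \<and>
      (\<forall>x\<in>carrier M. \<forall>y\<in>carrier N. ?g (pure_tensor R M N x y) = \<beta> x y)"
      by auto
  next
    fix h
    assume h: "h \<in> hom (tensor_group R M N) G \<inter> extensional (carrier (tensor_group R M N)) \<and>
      (\<forall>x\<in>carrier M. \<forall>y\<in>carrier N. h (pure_tensor R M N x y) = \<beta> x y)"
    have hp: "h \<circ> (\<lambda>c. ?K #>\<^bsub>?F\<^esub> c) \<in> hom ?F G"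
      using h proj by (blast intro: hom_compose)
    interpret hp: group_hom ?F G "h \<circ> (\<lambda>c. ?K #>\<^bsub>?F\<^esub> c)"
      using hp by (simp add: group_hom_def group_hom_axioms_def)
    have eq: "(h \<circ> (\<lambda>c. ?K #>\<^bsub>?F\<^esub> c)) c = k c" if "Poly_Mapping.keys c \<subseteq> ?S" for c
      using that
    proof (rule free_Abelian_group_induct[where P = "\<lambda>c. (h \<circ> (\<lambda>c. ?K #>\<^bsub>?F\<^esub> c)) c = k c"])
      show "(h \<circ> (\<lambda>c. ?K #>\<^bsub>?F\<^esub> c)) 0 = k 0"
        using hp.hom_one k.hom_one by simp
    next
      fix a b
      assume "Poly_Mapping.keys a \<subseteq> ?S" "Poly_Mapping.keys b \<subseteq> ?S"
        "(h \<circ> (\<lambda>c. ?K #>\<^bsub>?F\<^esub> c)) a = k a" "(h \<circ> (\<lambda>c. ?K #>\<^bsub>?F\<^esub> c)) b = k b"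
      then show "(h \<circ> (\<lambda>c. ?K #>\<^bsub>?F\<^esub> c)) (a - b) = k (a - b)"
        using minus_hom[OF hp, of a b] kminus[of a b] by simp
    next
      fix z assume "z \<in> ?S"
      then show "(h \<circ> (\<lambda>c. ?K #>\<^bsub>?F\<^esub> c)) (frag_of z) = k (frag_of z)"
        using h kof by (auto simp: pure_tensor_def)
    qed
    show "h = ?g"
    proof (rule extensionalityI)
      show "h \<in> extensional (carrier (tensor_group R M N))" using h by blast
      show "?g \<in> extensional (carrier (tensor_group R M N))" by simp
      fix t assume "t \<in> carrier (tensor_group R M N)"
      then obtain c where "c \<in> carrier ?F" "t = ?K #>\<^bsub>?F\<^esub> c" using carT by auto
      then show "h t = ?g t" using eq[of c] gK[of c] by (auto simp: carT)
    qed
  qed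
qed

text \<open>The multiplicative part of \<open>tensor R M N\<close> is meaningful only for algebras; it does not affect
  the underlying module.\<close>

definition tensor ::
  "('k, 'r) ring_scheme \<Rightarrow> ('k, 'a, 'x) module_scheme \<Rightarrow> ('k, 'b, 'y) module_scheme
    \<Rightarrow> ('k, ('a \<times> 'b \<Rightarrow>\<^sub>0 int) set) module" where
  "tensor R M N =
     \<lparr>carrier = carrier (tensor_group R M N),
      monoid.mult = (\<lambda>s t.
        tensor_lift R M N (tensor_group R M N)
          (\<lambda>x y. tensor_lift R M N (tensor_group R M N)
             (\<lambda>x' y'. pure_tensor R M N (x \<otimes>\<^bsub>M\<^esub> x') (y \<otimes>\<^bsub>N\<^esub> y')) t) s),
      one = pure_tensor R M N \<one>\<^bsub>M\<^esub> \<one>\<^bsub>N\<^esub>,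
      ring.zero = \<one>\<^bsub>tensor_group R M N\<^esub>,
      ring.add = monoid.mult (tensor_group R M N),
      smult = (\<lambda>r. tensor_lift R M N (tensor_group R M N)
                 (\<lambda>x y. pure_tensor R M N (r \<odot>\<^bsub>M\<^esub> x) y))\<rparr>"

text \<open>For linear maps \<open>f : M \<rightarrow> M'\<close> and \<open>g : N \<rightarrow> N'\<close>, the map \<open>f \<otimes> g\<close> from \<open>M \<otimes> N\<close> to \<open>M' \<otimes> N'\<close>.\<close>

definition tensor_map where
  "tensor_map R M N M' N' f g =
     tensor_lift R M N (tensor_group R M' N') (\<lambda>x y. pure_tensor R M' N' (f x) (g y))"

text \<open>Iterated tensor products are nested to the right; \<open>tensor_lift3\<close> is the map induced by a
  trilinear map on \<open>A \<otimes> (B \<otimes> C)\<close>.\<close>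

definition tensor_lift3 where
  "tensor_lift3 R A B C G \<beta> =
     tensor_lift R A (tensor R B C) G (\<lambda>a. tensor_lift R B C G (\<beta> a))"

abbreviation tensor3 where
  "tensor3 R A B C \<equiv> tensor R A (tensor R B C)"

text \<open>The associator \<open>(A \<otimes> B) \<otimes> C \<rightarrow> A \<otimes> (B \<otimes> C)\<close>.\<close>

definition tensor_assoc where
  "tensor_assoc R A B C =
     tensor_lift R (tensor R A B) C (tensor_group R A (tensor R B C))
       (\<lambda>s c. tensor_lift R A B (tensor_group R A (tensor R B C))
          (\<lambda>a b. pure_tensor R A (tensor R B C) a (pure_tensor R B C b c)) s)"

text \<open>The rebracketing \<open>(A \<otimes> (B \<otimes> C)) \<otimes> D \<rightarrow> A \<otimes> (B \<otimes> (C \<otimes> D))\<close>.\<close>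

definition tensor_assoc3 where
  "tensor_assoc3 R A B C D =
     tensor_map R A (tensor R (tensor R B C) D) A (tensor3 R B C D) id (tensor_assoc R B C D)
       \<circ> tensor_assoc R A (tensor R B C) D"


section \<open>Faithful flatness\<close>

text \<open>\<open>M\<close> is faithfully flat if a sequence of linear maps \<open>N1 \<rightarrow> N2 \<rightarrow> N3\<close> is exact exactly when
  \<open>M \<otimes> N1 \<rightarrow> M \<otimes> N2 \<rightarrow> M \<otimes> N3\<close> is.

  A formula cannot quantify over types, so the modules \<open>N1\<close>, \<open>N2\<close>, \<open>N3\<close> range over all modules with
  elements in one fixed type, which has to be large enough to lose no generality. Since
  \<^typ>\<open>'a list\<close> is infinite, every quotient of a free module with at most \<open>|'a list|\<close>
  generators, in particular every finitely generated module, has an isomorphic copy with elements in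
  \<^typ>\<open>('a list \<Rightarrow> 'k) set\<close> (cosets of finitely supported families). Testing on such modules is
  the same as testing on all modules: flatness only needs the inclusions of finitely generated ideals
  into the ring (and the zero module), and a flat \<open>M\<close> is faithfully flat as soon as \<open>M \<otimes> N\<close> is
  nonzero for every nonzero cyclic \<open>N\<close>.\<close>

definition faithfully_flat :: "('k, 'r) ring_scheme \<Rightarrow> ('k, 'a, 'x) module_scheme \<Rightarrow> bool" where
  "faithfully_flat R M \<longleftrightarrow>
     module R M \<and>
     (\<forall>(N1 :: ('k, ('a list \<Rightarrow> 'k) set) module) (N2 :: ('k, ('a list \<Rightarrow> 'k) set) module)
        (N3 :: ('k, ('a list \<Rightarrow> 'k) set) module) f g.
        module R N1 \<and> module R N2 \<and> module R N3 \<and>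
        f \<in> linear_maps R N1 N2 \<and> g \<in> linear_maps R N2 N3 \<longrightarrow>
        (f ` carrier N1 = a_kernel N2 N3 g \<longleftrightarrow>
         tensor_map R M N1 M N2 id f ` carrier (tensor R M N1) =
           a_kernel (tensor R M N2) (tensor R M N3) (tensor_map R M N2 M N3 id g)))"


section \<open>Torsors and Grunspan maps\<close>

text \<open>In the first axiom both sides are elements of \<open>T \<otimes> (T\<^sup>o\<^sup>p \<otimes> (T \<otimes> (T\<^sup>o\<^sup>p \<otimes> T)))\<close>.\<close>

locale torsor = assoc_algebra R T for R (structure) and T (structure) +
  fixes \<mu>
  assumes mu_hom: "\<mu> \<in> algebra_homs R T (tensor3 R T (opp T) T)"
    and mu_coassoc: "x \<in> carrier T \<Longrightarrow>
        tensor_assoc3 R T (opp T) T (tensor R (opp T) T)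
          (tensor_map R T (tensor R (opp T) T) (tensor3 R T (opp T) T) (tensor R (opp T) T) \<mu> id (\<mu> x)) =
        tensor_map R T (tensor R (opp T) T) T (tensor R (opp T) (tensor3 R T (opp T) T)) id
          (tensor_map R (opp T) T (opp T) (tensor3 R T (opp T) T) id \<mu>) (\<mu> x)"
    and mu_left: "x \<in> carrier T \<Longrightarrow>
        tensor_lift3 R T (opp T) T (tensor_group R T T)
          (\<lambda>a b c. pure_tensor R T T (a \<otimes>\<^bsub>T\<^esub> b) c) (\<mu> x) = pure_tensor R T T \<one>\<^bsub>T\<^esub> x"
    and mu_right: "x \<in> carrier T \<Longrightarrow>
        tensor_lift3 R T (opp T) T (tensor_group R T T)
          (\<lambda>a b c. pure_tensor R T T a (b \<otimes>\<^bsub>T\<^esub> c)) (\<mu> x) = pure_tensor R T T x \<one>\<^bsub>T\<^esub>"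

definition mu_op where
  "mu_op R T \<mu> x =
     tensor_lift3 R T (opp T) T (tensor_group R (opp T) (tensor R T (opp T)))
       (\<lambda>a b c. pure_tensor R (opp T) (tensor R T (opp T)) c (pure_tensor R T (opp T) b a)) (\<mu> x)"

text \<open>Both sides of the first equation are elements of \<open>T \<otimes> (T\<^sup>o\<^sup>p \<otimes> (T \<otimes> (T\<^sup>o\<^sup>p \<otimes> T)))\<close>.\<close>

definition grunspan_map where
  "grunspan_map R T \<mu> \<theta> \<longleftrightarrow>
     \<theta> \<in> algebra_homs R T T \<and>
     (\<forall>x\<in>carrier T.
        tensor_map R T (tensor R (opp T) (tensor3 R T (opp T) T)) T (tensor R (opp T) (tensor3 R T (opp T) T)) id
          (tensor_map R (opp T) (tensor3 R T (opp T) T) (opp T) (tensor3 R T (opp T) T) id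
             (tensor_map R T (tensor R (opp T) T) T (tensor R (opp T) T) \<theta> id))
          (tensor_assoc3 R T (opp T) T (tensor R (opp T) T)
             (tensor_map R T (tensor R (opp T) T) (tensor3 R T (opp T) T) (tensor R (opp T) T) \<mu> id (\<mu> x))) =
        tensor_map R T (tensor R (tensor3 R (opp T) T (opp T)) T) T (tensor R (opp T) (tensor3 R T (opp T) T)) id
          (tensor_assoc3 R (opp T) T (opp T) T)
          (tensor_map R T (tensor R (opp T) T) T (tensor R (tensor3 R (opp T) T (opp T)) T) id
             (tensor_map R (opp T) T (tensor3 R (opp T) T (opp T)) T (mu_op R T \<mu>) id) (\<mu> x))) \<and>
     (\<forall>x\<in>carrier T.
        tensor_map R T (tensor R (opp T) T) T (tensor R (opp T) T) \<theta>
          (tensor_map R (opp T) T (opp T) T \<theta> \<theta>) (\<mu> x) = \<mu> (\<theta> x))"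

end

theory Submission
  imports Defs
begin

text \<open>Write \<open>x\<^sub>1 \<otimes> x\<^sub>2 \<otimes> x\<^sub>3\<close> for \<open>\<mu> x\<close> and \<open>x\<^sub>2\<^sub>1 \<otimes> x\<^sub>2\<^sub>2 \<otimes> x\<^sub>2\<^sub>3\<close> for \<open>\<mu> x\<^sub>2\<close>. The Grunspan map is
  \<open>\<theta> x = x\<^sub>1 x\<^sub>2\<^sub>3 x\<^sub>2\<^sub>2 x\<^sub>2\<^sub>1 x\<^sub>3\<close>. It is forced by the first Grunspan
  equation: contracting the outer factors shows that
  \<open>E x = x\<^sub>1x\<^sub>2\<^sub>3 \<otimes> x\<^sub>2\<^sub>2 \<otimes> x\<^sub>2\<^sub>1x\<^sub>3\<close> has to be \<open>1 \<otimes> \<theta> x \<otimes> 1\<close>. Conversely, the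
  torsor axioms imply that \<open>E x\<close> is equalized by the insertions of \<open>1\<close> before and after its first
  factor, and likewise for its last factor, so faithfully flat descent yields
  \<open>E x = 1 \<otimes> \<theta> x \<otimes> 1\<close>. Together with coassociativity this identity gives
  \<open>1 \<otimes> \<theta> x\<^sub>1 \<otimes> x\<^sub>2 \<otimes> x\<^sub>3 = x\<^sub>1x\<^sub>2\<^sub>3 \<otimes> x\<^sub>2\<^sub>2 \<otimes> x\<^sub>2\<^sub>1 \<otimes> x\<^sub>3\<close>, from which
  multiplicativity and both Grunspan equations follow.\<close>

section \<open>Linear maps and finite sums\<close>

text \<open>The torsor identities are not manipulated inside iterated tensor products. They are
  tested by multilinear maps into an arbitrary module \<open>G\<close>, where they become equations
  between finite sums, and taking \<open>G\<close> to be the tensor product itself gives them back.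
  The chosen decompositions \<open>\<rho>\<close> of \<open>\<mu>\<close> are neither linear nor
  canonical; what is linear in \<open>x\<close> is the sum of a multilinear map over
  \<open>\<rho> x\<close>.

  Two obstacles shape the descent part. Faithful flatness speaks about modules on one fixed type, so
  the tensor powers of \<open>T\<close> have to be copied into it injectively; this uses two
  distinct elements of \<open>T\<close>, and the zero algebra is treated apart. Moreover, descent
  needs the two insertions of 1 to agree on \<open>E x\<close>. For the last factor this rests on
  the multiplicativity of \<open>\<mu>\<close>: two copies of \<open>\<mu>\<close> are merged into
  \<open>\<mu>\<close> of a product that contracts to 1. For the first factor it is the mirror image
  in the opposite torsor, so only one of the two computations is carried out.\<close>

lemma linear_mapsI:
  assumes "\<And>x. x \<in> carrier M \<Longrightarrow> f x \<in> carrier N"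
    and "\<And>x y. \<lbrakk>x \<in> carrier M; y \<in> carrier M\<rbrakk> \<Longrightarrow> f (x \<oplus>\<^bsub>M\<^esub> y) = f x \<oplus>\<^bsub>N\<^esub> f y"
    and "\<And>r x. \<lbrakk>r \<in> carrier R; x \<in> carrier M\<rbrakk> \<Longrightarrow> f (r \<odot>\<^bsub>M\<^esub> x) = r \<odot>\<^bsub>N\<^esub> f x"
  shows "f \<in> linear_maps R M N"
  using assms by (auto simp: linear_maps_def hom_def)

lemma linear_maps_closed: "\<lbrakk>f \<in> linear_maps R M N; x \<in> carrier M\<rbrakk> \<Longrightarrow> f x \<in> carrier N"
  and linear_maps_add: "\<lbrakk>f \<in> linear_maps R M N; x \<in> carrier M; y \<in> carrier M\<rbrakk> \<Longrightarrow>
    f (x \<oplus>\<^bsub>M\<^esub> y) = f x \<oplus>\<^bsub>N\<^esub> f y"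
  and linear_maps_smult: "\<lbrakk>f \<in> linear_maps R M N; r \<in> carrier R; x \<in> carrier M\<rbrakk> \<Longrightarrow>
    f (r \<odot>\<^bsub>M\<^esub> x) = r \<odot>\<^bsub>N\<^esub> f x"
  by (auto simp: linear_maps_def hom_def)

lemma linear_maps_zero:
  assumes "module R M" "module R N" "f \<in> linear_maps R M N"
  shows "f \<zero>\<^bsub>M\<^esub> = \<zero>\<^bsub>N\<^esub>"
proof -
  interpret M: module R M by fact
  interpret N: module R N by fact
  have "f (\<zero>\<^bsub>R\<^esub> \<odot>\<^bsub>M\<^esub> \<zero>\<^bsub>M\<^esub>) = \<zero>\<^bsub>R\<^esub> \<odot>\<^bsub>N\<^esub> f \<zero>\<^bsub>M\<^esub>"
    using assms by (intro linear_maps_smult) auto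
  then show ?thesis using linear_maps_closed[OF assms(3)] by simp
qed

lemma linear_maps_id: "(\<lambda>x. x) \<in> linear_maps R M M"
  by (rule linear_mapsI) auto

lemma linear_maps_comp:
  "\<lbrakk>f \<in> linear_maps R M N; g \<in> linear_maps R N P\<rbrakk> \<Longrightarrow> (\<lambda>x. g (f x)) \<in> linear_maps R M P"
  by (rule linear_mapsI) (simp_all add: linear_maps_closed linear_maps_add linear_maps_smult)

text \<open>Lists instead of an indexed family: a decomposition may repeat a simple tensor, and
  lists can be concatenated and coded without choosing index sets.\<close>

definition lsum :: "('g, 'z) ring_scheme \<Rightarrow> 'g list \<Rightarrow> 'g" where
  "lsum G zs = foldr (\<lambda>x y. x \<oplus>\<^bsub>G\<^esub> y) zs \<zero>\<^bsub>G\<^esub>"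

lemma lsum_simps [simp]: "lsum G [] = \<zero>\<^bsub>G\<^esub>" "lsum G (z # zs) = z \<oplus>\<^bsub>G\<^esub> lsum G zs"
  by (simp_all add: lsum_def)

context abelian_group
begin

lemma lsum_closed: "set zs \<subseteq> carrier G \<Longrightarrow> lsum G zs \<in> carrier G"
  by (induction zs) auto

lemma lsum_append:
  "\<lbrakk>set zs \<subseteq> carrier G; set ws \<subseteq> carrier G\<rbrakk> \<Longrightarrow> lsum G (zs @ ws) = lsum G zs \<oplus> lsum G ws"
  by (induction zs) (auto simp: lsum_closed a_assoc)

lemma lsum_zero: "lsum G (map (\<lambda>_. \<zero>) xs) = \<zero>"
  by (induction xs) auto

lemma lsum_add:
  "\<lbrakk>\<And>x. x \<in> set xs \<Longrightarrow> f x \<in> carrier G; \<And>x. x \<in> set xs \<Longrightarrow> g x \<in> carrier G\<rbrakk> \<Longrightarrow>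
    lsum G (map (\<lambda>x. f x \<oplus> g x) xs) = lsum G (map f xs) \<oplus> lsum G (map g xs)"
proof (induction xs)
  case (Cons x xs)
  have "lsum G (map f xs) \<in> carrier G" "lsum G (map g xs) \<in> carrier G"
    using Cons.prems by (auto intro!: lsum_closed)
  with Cons show ?case by (simp add: a_ac)
qed simp

lemma lsum_swap:
  assumes "\<And>x y. \<lbrakk>x \<in> set xs; y \<in> set ys\<rbrakk> \<Longrightarrow> f x y \<in> carrier G"
  shows "lsum G (map (\<lambda>x. lsum G (map (f x) ys)) xs) = lsum G (map (\<lambda>y. lsum G (map (\<lambda>x. f x y) xs)) ys)"
  using assms
proof (induction xs)
  case Nil
  then show ?case by (simp add: lsum_zero)
next
  case (Cons x xs)
  have "lsum G (map (\<lambda>y. f x y \<oplus> lsum G (map (\<lambda>x. f x y) xs)) ys) =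
      lsum G (map (f x) ys) \<oplus> lsum G (map (\<lambda>y. lsum G (map (\<lambda>x. f x y) xs)) ys)"
    using Cons.prems by (intro lsum_add lsum_closed) auto
  with Cons show ?case by simp
qed

end

lemma linear_maps_lsum:
  assumes "module R M" "module R N" "f \<in> linear_maps R M N" "set zs \<subseteq> carrier M"
  shows "f (lsum M zs) = lsum N (map f zs)"
  using assms(4)
proof (induction zs)
  case Nil
  then show ?case using assms by (simp add: linear_maps_zero)
next
  case (Cons z zs)
  interpret M: module R M by fact
  show ?case using Cons assms(3) by (simp add: linear_maps_add M.lsum_closed)
qed

section \<open>The tensor product as a module\<close>

lemma opp_simps [simp]:
  "carrier (opp A) = carrier A" "ring.add (opp A) = ring.add A" "ring.zero (opp A) = ring.zero A"
  "smult (opp A) = smult A" "monoid.one (opp A) = monoid.one A" "x \<otimes>\<^bsub>opp A\<^esub> y = y \<otimes>\<^bsub>A\<^esub> x"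
  by (simp_all add: opp_def)

lemma tensor_simps:
  "carrier (tensor R M N) = carrier (tensor_group R M N)"
  "ring.zero (tensor R M N) = \<one>\<^bsub>tensor_group R M N\<^esub>"
  "ring.add (tensor R M N) = monoid.mult (tensor_group R M N)"
  by (simp_all add: tensor_def)

text \<open>The quotient group is written multiplicatively, while \<open>tensor R M N\<close> stores
  the same operation in its additive fields; the group laws mention only carrier, operation and
  unit, so they carry over.\<close>

lemma comm_group_cong:
  assumes "comm_group G" "carrier H = carrier G" "monoid.mult H = monoid.mult G" "\<one>\<^bsub>H\<^esub> = \<one>\<^bsub>G\<^esub>"
  shows "comm_group H"
proof -
  interpret comm_group G by fact
  show ?thesis
    by (rule comm_groupI) (use assms in \<open>auto simp: m_assoc intro: l_inv_ex m_comm\<close>)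
qed

locale module_pair = M: module R M + N: module R N for R (structure) and M N
begin

abbreviation F where "F \<equiv> free_Abelian_group (carrier M \<times> carrier N)"
abbreviation K where "K \<equiv> tensor_kernel R M N"
abbreviation pt where "pt \<equiv> pure_tensor R M N"
abbreviation TP where "TP \<equiv> tensor R M N"

sublocale F: comm_group F by (rule abelian_free_Abelian_group)

lemma F_minus: "\<lbrakk>a \<in> carrier F; b \<in> carrier F\<rbrakk> \<Longrightarrow> a - b \<in> carrier F"
  using keys_diff[of a b] by auto

lemma rels: "tensor_rels R M N \<subseteq> carrier F"
  unfolding tensor_rels_def by (auto intro!: F_minus)

lemma K_subgroup: "subgroup K F"
  unfolding tensor_kernel_def by (rule F.generate_is_subgroup[OF rels])

lemma K_normal: "K \<lhd> F"
  using K_subgroup by (simp add: F.subgroup_imp_normal)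

lemma comm_group_tensor: "comm_group (tensor_group R M N)"
  unfolding tensor_group_def by (rule F.abelian_FactGroup[OF K_subgroup])

sublocale TG: abelian_group TP
  by (rule comm_group_abelian_groupI, rule comm_group_cong[OF comm_group_tensor])
    (simp_all add: tensor_simps)

lemma carrier_tensor: "carrier TP = (\<lambda>c. K #>\<^bsub>F\<^esub> c) ` carrier F"
  by (auto simp: tensor_simps tensor_group_def FactGroup_def RCOSETS_def)

lemma proj_hom: "(\<lambda>c. K #>\<^bsub>F\<^esub> c) \<in> hom F (add_monoid TP)"
  using normal.r_coset_hom_Mod[OF K_normal]
  by (simp add: hom_def tensor_simps tensor_group_def)

lemma proj_add:
  "\<lbrakk>a \<in> carrier F; b \<in> carrier F\<rbrakk> \<Longrightarrow> K #>\<^bsub>F\<^esub> (a + b) = (K #>\<^bsub>F\<^esub> a) \<oplus>\<^bsub>TP\<^esub> (K #>\<^bsub>F\<^esub> b)"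
  using hom_mult[OF proj_hom] by simp

lemma proj_closed: "a \<in> carrier F \<Longrightarrow> K #>\<^bsub>F\<^esub> a \<in> carrier TP"
  unfolding carrier_tensor by blast

lemma proj_rel:
  assumes "a \<in> tensor_rels R M N" shows "K #>\<^bsub>F\<^esub> a = \<zero>\<^bsub>TP\<^esub>"
proof -
  have "a \<in> K" using assms unfolding tensor_kernel_def by (rule generate.incl)
  then have "K #>\<^bsub>F\<^esub> a = K"
    using F.coset_join2[OF _ K_subgroup, of a] assms rels by blast
  then show ?thesis by (simp add: tensor_simps tensor_group_def FactGroup_def)
qed

lemma pure_closed [simp, intro]: "\<lbrakk>x \<in> carrier M; y \<in> carrier N\<rbrakk> \<Longrightarrow> pt x y \<in> carrier TP"
  unfolding pure_tensor_def by (rule proj_closed) simp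

lemma frag_of_closed: "\<lbrakk>x \<in> carrier M; y \<in> carrier N\<rbrakk> \<Longrightarrow> frag_of (x, y) \<in> carrier F"
  by simp

lemma pure_add_left:
  assumes "x \<in> carrier M" "x' \<in> carrier M" "y \<in> carrier N"
  shows "pt (x \<oplus>\<^bsub>M\<^esub> x') y = pt x y \<oplus>\<^bsub>TP\<^esub> pt x' y"
proof -
  let ?d = "frag_of (x \<oplus>\<^bsub>M\<^esub> x', y) - frag_of (x, y) - frag_of (x', y)"
  have d: "?d \<in> tensor_rels R M N" unfolding tensor_rels_def using assms by blast
  then have dF: "?d \<in> carrier F" using rels by blast
  have "frag_of (x \<oplus>\<^bsub>M\<^esub> x', y) = ?d + (frag_of (x, y) + frag_of (x', y))" by simp
  then have "pt (x \<oplus>\<^bsub>M\<^esub> x') y = K #>\<^bsub>F\<^esub> (?d + (frag_of (x, y) + frag_of (x', y)))"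
    unfolding pure_tensor_def by simp
  also have "\<dots> = \<zero>\<^bsub>TP\<^esub> \<oplus>\<^bsub>TP\<^esub> (pt x y \<oplus>\<^bsub>TP\<^esub> pt x' y)"
    using assms dF proj_rel[OF d] frag_of_closed F.m_closed[of "frag_of (x, y)" "frag_of (x', y)"]
    by (simp only: proj_add pure_tensor_def mult_free_Abelian_group)
  finally show ?thesis using assms by simp
qed

lemma pure_add_right:
  assumes "x \<in> carrier M" "y \<in> carrier N" "y' \<in> carrier N"
  shows "pt x (y \<oplus>\<^bsub>N\<^esub> y') = pt x y \<oplus>\<^bsub>TP\<^esub> pt x y'"
proof -
  let ?d = "frag_of (x, y \<oplus>\<^bsub>N\<^esub> y') - frag_of (x, y) - frag_of (x, y')"
  have d: "?d \<in> tensor_rels R M N" unfolding tensor_rels_def using assms by blast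
  then have dF: "?d \<in> carrier F" using rels by blast
  have "frag_of (x, y \<oplus>\<^bsub>N\<^esub> y') = ?d + (frag_of (x, y) + frag_of (x, y'))" by simp
  then have "pt x (y \<oplus>\<^bsub>N\<^esub> y') = K #>\<^bsub>F\<^esub> (?d + (frag_of (x, y) + frag_of (x, y')))"
    unfolding pure_tensor_def by simp
  also have "\<dots> = \<zero>\<^bsub>TP\<^esub> \<oplus>\<^bsub>TP\<^esub> (pt x y \<oplus>\<^bsub>TP\<^esub> pt x y')"
    using assms dF proj_rel[OF d] frag_of_closed F.m_closed[of "frag_of (x, y)" "frag_of (x, y')"]
    by (simp only: proj_add pure_tensor_def mult_free_Abelian_group)
  finally show ?thesis using assms by simp
qed

lemma pure_balanced:
  assumes "r \<in> carrier R" "x \<in> carrier M" "y \<in> carrier N"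
  shows "pt (r \<odot>\<^bsub>M\<^esub> x) y = pt x (r \<odot>\<^bsub>N\<^esub> y)"
proof -
  let ?d = "frag_of (r \<odot>\<^bsub>M\<^esub> x, y) - frag_of (x, r \<odot>\<^bsub>N\<^esub> y)"
  have d: "?d \<in> tensor_rels R M N" unfolding tensor_rels_def using assms by blast
  then have dF: "?d \<in> carrier F" using rels by blast
  have "frag_of (r \<odot>\<^bsub>M\<^esub> x, y) = ?d + frag_of (x, r \<odot>\<^bsub>N\<^esub> y)" by simp
  then have "pt (r \<odot>\<^bsub>M\<^esub> x) y = K #>\<^bsub>F\<^esub> (?d + frag_of (x, r \<odot>\<^bsub>N\<^esub> y))"
    unfolding pure_tensor_def by simp
  also have "\<dots> = \<zero>\<^bsub>TP\<^esub> \<oplus>\<^bsub>TP\<^esub> pt x (r \<odot>\<^bsub>N\<^esub> y)"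
    using assms dF proj_rel[OF d] frag_of_closed
    by (simp only: proj_add pure_tensor_def N.smult_closed)
  finally show ?thesis using assms by simp
qed

lemma pure_zero_left: "y \<in> carrier N \<Longrightarrow> pt \<zero>\<^bsub>M\<^esub> y = \<zero>\<^bsub>TP\<^esub>"
  using pure_add_left[of "\<zero>\<^bsub>M\<^esub>" "\<zero>\<^bsub>M\<^esub>" y] TG.add.l_cancel_one[of "pt \<zero>\<^bsub>M\<^esub> y" "pt \<zero>\<^bsub>M\<^esub> y"] by simp

lemma pure_minus_left:
  assumes "x \<in> carrier M" "y \<in> carrier N" shows "pt (\<ominus>\<^bsub>M\<^esub> x) y = \<ominus>\<^bsub>TP\<^esub> pt x y"
  using pure_add_left[of "\<ominus>\<^bsub>M\<^esub> x" x y] assms pure_zero_left[of y]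
  by (intro TG.minus_equality[symmetric]) (auto simp: M.M.l_neg)

text \<open>Differences come from the induction principle of the free abelian group; they survive in
  the quotient because the projection is additive.\<close>

lemma tensor_minus_pure_induct [consumes 1, case_names zero pure minus]:
  assumes z: "z \<in> carrier TP"
    and zero: "P \<zero>\<^bsub>TP\<^esub>"
    and pure: "\<And>x y. \<lbrakk>x \<in> carrier M; y \<in> carrier N\<rbrakk> \<Longrightarrow> P (pt x y)"
    and minus: "\<And>a b. \<lbrakk>a \<in> carrier TP; b \<in> carrier TP; P a; P b\<rbrakk> \<Longrightarrow> P (a \<ominus>\<^bsub>TP\<^esub> b)"
  shows "P z"
proof -
  obtain c where c: "c \<in> carrier F" and z_c: "z = K #>\<^bsub>F\<^esub> c" using z carrier_tensor by auto
  from c have "Poly_Mapping.keys c \<subseteq> carrier M \<times> carrier N" by simp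
  then have "P (K #>\<^bsub>F\<^esub> c)"
  proof (rule free_Abelian_group_induct[where P = "\<lambda>c. P (K #>\<^bsub>F\<^esub> c)"])
    have "K #>\<^bsub>F\<^esub> 0 = \<zero>\<^bsub>TP\<^esub>"
      using F.coset_mult_one[of K] subgroup.subset[OF K_subgroup]
      by (simp add: tensor_simps tensor_group_def FactGroup_def)
    then show "P (K #>\<^bsub>F\<^esub> 0)" using zero by simp
  next
    fix a b assume a: "Poly_Mapping.keys a \<subseteq> carrier M \<times> carrier N"
      and b: "Poly_Mapping.keys b \<subseteq> carrier M \<times> carrier N"
      and P: "P (K #>\<^bsub>F\<^esub> a)" "P (K #>\<^bsub>F\<^esub> b)"
    have aF: "a \<in> carrier F" and bF: "b \<in> carrier F" using a b by auto
    have ab: "a - b \<in> carrier F" by (rule F_minus[OF aF bF])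
    have "K #>\<^bsub>F\<^esub> a = (K #>\<^bsub>F\<^esub> (a - b)) \<oplus>\<^bsub>TP\<^esub> (K #>\<^bsub>F\<^esub> b)"
      using proj_add[OF ab bF] by simp
    then have "K #>\<^bsub>F\<^esub> (a - b) = (K #>\<^bsub>F\<^esub> a) \<ominus>\<^bsub>TP\<^esub> (K #>\<^bsub>F\<^esub> b)"
      using proj_closed[OF ab] proj_closed[OF bF] by (simp add: TG.minus_eq TG.a_assoc TG.r_neg)
    then show "P (K #>\<^bsub>F\<^esub> (a - b))" using minus P aF bF by (simp add: proj_closed del: carrier_free_Abelian_group_iff)
  next
    fix u assume "u \<in> carrier M \<times> carrier N"
    then show "P (K #>\<^bsub>F\<^esub> frag_of u)" using pure unfolding pure_tensor_def by (cases u) auto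
  qed
  then show ?thesis using z_c by simp
qed

text \<open>A negative is absorbed into the left factor of each simple tensor, so no signs remain.
  This is what allows \<open>\<mu> x\<close> to be represented by a plain list of triples.\<close>

lemma tensor_sum_of_pures:
  assumes "z \<in> carrier TP"
  shows "\<exists>ps. set ps \<subseteq> carrier M \<times> carrier N \<and> z = lsum TP (map (\<lambda>(x, y). pt x y) ps)"
  using assms
proof (induction rule: tensor_minus_pure_induct)
  case zero
  then show ?case by (intro exI[of _ "[]"]) auto
next
  case (pure x y)
  then show ?case by (intro exI[of _ "[(x, y)]"]) (auto simp: TG.r_zero)
next
  case (minus a b)
  then obtain ps qs where
    ps: "set ps \<subseteq> carrier M \<times> carrier N" "a = lsum TP (map (\<lambda>(x, y). pt x y) ps)" and
    qs: "set qs \<subseteq> carrier M \<times> carrier N" "b = lsum TP (map (\<lambda>(x, y). pt x y) qs)" by blast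
  have neg: "\<ominus>\<^bsub>TP\<^esub> lsum TP (map (\<lambda>(x, y). pt x y) qs) =
      lsum TP (map (\<lambda>(x, y). pt x y) (map (\<lambda>(x, y). (\<ominus>\<^bsub>M\<^esub> x, y)) qs))"
    using qs(1)
  proof (induction qs)
    case (Cons q qs)
    have "lsum TP (map (\<lambda>(x, y). pt x y) qs) \<in> carrier TP"
      using Cons.prems by (intro TG.lsum_closed) auto
    moreover obtain x y where "q = (x, y)" "x \<in> carrier M" "y \<in> carrier N"
      using Cons.prems by auto
    ultimately show ?case using Cons by (simp add: TG.minus_add pure_minus_left)
  qed simp
  have "a \<ominus>\<^bsub>TP\<^esub> b = lsum TP (map (\<lambda>(x, y). pt x y) (ps @ map (\<lambda>(x, y). (\<ominus>\<^bsub>M\<^esub> x, y)) qs))"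
    unfolding map_append TG.minus_eq ps(2) qs(2) neg using ps(1) qs(1)
    by (intro TG.lsum_append[symmetric]) auto
  moreover have "set (ps @ map (\<lambda>(x, y). (\<ominus>\<^bsub>M\<^esub> x, y)) qs) \<subseteq> carrier M \<times> carrier N"
    using ps(1) qs(1) by auto
  ultimately show ?case by blast
qed

lemma tensor_induct [consumes 1, case_names zero pure add]:
  assumes z: "z \<in> carrier TP"
    and zero: "P \<zero>\<^bsub>TP\<^esub>"
    and pure: "\<And>x y. \<lbrakk>x \<in> carrier M; y \<in> carrier N\<rbrakk> \<Longrightarrow> P (pt x y)"
    and add: "\<And>a b. \<lbrakk>a \<in> carrier TP; b \<in> carrier TP; P a; P b\<rbrakk> \<Longrightarrow> P (a \<oplus>\<^bsub>TP\<^esub> b)"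
  shows "P z"
proof -
  obtain ps where ps: "set ps \<subseteq> carrier M \<times> carrier N" and z: "z = lsum TP (map (\<lambda>(x, y). pt x y) ps)"
    using tensor_sum_of_pures[OF z] by blast
  have "P (lsum TP (map (\<lambda>(x, y). pt x y) ps))" using ps
  proof (induction ps)
    case (Cons p ps)
    have "pt x y \<in> carrier TP" if "(x, y) \<in> set ps" for x y
      using that Cons.prems by auto
    then show ?case using Cons by (auto intro!: add pure TG.lsum_closed)
  qed (simp add: zero)
  then show ?thesis using z by simp
qed

end

section \<open>Bilinear maps and the universal property\<close>

definition linear2 where
  "linear2 R M N P \<beta> \<longleftrightarrow>
     (\<forall>y\<in>carrier N. (\<lambda>x. \<beta> x y) \<in> linear_maps R M P) \<and> (\<forall>x\<in>carrier M. \<beta> x \<in> linear_maps R N P)"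

lemma linear2I:
  assumes "\<And>y. y \<in> carrier N \<Longrightarrow> (\<lambda>x. \<beta> x y) \<in> linear_maps R M P"
    and "\<And>x. x \<in> carrier M \<Longrightarrow> (\<lambda>y. \<beta> x y) \<in> linear_maps R N P"
  shows "linear2 R M N P \<beta>"
  using assms by (simp add: linear2_def)

lemma linear2_closed: "\<lbrakk>linear2 R M N P \<beta>; x \<in> carrier M; y \<in> carrier N\<rbrakk> \<Longrightarrow> \<beta> x y \<in> carrier P"
  unfolding linear2_def by (blast intro: linear_maps_closed)

lemma linear2_left: "\<lbrakk>linear2 R M N P \<beta>; y \<in> carrier N\<rbrakk> \<Longrightarrow> (\<lambda>x. \<beta> x y) \<in> linear_maps R M P"
  and linear2_right: "\<lbrakk>linear2 R M N P \<beta>; x \<in> carrier M\<rbrakk> \<Longrightarrow> (\<lambda>y. \<beta> x y) \<in> linear_maps R N P"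
  by (auto simp: linear2_def)

text \<open>\<^const>\<open>tensor_lift\<close> takes a multiplicatively written target; \<open>presents G P\<close> says that \<open>G\<close> is the
  additive group of \<open>P\<close> in this role.\<close>

definition presents :: "('g, 'z) monoid_scheme \<Rightarrow> ('g, 'y) ring_scheme \<Rightarrow> bool" where
  "presents G P \<longleftrightarrow> carrier G = carrier P \<and> monoid.mult G = ring.add P \<and> \<one>\<^bsub>G\<^esub> = \<zero>\<^bsub>P\<^esub>"

lemma presents_add_monoid: "presents (add_monoid P) P"
  by (simp add: presents_def)

lemma presents_tensor_group: "presents (tensor_group R M N) (tensor R M N)"
  by (simp add: presents_def tensor_simps)

context module_pair
begin

lemma tensor_lift_spec:
  assumes "comm_group G"
    and "\<And>x y. \<lbrakk>x \<in> carrier M; y \<in> carrier N\<rbrakk> \<Longrightarrow> \<beta> x y \<in> carrier G"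
    and "\<And>x x' y. \<lbrakk>x \<in> carrier M; x' \<in> carrier M; y \<in> carrier N\<rbrakk> \<Longrightarrow>
      \<beta> (x \<oplus>\<^bsub>M\<^esub> x') y = \<beta> x y \<otimes>\<^bsub>G\<^esub> \<beta> x' y"
    and "\<And>x y y'. \<lbrakk>x \<in> carrier M; y \<in> carrier N; y' \<in> carrier N\<rbrakk> \<Longrightarrow>
      \<beta> x (y \<oplus>\<^bsub>N\<^esub> y') = \<beta> x y \<otimes>\<^bsub>G\<^esub> \<beta> x y'"
    and "\<And>r x y. \<lbrakk>r \<in> carrier R; x \<in> carrier M; y \<in> carrier N\<rbrakk> \<Longrightarrow>
      \<beta> (r \<odot>\<^bsub>M\<^esub> x) y = \<beta> x (r \<odot>\<^bsub>N\<^esub> y)"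
  shows "tensor_lift R M N G \<beta> \<in> hom (tensor_group R M N) G"
    and "\<And>x y. \<lbrakk>x \<in> carrier M; y \<in> carrier N\<rbrakk> \<Longrightarrow> tensor_lift R M N G \<beta> (pt x y) = \<beta> x y"
proof -
  have "\<exists>!h. h \<in> hom (tensor_group R M N) G \<inter> extensional (carrier (tensor_group R M N)) \<and>
      (\<forall>x\<in>carrier M. \<forall>y\<in>carrier N. h (pure_tensor R M N x y) = \<beta> x y)"
    using assms by (intro tensor_lift_unique M.module_axioms N.module_axioms) auto
  from theI'[OF this] show "tensor_lift R M N G \<beta> \<in> hom (tensor_group R M N) G"
    and "\<And>x y. \<lbrakk>x \<in> carrier M; y \<in> carrier N\<rbrakk> \<Longrightarrow> tensor_lift R M N G \<beta> (pt x y) = \<beta> x y"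
    unfolding tensor_lift_def by auto
qed

lemma tensor_smult:
  assumes r: "r \<in> carrier R"
  shows tensor_smult_pure:
      "\<And>x y. \<lbrakk>x \<in> carrier M; y \<in> carrier N\<rbrakk> \<Longrightarrow> r \<odot>\<^bsub>TP\<^esub> pt x y = pt (r \<odot>\<^bsub>M\<^esub> x) y"
    and tensor_smult_closed: "\<And>z. z \<in> carrier TP \<Longrightarrow> r \<odot>\<^bsub>TP\<^esub> z \<in> carrier TP"
    and tensor_smult_add: "\<And>z w. \<lbrakk>z \<in> carrier TP; w \<in> carrier TP\<rbrakk> \<Longrightarrow>
      r \<odot>\<^bsub>TP\<^esub> (z \<oplus>\<^bsub>TP\<^esub> w) = r \<odot>\<^bsub>TP\<^esub> z \<oplus>\<^bsub>TP\<^esub> r \<odot>\<^bsub>TP\<^esub> w"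
proof -
  let ?\<beta> = "\<lambda>x y. pt (r \<odot>\<^bsub>M\<^esub> x) y"
  have sm: "smult TP r = tensor_lift R M N (tensor_group R M N) ?\<beta>"
    by (simp add: tensor_def)
  \<comment> \<open>Commutativity of the base ring makes scaling the left factor by \<open>r\<close>
    balanced, hence well defined on the tensor product.\<close>
  have "r' \<odot>\<^bsub>M\<^esub> (r \<odot>\<^bsub>M\<^esub> x) = r \<odot>\<^bsub>M\<^esub> (r' \<odot>\<^bsub>M\<^esub> x)" if "r' \<in> carrier R" "x \<in> carrier M" for r' x
    using that r by (simp add: M.smult_assoc1[symmetric] M.m_comm)
  then have *: "?\<beta> (r' \<odot>\<^bsub>M\<^esub> x) y = ?\<beta> x (r' \<odot>\<^bsub>N\<^esub> y)"
    if "r' \<in> carrier R" "x \<in> carrier M" "y \<in> carrier N" for r' x y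
    using that r by (simp flip: pure_balanced)
  note spec = tensor_lift_spec[OF comm_group_tensor, of ?\<beta>, folded sm tensor_simps(1,3)]
  show "\<And>x y. \<lbrakk>x \<in> carrier M; y \<in> carrier N\<rbrakk> \<Longrightarrow> r \<odot>\<^bsub>TP\<^esub> pt x y = pt (r \<odot>\<^bsub>M\<^esub> x) y"
    using r * by (intro spec) (auto simp: M.smult_r_distr pure_add_left pure_add_right)
  have hom: "smult TP r \<in> hom (tensor_group R M N) (tensor_group R M N)"
    using r * by (intro spec) (auto simp: M.smult_r_distr pure_add_left pure_add_right)
  then show "\<And>z. z \<in> carrier TP \<Longrightarrow> r \<odot>\<^bsub>TP\<^esub> z \<in> carrier TP"
    and "\<And>z w. \<lbrakk>z \<in> carrier TP; w \<in> carrier TP\<rbrakk> \<Longrightarrow>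
      r \<odot>\<^bsub>TP\<^esub> (z \<oplus>\<^bsub>TP\<^esub> w) = r \<odot>\<^bsub>TP\<^esub> z \<oplus>\<^bsub>TP\<^esub> r \<odot>\<^bsub>TP\<^esub> w"
    by (auto simp: hom_def tensor_simps)
qed

lemma tensor_smult_zero: "r \<in> carrier R \<Longrightarrow> r \<odot>\<^bsub>TP\<^esub> \<zero>\<^bsub>TP\<^esub> = \<zero>\<^bsub>TP\<^esub>"
  using tensor_smult_add[of r "\<zero>\<^bsub>TP\<^esub>" "\<zero>\<^bsub>TP\<^esub>"] TG.add.l_cancel_one[of "r \<odot>\<^bsub>TP\<^esub> \<zero>\<^bsub>TP\<^esub>" "r \<odot>\<^bsub>TP\<^esub> \<zero>\<^bsub>TP\<^esub>"]
  by (simp add: tensor_smult_closed)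

lemma module_tensor: "module R TP"
proof (rule moduleI)
  show "cring R" by (rule M.R.is_cring)
  show "abelian_group TP" by (rule TG.abelian_group_axioms)
next
  fix r z assume "r \<in> carrier R" "z \<in> carrier TP"
  then show "r \<odot>\<^bsub>TP\<^esub> z \<in> carrier TP" by (rule tensor_smult_closed)
next
  fix r s z assume rs: "r \<in> carrier R" "s \<in> carrier R" and "z \<in> carrier TP"
  show "(r \<oplus> s) \<odot>\<^bsub>TP\<^esub> z = r \<odot>\<^bsub>TP\<^esub> z \<oplus>\<^bsub>TP\<^esub> s \<odot>\<^bsub>TP\<^esub> z"
    using \<open>z \<in> carrier TP\<close>
    by (induction rule: tensor_induct)
      (use rs in \<open>simp_all add: tensor_smult_zero tensor_smult_pure tensor_smult_add tensor_smult_closed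
        M.smult_l_distr pure_add_left TG.a_ac\<close>)
  show "(r \<otimes> s) \<odot>\<^bsub>TP\<^esub> z = r \<odot>\<^bsub>TP\<^esub> (s \<odot>\<^bsub>TP\<^esub> z)"
    using \<open>z \<in> carrier TP\<close>
    by (induction rule: tensor_induct)
      (use rs in \<open>simp_all add: tensor_smult_zero tensor_smult_pure tensor_smult_add tensor_smult_closed
        M.smult_assoc1\<close>)
next
  fix r z w assume "r \<in> carrier R" "z \<in> carrier TP" "w \<in> carrier TP"
  then show "r \<odot>\<^bsub>TP\<^esub> (z \<oplus>\<^bsub>TP\<^esub> w) = r \<odot>\<^bsub>TP\<^esub> z \<oplus>\<^bsub>TP\<^esub> r \<odot>\<^bsub>TP\<^esub> w" by (rule tensor_smult_add)
next
  fix z assume "z \<in> carrier TP"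
  then show "\<one> \<odot>\<^bsub>TP\<^esub> z = z"
    by (induction rule: tensor_induct) (simp_all add: tensor_smult_zero tensor_smult_pure tensor_smult_add)
qed

lemma linear2_pure: "linear2 R M N TP pt"
  by (intro linear2I linear_mapsI)
    (simp_all add: pure_add_left pure_add_right tensor_smult_pure pure_balanced)

lemma tensor_ext:
  assumes "module R P" "f \<in> linear_maps R TP P" "g \<in> linear_maps R TP P"
    and "\<And>x y. \<lbrakk>x \<in> carrier M; y \<in> carrier N\<rbrakk> \<Longrightarrow> f (pt x y) = g (pt x y)"
    and "z \<in> carrier TP"
  shows "f z = g z"
  using assms(5)
  by (induction rule: tensor_induct)
    (use assms module_tensor in \<open>simp_all add: linear_maps_zero linear_maps_add\<close>)

lemma tensor_lift_linear:
  assumes P: "module R P" and "presents G P"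
    and \<beta>: "linear2 R M N P \<beta>"
  shows tensor_lift_closed: "tensor_lift R M N G \<beta> \<in> linear_maps R TP P"
    and tensor_lift_pure:
      "\<And>x y. \<lbrakk>x \<in> carrier M; y \<in> carrier N\<rbrakk> \<Longrightarrow> tensor_lift R M N G \<beta> (pt x y) = \<beta> x y"
proof -
  interpret P: module R P by fact
  have G: "carrier G = carrier P" "monoid.mult G = ring.add P" "\<one>\<^bsub>G\<^esub> = \<zero>\<^bsub>P\<^esub>"
    using assms(2) by (simp_all add: presents_def)
  have comm: "comm_group G"
    by (rule comm_group_cong[OF P.a_comm_group]) (simp_all add: G)
  note bl = linear2_left[OF \<beta>] and br = linear2_right[OF \<beta>]
  note spec = tensor_lift_spec[OF comm, of \<beta>, unfolded G]
  note rules = linear2_closed[OF \<beta>] linear_maps_add[OF bl] linear_maps_add[OF br]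
  \<comment> \<open>Bilinearity over \<open>R\<close> implies balancedness: both sides are
    \<open>r\<close> times \<open>\<beta> x y\<close>.\<close>
  have bal: "\<beta> (r \<odot>\<^bsub>M\<^esub> x) y = \<beta> x (r \<odot>\<^bsub>N\<^esub> y)" if "r \<in> carrier R" "x \<in> carrier M" "y \<in> carrier N" for r x y
    using that linear_maps_smult[OF bl] linear_maps_smult[OF br] by simp
  show lift_pure: "tensor_lift R M N G \<beta> (pt x y) = \<beta> x y" if "x \<in> carrier M" "y \<in> carrier N" for x y
    by (rule spec) (simp_all add: rules bal that)
  have hom: "tensor_lift R M N G \<beta> \<in> hom (tensor_group R M N) G"
    by (rule spec) (simp_all add: rules bal)
  show "tensor_lift R M N G \<beta> \<in> linear_maps R TP P"
  proof (rule linear_mapsI)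
    show closed: "tensor_lift R M N G \<beta> z \<in> carrier P" if "z \<in> carrier TP" for z
      using hom that by (auto simp: hom_def tensor_simps G)
    show lift_add: "tensor_lift R M N G \<beta> (z \<oplus>\<^bsub>TP\<^esub> w) = tensor_lift R M N G \<beta> z \<oplus>\<^bsub>P\<^esub> tensor_lift R M N G \<beta> w"
      if "z \<in> carrier TP" "w \<in> carrier TP" for z w
      using hom that by (auto simp: hom_def tensor_simps G)
    have lift_zero: "tensor_lift R M N G \<beta> \<zero>\<^bsub>TP\<^esub> = \<zero>\<^bsub>P\<^esub>"
      using lift_add[of "\<zero>\<^bsub>TP\<^esub>" "\<zero>\<^bsub>TP\<^esub>"] closed[of "\<zero>\<^bsub>TP\<^esub>"] P.add.l_cancel_one by simp
    fix r z assume r: "r \<in> carrier R" and z: "z \<in> carrier TP"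
    from z show "tensor_lift R M N G \<beta> (r \<odot>\<^bsub>TP\<^esub> z) = r \<odot>\<^bsub>P\<^esub> tensor_lift R M N G \<beta> z"
    proof (induction rule: tensor_induct)
      case zero
      show ?case using r lift_zero tensor_smult_zero by simp
    next
      case (pure x y)
      then show ?case using r by (simp add: tensor_smult_pure pure lift_pure linear_maps_smult[OF bl])
    next
      case (add a b)
      then show ?case using r by (simp add: tensor_smult_add tensor_smult_closed closed lift_add P.smult_r_distr)
    qed
  qed
qed

end

text \<open>From here on the facts take the module assumptions as premises, so that they apply to
  nested tensor products by plain resolution, without one interpretation for each nesting.\<close>

lemma module_pairI: "\<lbrakk>module R M; module R N\<rbrakk> \<Longrightarrow> module_pair R M N"
  by (simp add: module_pair_def)

lemma module_tensor: "\<lbrakk>module R M; module R N\<rbrakk> \<Longrightarrow> module R (tensor R M N)"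
  by (rule module_pair.module_tensor[OF module_pairI])

lemma pure_tensor_closed:
  "\<lbrakk>module R M; module R N; x \<in> carrier M; y \<in> carrier N\<rbrakk> \<Longrightarrow>
    pure_tensor R M N x y \<in> carrier (tensor R M N)"
  by (rule module_pair.pure_closed[OF module_pairI])

lemma linear2_pure_tensor: "\<lbrakk>module R M; module R N\<rbrakk> \<Longrightarrow> linear2 R M N (tensor R M N) (pure_tensor R M N)"
  by (rule module_pair.linear2_pure[OF module_pairI])

lemma tensor_lift_closed:
  "\<lbrakk>module R M; module R N; module R P; presents G P; linear2 R M N P \<beta>\<rbrakk> \<Longrightarrow>
    tensor_lift R M N G \<beta> \<in> linear_maps R (tensor R M N) P"
  by (rule module_pair.tensor_lift_closed[OF module_pairI])

lemma tensor_lift_pure: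
  assumes "module R M" "module R N" "module R P" "presents G P" "linear2 R M N P \<beta>"
    "x \<in> carrier M" "y \<in> carrier N"
  shows "tensor_lift R M N G \<beta> (pure_tensor R M N x y) = \<beta> x y"
  by (rule module_pair.tensor_lift_pure[OF module_pairI]) fact+

lemma tensor_ext:
  assumes "module R M" "module R N" "module R P"
    "f \<in> linear_maps R (tensor R M N) P" "g \<in> linear_maps R (tensor R M N) P"
    "\<And>x y. \<lbrakk>x \<in> carrier M; y \<in> carrier N\<rbrakk> \<Longrightarrow> f (pure_tensor R M N x y) = g (pure_tensor R M N x y)"
    "z \<in> carrier (tensor R M N)"
  shows "f z = g z"
  by (rule module_pair.tensor_ext[OF module_pairI]) fact+

section \<open>Multilinear maps\<close>

definition linear3 where
  "linear3 R A B C P \<phi> \<longleftrightarrow>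
     (\<forall>b\<in>carrier B. \<forall>c\<in>carrier C. (\<lambda>a. \<phi> a b c) \<in> linear_maps R A P) \<and>
     (\<forall>a\<in>carrier A. linear2 R B C P (\<phi> a))"

definition linear4 where
  "linear4 R A B C D P \<phi> \<longleftrightarrow>
     (\<forall>b\<in>carrier B. \<forall>c\<in>carrier C. \<forall>d\<in>carrier D. (\<lambda>a. \<phi> a b c d) \<in> linear_maps R A P) \<and>
     (\<forall>a\<in>carrier A. linear3 R B C D P (\<phi> a))"

definition linear5 where
  "linear5 R A B C D E P \<phi> \<longleftrightarrow>
     (\<forall>b\<in>carrier B. \<forall>c\<in>carrier C. \<forall>d\<in>carrier D. \<forall>e\<in>carrier E.
        (\<lambda>a. \<phi> a b c d e) \<in> linear_maps R A P) \<and>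
     (\<forall>a\<in>carrier A. linear4 R B C D E P (\<phi> a))"

lemmas multilinear_defs = linear5_def linear4_def linear3_def linear2_def

lemma linear_maps_cong:
  assumes "module R M" "f \<in> linear_maps R M N" "\<And>x. x \<in> carrier M \<Longrightarrow> g x = f x"
  shows "g \<in> linear_maps R M N"
proof -
  interpret M: module R M by fact
  show ?thesis
    by (rule linear_mapsI) (use assms in \<open>simp_all add: linear_maps_closed linear_maps_add linear_maps_smult\<close>)
qed

lemma linear_maps_const_zero:
  assumes "module R N" shows "(\<lambda>_. \<zero>\<^bsub>N\<^esub>) \<in> linear_maps R M N"
proof -
  interpret N: module R N by fact
  show ?thesis by (rule linear_mapsI) auto
qed

lemma linear_maps_sum:
  assumes "module R N" "f \<in> linear_maps R M N" "g \<in> linear_maps R M N"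
  shows "(\<lambda>x. f x \<oplus>\<^bsub>N\<^esub> g x) \<in> linear_maps R M N"
proof -
  interpret N: module R N by fact
  show ?thesis
    by (rule linear_mapsI)
      (use assms(2,3) in \<open>auto simp: linear_maps_closed linear_maps_add linear_maps_smult N.smult_r_distr N.a_ac\<close>)
qed

text \<open>This is what lets lifts be nested: a lift in the inner variables, evaluated at a fixed
  tensor \<open>z\<close>, is linear in an outer parameter. On simple tensors this is the hypothesis
  \<open>left\<close>, and sums of linear maps are linear.\<close>

lemma tensor_lift_param_linear:
  assumes A: "module R A" and B: "module R B" and C: "module R C" and P: "module R P"
    and G: "presents G P"
    and left: "\<And>b c. \<lbrakk>b \<in> carrier B; c \<in> carrier C\<rbrakk> \<Longrightarrow> (\<lambda>a. \<psi> a b c) \<in> linear_maps R A P"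
    and right: "\<And>a. a \<in> carrier A \<Longrightarrow> linear2 R B C P (\<psi> a)"
    and z: "z \<in> carrier (tensor R B C)"
  shows "(\<lambda>a. tensor_lift R B C G (\<psi> a) z) \<in> linear_maps R A P"
proof -
  interpret module_pair R B C using B C by (rule module_pairI)
  note lift = tensor_lift_closed[OF P G right] tensor_lift_pure[OF P G right]
  show ?thesis using z
  proof (induction rule: tensor_induct)
    case zero
    then show ?case
      by (rule linear_maps_cong[OF A linear_maps_const_zero[OF P]])
        (rule linear_maps_zero[OF module_tensor P lift(1)])
  next
    case (pure x y)
    show ?case by (rule linear_maps_cong[OF A left[OF pure]]) (rule lift(2)[OF _ pure])
  next
    case (add z w)
    show ?case
      by (rule linear_maps_cong[OF A linear_maps_sum[OF P add(3,4)]])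
        (rule linear_maps_add[OF lift(1) add(1,2)])
  qed
qed

lemma linear2_tensor_lift:
  assumes "module R A" "module R B" "module R C" "module R P" "presents G P" "linear3 R A B C P \<phi>"
  shows "linear2 R A (tensor R B C) P (\<lambda>a. tensor_lift R B C G (\<phi> a))"
proof (rule linear2I)
  fix z assume "z \<in> carrier (tensor R B C)"
  with assms show "(\<lambda>a. tensor_lift R B C G (\<phi> a) z) \<in> linear_maps R A P"
    by (intro tensor_lift_param_linear) (auto simp: linear3_def)
next
  fix a assume "a \<in> carrier A"
  with assms show "(\<lambda>z. tensor_lift R B C G (\<phi> a) z) \<in> linear_maps R (tensor R B C) P"
    by (simp add: linear3_def tensor_lift_closed)
qed

lemma linear3_tensor_lift:
  assumes "module R A" "module R B" "module R C" "module R D" "module R P" "presents G P"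
    "linear4 R A B C D P \<phi>"
  shows "linear3 R A B (tensor R C D) P (\<lambda>a b. tensor_lift R C D G (\<phi> a b))"
  unfolding linear3_def
proof (intro conjI ballI)
  fix b z assume "b \<in> carrier B" "z \<in> carrier (tensor R C D)"
  with assms show "(\<lambda>a. tensor_lift R C D G (\<phi> a b) z) \<in> linear_maps R A P"
    by (intro tensor_lift_param_linear) (auto simp: linear3_def linear4_def)
next
  fix a assume "a \<in> carrier A"
  with assms show "linear2 R B (tensor R C D) P (\<lambda>b. tensor_lift R C D G (\<phi> a b))"
    by (intro linear2_tensor_lift) (auto simp: linear4_def)
qed

lemma linear4_tensor_lift:
  assumes "module R A" "module R B" "module R C" "module R D" "module R E" "module R P" "presents G P"
    "linear5 R A B C D E P \<phi>"
  shows "linear4 R A B C (tensor R D E) P (\<lambda>a b c. tensor_lift R D E G (\<phi> a b c))"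
  unfolding linear4_def
proof (intro conjI ballI)
  fix b c z assume "b \<in> carrier B" "c \<in> carrier C" "z \<in> carrier (tensor R D E)"
  with assms show "(\<lambda>a. tensor_lift R D E G (\<phi> a b c) z) \<in> linear_maps R A P"
    by (intro tensor_lift_param_linear) (auto simp: linear3_def linear4_def linear5_def)
next
  fix a assume "a \<in> carrier A"
  with assms show "linear3 R B C (tensor R D E) P (\<lambda>b c. tensor_lift R D E G (\<phi> a b c))"
    by (intro linear3_tensor_lift) (auto simp: linear5_def)
qed

lemma tensor_lift3_linear:
  assumes "module R A" "module R B" "module R C" "module R P" "presents G P" "linear3 R A B C P \<phi>"
  shows tensor_lift3_closed: "tensor_lift3 R A B C G \<phi> \<in> linear_maps R (tensor3 R A B C) P"
    and tensor_lift3_pure: "\<And>a b c. \<lbrakk>a \<in> carrier A; b \<in> carrier B; c \<in> carrier C\<rbrakk> \<Longrightarrow>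
      tensor_lift3 R A B C G \<phi> (pure_tensor R A (tensor R B C) a (pure_tensor R B C b c)) = \<phi> a b c"
proof -
  note lin2 = linear2_tensor_lift[OF assms]
  show "tensor_lift3 R A B C G \<phi> \<in> linear_maps R (tensor3 R A B C) P"
    unfolding tensor_lift3_def by (intro tensor_lift_closed module_tensor lin2 assms)
  fix a b c assume "a \<in> carrier A" "b \<in> carrier B" "c \<in> carrier C"
  moreover from this assms(6) have "linear2 R B C P (\<phi> a)" by (simp add: linear3_def)
  ultimately show "tensor_lift3 R A B C G \<phi> (pure_tensor R A (tensor R B C) a (pure_tensor R B C b c)) = \<phi> a b c"
    unfolding tensor_lift3_def using assms
    by (subst tensor_lift_pure[OF _ _ _ _ lin2]) (auto simp: module_tensor pure_tensor_closed tensor_lift_pure)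
qed

text \<open>The tensor product of the last two factors counts as a single third factor, which
  reduces the claim to \<open>tensor_lift3\<close>; the five-fold case below is reduced to this one
  in the same way.\<close>

lemma tensor4_lift_exists:
  assumes "module R A" "module R B" "module R C" "module R D" "module R P" "linear4 R A B C D P \<phi>"
  shows "\<exists>h \<in> linear_maps R (tensor R A (tensor3 R B C D)) P.
    \<forall>a\<in>carrier A. \<forall>b\<in>carrier B. \<forall>c\<in>carrier C. \<forall>d\<in>carrier D.
      h (pure_tensor R A (tensor3 R B C D) a (pure_tensor R B (tensor R C D) b (pure_tensor R C D c d))) = \<phi> a b c d"
proof (intro bexI ballI)
  note lin3 = linear3_tensor_lift[OF assms(1-5) presents_add_monoid assms(6)]
  let ?h = "tensor_lift3 R A B (tensor R C D) (add_monoid P) (\<lambda>a b. tensor_lift R C D (add_monoid P) (\<phi> a b))"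
  show "?h \<in> linear_maps R (tensor R A (tensor3 R B C D)) P"
    by (intro tensor_lift3_closed presents_add_monoid module_tensor lin3 assms)
  fix a b c d assume abcd: "a \<in> carrier A" "b \<in> carrier B" "c \<in> carrier C" "d \<in> carrier D"
  have "linear2 R C D P (\<phi> a b)" using assms(6) abcd by (simp add: linear4_def linear3_def)
  then show "?h (pure_tensor R A (tensor3 R B C D) a
      (pure_tensor R B (tensor R C D) b (pure_tensor R C D c d))) = \<phi> a b c d"
    using assms abcd
    by (subst tensor_lift3_pure[OF _ _ _ _ presents_add_monoid lin3])
      (simp_all add: tensor_lift_pure presents_add_monoid module_tensor pure_tensor_closed)
qed

lemma tensor5_lift_exists:
  assumes "module R A" "module R B" "module R C" "module R D" "module R E" "module R P"
    "linear5 R A B C D E P \<phi>"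
  shows "\<exists>h \<in> linear_maps R (tensor R A (tensor R B (tensor3 R C D E))) P.
    \<forall>a\<in>carrier A. \<forall>b\<in>carrier B. \<forall>c\<in>carrier C. \<forall>d\<in>carrier D. \<forall>e\<in>carrier E.
      h (pure_tensor R A (tensor R B (tensor3 R C D E)) a (pure_tensor R B (tensor3 R C D E) b
        (pure_tensor R C (tensor R D E) c (pure_tensor R D E d e)))) = \<phi> a b c d e"
proof -
  note lin4 = linear4_tensor_lift[OF assms(1-6) presents_add_monoid assms(7)]
  obtain h where h: "h \<in> linear_maps R (tensor R A (tensor R B (tensor3 R C D E))) P"
    and eq: "\<And>a b c z. \<lbrakk>a \<in> carrier A; b \<in> carrier B; c \<in> carrier C; z \<in> carrier (tensor R D E)\<rbrakk> \<Longrightarrow>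
      h (pure_tensor R A (tensor R B (tensor3 R C D E)) a (pure_tensor R B (tensor3 R C D E) b
        (pure_tensor R C (tensor R D E) c z))) = tensor_lift R D E (add_monoid P) (\<phi> a b c) z"
    using tensor4_lift_exists[OF assms(1-3) module_tensor[OF assms(4,5)] assms(6) lin4] by blast
  have "linear2 R D E P (\<phi> a b c)" if "a \<in> carrier A" "b \<in> carrier B" "c \<in> carrier C" for a b c
    using assms(7) that by (simp add: linear5_def linear4_def linear3_def)
  with eq assms have "h (pure_tensor R A (tensor R B (tensor3 R C D E)) a (pure_tensor R B (tensor3 R C D E) b
        (pure_tensor R C (tensor R D E) c (pure_tensor R D E d e)))) = \<phi> a b c d e"
    if "a \<in> carrier A" "b \<in> carrier B" "c \<in> carrier C" "d \<in> carrier D" "e \<in> carrier E" for a b c d e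
    using that by (simp add: pure_tensor_closed tensor_lift_pure presents_add_monoid)
  with h show ?thesis by blast
qed

section \<open>Induced maps, rebracketing and products on simple tensors\<close>

lemma linear2_pure_comp:
  assumes "module R M'" "module R N'" "f \<in> linear_maps R M M'" "g \<in> linear_maps R N N'"
  shows "linear2 R M N (tensor R M' N') (\<lambda>x y. pure_tensor R M' N' (f x) (g y))"
proof (rule linear2I)
  note pure = linear2_pure_tensor[OF assms(1,2)]
  fix y assume "y \<in> carrier N"
  then have "g y \<in> carrier N'" by (rule linear_maps_closed[OF assms(4)])
  from linear_maps_comp[OF assms(3) linear2_left[OF pure this]]
  show "(\<lambda>x. pure_tensor R M' N' (f x) (g y)) \<in> linear_maps R M (tensor R M' N')" .
next
  note pure = linear2_pure_tensor[OF assms(1,2)]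
  fix x assume "x \<in> carrier M"
  then have "f x \<in> carrier M'" by (rule linear_maps_closed[OF assms(3)])
  from linear_maps_comp[OF assms(4) linear2_right[OF pure this]]
  show "(\<lambda>y. pure_tensor R M' N' (f x) (g y)) \<in> linear_maps R N (tensor R M' N')" .
qed

lemma tensor_map_closed:
  "\<lbrakk>module R M; module R N; module R M'; module R N'; f \<in> linear_maps R M M'; g \<in> linear_maps R N N'\<rbrakk> \<Longrightarrow>
    tensor_map R M N M' N' f g \<in> linear_maps R (tensor R M N) (tensor R M' N')"
  unfolding tensor_map_def
  by (intro tensor_lift_closed module_tensor presents_tensor_group linear2_pure_comp)

lemma tensor_map_pure:
  "\<lbrakk>module R M; module R N; module R M'; module R N'; f \<in> linear_maps R M M'; g \<in> linear_maps R N N';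
    x \<in> carrier M; y \<in> carrier N\<rbrakk> \<Longrightarrow>
    tensor_map R M N M' N' f g (pure_tensor R M N x y) = pure_tensor R M' N' (f x) (g y)"
  unfolding tensor_map_def
  by (subst tensor_lift_pure[OF _ _ _ presents_tensor_group])
    (simp_all add: module_tensor linear2_pure_comp)

lemma linear_maps_id': "id \<in> linear_maps R M M"
  using linear_maps_id by (simp add: id_def)

lemma tensor_assoc_linear:
  assumes "module R A" "module R B" "module R C"
  shows tensor_assoc_closed: "tensor_assoc R A B C \<in> linear_maps R (tensor R (tensor R A B) C) (tensor3 R A B C)"
    and tensor_assoc_pure: "\<And>a b c. \<lbrakk>a \<in> carrier A; b \<in> carrier B; c \<in> carrier C\<rbrakk> \<Longrightarrow>
      tensor_assoc R A B C (pure_tensor R (tensor R A B) C (pure_tensor R A B a b) c) =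
      pure_tensor R A (tensor R B C) a (pure_tensor R B C b c)"
proof -
  let ?P = "tensor3 R A B C" and ?G = "tensor_group R A (tensor R B C)"
  let ?\<psi> = "\<lambda>c a b. pure_tensor R A (tensor R B C) a (pure_tensor R B C b c)"
  have P: "module R ?P" by (intro module_tensor assms)
  have BC: "module R (tensor R B C)" by (intro module_tensor assms)
  note pure2 = linear2_pure_tensor[OF assms(2,3)]
  \<comment> \<open>Here \<open>c\<close> is the parameter: for fixed \<open>c\<close> the inner map
    is lifted over the tensor product of \<open>A\<close> and \<open>B\<close>, and linearity of
    that lift in \<open>c\<close> makes the outer map bilinear.\<close>
  have right: "linear2 R A B ?P (?\<psi> c)" if "c \<in> carrier C" for c
    by (intro linear2_pure_comp[OF assms(1) BC linear_maps_id] linear2_left[OF pure2] that)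
  have left: "(\<lambda>c. ?\<psi> c a b) \<in> linear_maps R C ?P" if "a \<in> carrier A" "b \<in> carrier B" for a b
    by (rule linear_maps_comp[OF linear2_right[OF pure2 that(2)]
          linear2_right[OF linear2_pure_tensor[OF assms(1) BC] that(1)]])
  have lin: "linear2 R (tensor R A B) C ?P (\<lambda>s c. tensor_lift R A B ?G (?\<psi> c) s)"
    by (intro linear2I tensor_lift_closed[OF assms(1,2) P presents_tensor_group] right
        tensor_lift_param_linear[OF assms(3,1,2) P presents_tensor_group] left)
  show "tensor_assoc R A B C \<in> linear_maps R (tensor R (tensor R A B) C) ?P"
    unfolding tensor_assoc_def
    by (intro tensor_lift_closed presents_tensor_group module_tensor assms lin)
  fix a b c assume "a \<in> carrier A" "b \<in> carrier B" "c \<in> carrier C"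
  then show "tensor_assoc R A B C (pure_tensor R (tensor R A B) C (pure_tensor R A B a b) c) = ?\<psi> c a b"
    unfolding tensor_assoc_def using assms right
    by (subst tensor_lift_pure[OF _ _ P presents_tensor_group lin])
      (simp_all add: module_tensor pure_tensor_closed tensor_lift_pure[OF _ _ P presents_tensor_group])
qed

lemma tensor_assoc3_linear:
  assumes "module R A" "module R B" "module R C" "module R D"
  shows tensor_assoc3_closed: "tensor_assoc3 R A B C D \<in>
      linear_maps R (tensor R (tensor3 R A B C) D) (tensor R A (tensor3 R B C D))"
    and tensor_assoc3_pure: "\<And>a b c d. \<lbrakk>a \<in> carrier A; b \<in> carrier B; c \<in> carrier C; d \<in> carrier D\<rbrakk> \<Longrightarrow>
      tensor_assoc3 R A B C D
        (pure_tensor R (tensor3 R A B C) D (pure_tensor R A (tensor R B C) a (pure_tensor R B C b c)) d) =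
      pure_tensor R A (tensor3 R B C D) a (pure_tensor R B (tensor R C D) b (pure_tensor R C D c d))"
proof -
  note closed = tensor_map_closed[OF assms(1) module_tensor[OF module_tensor[OF assms(2,3)] assms(4)]
      assms(1) module_tensor[OF assms(2) module_tensor[OF assms(3,4)]] linear_maps_id'
      tensor_assoc_closed[OF assms(2-4)]]
  show "tensor_assoc3 R A B C D \<in> linear_maps R (tensor R (tensor3 R A B C) D) (tensor R A (tensor3 R B C D))"
    unfolding tensor_assoc3_def comp_def
    by (rule linear_maps_comp[OF tensor_assoc_closed[OF assms(1) module_tensor[OF assms(2,3)] assms(4)] closed])
  fix a b c d assume "a \<in> carrier A" "b \<in> carrier B" "c \<in> carrier C" "d \<in> carrier D"
  with assms show "tensor_assoc3 R A B C D
        (pure_tensor R (tensor3 R A B C) D (pure_tensor R A (tensor R B C) a (pure_tensor R B C b c)) d) =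
      pure_tensor R A (tensor3 R B C D) a (pure_tensor R B (tensor R C D) b (pure_tensor R C D c d))"
    unfolding tensor_assoc3_def comp_def
    by (simp add: tensor_assoc_pure tensor_map_pure linear_maps_id' tensor_assoc_closed module_tensor pure_tensor_closed)
qed

text \<open>The assumption on the factors is bilinearity of their products, so the lemma can be
  iterated: its first conclusion for \<open>opp T \<otimes> T\<close> is a hypothesis when
  \<open>T\<close> is added as a further factor on the left.\<close>

lemma tensor_mult_linear:
  assumes M: "module R M" and N: "module R N"
    and mM: "linear2 R M M M (monoid.mult M)" and mN: "linear2 R N N N (monoid.mult N)"
  shows tensor_mult_linear2: "linear2 R (tensor R M N) (tensor R M N) (tensor R M N) (monoid.mult (tensor R M N))"
    and tensor_mult_pure:
      "\<And>x y x' y'. \<lbrakk>x \<in> carrier M; y \<in> carrier N; x' \<in> carrier M; y' \<in> carrier N\<rbrakk> \<Longrightarrow>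
        pure_tensor R M N x y \<otimes>\<^bsub>tensor R M N\<^esub> pure_tensor R M N x' y' =
        pure_tensor R M N (x \<otimes>\<^bsub>M\<^esub> x') (y \<otimes>\<^bsub>N\<^esub> y')"
proof -
  let ?P = "tensor R M N" and ?G = "tensor_group R M N"
  let ?\<psi> = "\<lambda>x y x' y'. pure_tensor R M N (x \<otimes>\<^bsub>M\<^esub> x') (y \<otimes>\<^bsub>N\<^esub> y')"
  let ?L = "\<lambda>t x y. tensor_lift R M N ?G (?\<psi> x y) t"
  have P: "module R ?P" by (intro module_tensor M N)
  \<comment> \<open>The product is a lift inside a lift, so bilinearity is needed twice: in the
    right argument for fixed left legs, and in the left argument for fixed right legs.\<close>
  have inner: "linear2 R M N ?P (?\<psi> x y)" if "x \<in> carrier M" "y \<in> carrier N" for x y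
    by (intro linear2_pure_comp M N linear2_right[OF mM] linear2_right[OF mN] that)
  have outer: "linear2 R M N ?P (\<lambda>x y. ?\<psi> x y x' y')" if "x' \<in> carrier M" "y' \<in> carrier N" for x' y'
    by (intro linear2_pure_comp M N linear2_left[OF mM] linear2_left[OF mN] that)
  have L: "linear2 R M N ?P (?L t)" if "t \<in> carrier ?P" for t
    by (intro linear2I tensor_lift_param_linear M N P presents_tensor_group inner that
        linear2_left[OF outer] linear2_right[OF outer])
  have mult: "monoid.mult ?P = (\<lambda>s t. tensor_lift R M N ?G (?L t) s)"
    by (simp add: tensor_def)
  show "linear2 R ?P ?P ?P (monoid.mult ?P)"
    unfolding mult
    by (intro linear2I tensor_lift_closed tensor_lift_param_linear M N P presents_tensor_group L inner)
  fix x y x' y' assume "x \<in> carrier M" "y \<in> carrier N" "x' \<in> carrier M" "y' \<in> carrier N"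
  then show "pure_tensor R M N x y \<otimes>\<^bsub>?P\<^esub> pure_tensor R M N x' y' = ?\<psi> x y x' y'"
    unfolding mult by (simp add: tensor_lift_pure[OF M N P presents_tensor_group] pure_tensor_closed M N L inner)
qed

section \<open>Substitution rules for multilinear maps\<close>

lemma linear3I:
  assumes "\<And>b c. \<lbrakk>b \<in> carrier B; c \<in> carrier C\<rbrakk> \<Longrightarrow> (\<lambda>a. \<phi> a b c) \<in> linear_maps R A P"
    and "\<And>a c. \<lbrakk>a \<in> carrier A; c \<in> carrier C\<rbrakk> \<Longrightarrow> (\<lambda>b. \<phi> a b c) \<in> linear_maps R B P"
    and "\<And>a b. \<lbrakk>a \<in> carrier A; b \<in> carrier B\<rbrakk> \<Longrightarrow> (\<lambda>c. \<phi> a b c) \<in> linear_maps R C P"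
  shows "linear3 R A B C P \<phi>"
  using assms by (simp add: multilinear_defs)

lemma linear4I:
  assumes "\<And>b c d. \<lbrakk>b \<in> carrier B; c \<in> carrier C; d \<in> carrier D\<rbrakk> \<Longrightarrow> (\<lambda>a. \<phi> a b c d) \<in> linear_maps R A P"
    and "\<And>a c d. \<lbrakk>a \<in> carrier A; c \<in> carrier C; d \<in> carrier D\<rbrakk> \<Longrightarrow> (\<lambda>b. \<phi> a b c d) \<in> linear_maps R B P"
    and "\<And>a b d. \<lbrakk>a \<in> carrier A; b \<in> carrier B; d \<in> carrier D\<rbrakk> \<Longrightarrow> (\<lambda>c. \<phi> a b c d) \<in> linear_maps R C P"
    and "\<And>a b c. \<lbrakk>a \<in> carrier A; b \<in> carrier B; c \<in> carrier C\<rbrakk> \<Longrightarrow> (\<lambda>d. \<phi> a b c d) \<in> linear_maps R D P"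
  shows "linear4 R A B C D P \<phi>"
  using assms by (simp add: multilinear_defs)

lemma linear5I:
  assumes "\<And>b c d e. \<lbrakk>b \<in> carrier B; c \<in> carrier C; d \<in> carrier D; e \<in> carrier E\<rbrakk> \<Longrightarrow>
      (\<lambda>a. \<phi> a b c d e) \<in> linear_maps R A P"
    and "\<And>a c d e. \<lbrakk>a \<in> carrier A; c \<in> carrier C; d \<in> carrier D; e \<in> carrier E\<rbrakk> \<Longrightarrow>
      (\<lambda>b. \<phi> a b c d e) \<in> linear_maps R B P"
    and "\<And>a b d e. \<lbrakk>a \<in> carrier A; b \<in> carrier B; d \<in> carrier D; e \<in> carrier E\<rbrakk> \<Longrightarrow>
      (\<lambda>c. \<phi> a b c d e) \<in> linear_maps R C P"
    and "\<And>a b c e. \<lbrakk>a \<in> carrier A; b \<in> carrier B; c \<in> carrier C; e \<in> carrier E\<rbrakk> \<Longrightarrow>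
      (\<lambda>d. \<phi> a b c d e) \<in> linear_maps R D P"
    and "\<And>a b c d. \<lbrakk>a \<in> carrier A; b \<in> carrier B; c \<in> carrier C; d \<in> carrier D\<rbrakk> \<Longrightarrow>
      (\<lambda>e. \<phi> a b c d e) \<in> linear_maps R E P"
  shows "linear5 R A B C D E P \<phi>"
  using assms by (simp add: multilinear_defs)

text \<open>These facts have the shape of introduction rules: replacing one argument by a linear
  expression keeps the map linear. Linearity of long Sweedler terms is then checked one variable at
  a time by \<open>intro\<close>.\<close>

lemma linear2_comp:
  assumes "linear2 R A B P \<phi>"
  shows "\<lbrakk>f \<in> linear_maps R K A; b \<in> carrier B\<rbrakk> \<Longrightarrow> (\<lambda>x. \<phi> (f x) b) \<in> linear_maps R K P"
    and "\<lbrakk>f' \<in> linear_maps R K B; a \<in> carrier A\<rbrakk> \<Longrightarrow> (\<lambda>x. \<phi> a (f' x)) \<in> linear_maps R K P"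
    and "\<lbrakk>a \<in> carrier A; b \<in> carrier B\<rbrakk> \<Longrightarrow> \<phi> a b \<in> carrier P"
  using assms
  by (auto simp: multilinear_defs intro: linear_maps_comp[of f R K A "\<lambda>x. \<phi> x b"] linear_maps_comp[of f']
      linear_maps_closed)

lemma linear3_comp:
  assumes "linear3 R A B C P \<phi>"
  shows "\<lbrakk>f \<in> linear_maps R K A; b \<in> carrier B; c \<in> carrier C\<rbrakk> \<Longrightarrow> (\<lambda>x. \<phi> (f x) b c) \<in> linear_maps R K P"
    and "\<lbrakk>f' \<in> linear_maps R K B; a \<in> carrier A; c \<in> carrier C\<rbrakk> \<Longrightarrow> (\<lambda>x. \<phi> a (f' x) c) \<in> linear_maps R K P"
    and "\<lbrakk>g \<in> linear_maps R K C; a \<in> carrier A; b \<in> carrier B\<rbrakk> \<Longrightarrow> (\<lambda>x. \<phi> a b (g x)) \<in> linear_maps R K P"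
    and "\<lbrakk>a \<in> carrier A; b \<in> carrier B; c \<in> carrier C\<rbrakk> \<Longrightarrow> \<phi> a b c \<in> carrier P"
  using assms
  by (auto simp: linear3_def intro: linear_maps_comp[of f R K A "\<lambda>x. \<phi> x b c"] linear2_comp)

lemma linear4_comp:
  assumes "linear4 R A B C D P \<phi>"
  shows "\<lbrakk>f \<in> linear_maps R K A; b \<in> carrier B; c \<in> carrier C; d \<in> carrier D\<rbrakk> \<Longrightarrow>
      (\<lambda>x. \<phi> (f x) b c d) \<in> linear_maps R K P"
    and "\<lbrakk>f' \<in> linear_maps R K B; a \<in> carrier A; c \<in> carrier C; d \<in> carrier D\<rbrakk> \<Longrightarrow>
      (\<lambda>x. \<phi> a (f' x) c d) \<in> linear_maps R K P"
    and "\<lbrakk>g \<in> linear_maps R K C; a \<in> carrier A; b \<in> carrier B; d \<in> carrier D\<rbrakk> \<Longrightarrow>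
      (\<lambda>x. \<phi> a b (g x) d) \<in> linear_maps R K P"
    and "\<lbrakk>g' \<in> linear_maps R K D; a \<in> carrier A; b \<in> carrier B; c \<in> carrier C\<rbrakk> \<Longrightarrow>
      (\<lambda>x. \<phi> a b c (g' x)) \<in> linear_maps R K P"
    and "\<lbrakk>a \<in> carrier A; b \<in> carrier B; c \<in> carrier C; d \<in> carrier D\<rbrakk> \<Longrightarrow> \<phi> a b c d \<in> carrier P"
  using assms
  by (auto simp: linear4_def intro: linear_maps_comp[of f R K A "\<lambda>x. \<phi> x b c d"] linear3_comp)

lemma linear5_comp:
  assumes "linear5 R A B C D E P \<phi>"
  shows "\<lbrakk>f \<in> linear_maps R K A; b \<in> carrier B; c \<in> carrier C; d \<in> carrier D; e \<in> carrier E\<rbrakk> \<Longrightarrow>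
      (\<lambda>x. \<phi> (f x) b c d e) \<in> linear_maps R K P"
    and "\<lbrakk>f' \<in> linear_maps R K B; a \<in> carrier A; c \<in> carrier C; d \<in> carrier D; e \<in> carrier E\<rbrakk> \<Longrightarrow>
      (\<lambda>x. \<phi> a (f' x) c d e) \<in> linear_maps R K P"
    and "\<lbrakk>g \<in> linear_maps R K C; a \<in> carrier A; b \<in> carrier B; d \<in> carrier D; e \<in> carrier E\<rbrakk> \<Longrightarrow>
      (\<lambda>x. \<phi> a b (g x) d e) \<in> linear_maps R K P"
    and "\<lbrakk>g' \<in> linear_maps R K D; a \<in> carrier A; b \<in> carrier B; c \<in> carrier C; e \<in> carrier E\<rbrakk> \<Longrightarrow>
      (\<lambda>x. \<phi> a b c (g' x) e) \<in> linear_maps R K P"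
    and "\<lbrakk>h \<in> linear_maps R K E; a \<in> carrier A; b \<in> carrier B; c \<in> carrier C; d \<in> carrier D\<rbrakk> \<Longrightarrow>
      (\<lambda>x. \<phi> a b c d (h x)) \<in> linear_maps R K P"
    and "\<lbrakk>a \<in> carrier A; b \<in> carrier B; c \<in> carrier C; d \<in> carrier D; e \<in> carrier E\<rbrakk> \<Longrightarrow>
      \<phi> a b c d e \<in> carrier P"
  using assms
  by (auto simp: linear5_def intro: linear_maps_comp[of f R K A "\<lambda>x. \<phi> x b c d e"] linear4_comp)

lemma linear_maps_opp: "linear_maps R (opp A) B = linear_maps R A B"
  by (simp add: linear_maps_def hom_def)

lemma linear_maps_opp_target: "linear_maps R A (opp B) = linear_maps R A B"
  by (simp add: linear_maps_def hom_def)

text \<open>Passing to the opposite algebra changes the product and nothing else, so multilinearity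
  does not see it. This allows the Sweedler calculus to speak of \<open>T\<close> in every
  leg.\<close>

lemma multilinear_opp:
  "linear2 R (opp A) B P = linear2 R A B P" "linear2 R A (opp B) P = linear2 R A B P"
  "linear3 R (opp A) B C P = linear3 R A B C P" "linear3 R A (opp B) C P = linear3 R A B C P"
  "linear3 R A B (opp C) P = linear3 R A B C P"
  "linear5 R (opp A) B C D E P = linear5 R A B C D E P" "linear5 R A (opp B) C D E P = linear5 R A B C D E P"
  "linear5 R A B (opp C) D E P = linear5 R A B C D E P" "linear5 R A B C (opp D) E P = linear5 R A B C D E P"
  "linear5 R A B C D (opp E) P = linear5 R A B C D E P"
  by (auto simp: multilinear_defs linear_maps_opp fun_eq_iff)

lemma assoc_algebra_opp:
  assumes "assoc_algebra R A" shows "assoc_algebra R (opp A)"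
proof -
  interpret assoc_algebra R A by fact
  have "abelian_group (opp A)"
    by (rule abelian_groupI) (auto simp: a_assoc intro: a_comm add.l_inv_ex)
  moreover have "Group.monoid (opp A)"
    by (rule monoidI) (auto simp: m_assoc)
  ultimately show ?thesis
    by (intro assoc_algebra.intro module.intro ring.intro module_axioms.intro ring_axioms.intro
        assoc_algebra_axioms.intro is_cring)
      (auto simp: smult_l_distr smult_r_distr smult_assoc1 smult_mult_left smult_mult_right l_distr r_distr)
qed

section \<open>Sweedler calculus\<close>

definition tsum where
  "tsum G \<rho> x \<phi> = lsum G (map (\<lambda>(a, b, c). \<phi> a b c) (\<rho> x))"

lemma tsum_congI:
  assumes "set (\<rho> x) \<subseteq> A \<times> A \<times> A"
    "\<And>a b c. \<lbrakk>a \<in> A; b \<in> A; c \<in> A\<rbrakk> \<Longrightarrow> \<phi> a b c = \<psi> a b c"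
  shows "tsum G \<rho> x \<phi> = tsum G \<rho> x \<psi>"
proof -
  have "map (\<lambda>(a, b, c). \<phi> a b c) (\<rho> x) = map (\<lambda>(a, b, c). \<psi> a b c) (\<rho> x)"
    using assms by (intro map_cong) auto
  then show ?thesis by (simp only: tsum_def)
qed

lemma tsum_closedI:
  assumes "abelian_group G" "set (\<rho> x) \<subseteq> A \<times> A \<times> A"
    "\<And>a b c. \<lbrakk>a \<in> A; b \<in> A; c \<in> A\<rbrakk> \<Longrightarrow> \<phi> a b c \<in> carrier G"
  shows "tsum G \<rho> x \<phi> \<in> carrier G"
  unfolding tsum_def using assms(2,3)
  by (intro abelian_group.lsum_closed[OF assms(1)]) (auto simp: subset_iff)

text \<open>Sweedler calculus: \<open>\<rho> x\<close> lists the simple tensors of a decomposition of \<open>\<mu> x\<close>, and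
  \<open>tsum G \<rho> x \<phi>\<close> stands for \<open>\<phi> x\<^sub>1 x\<^sub>2 x\<^sub>3\<close>; the torsor axioms are required after applying
  multilinear maps with values in \<open>G\<close>.\<close>

locale torsor_sums = T: assoc_algebra R T + G: module R G
  for R (structure) and T (structure) and G (structure) +
  fixes \<rho>
  assumes rho_closed: "x \<in> carrier T \<Longrightarrow> set (\<rho> x) \<subseteq> carrier T \<times> carrier T \<times> carrier T"
    and linear: "linear3 R T T T G \<phi> \<Longrightarrow> (\<lambda>x. tsum G \<rho> x \<phi>) \<in> linear_maps R T G"
    and coassoc: "\<lbrakk>linear5 R T T T T T G \<psi>; x \<in> carrier T\<rbrakk> \<Longrightarrow>
      tsum G \<rho> x (\<lambda>a b c. tsum G \<rho> a (\<lambda>p q r. \<psi> p q r b c)) =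
      tsum G \<rho> x (\<lambda>a b c. tsum G \<rho> c (\<lambda>p q r. \<psi> a b p q r))"
    and contract_left: "\<lbrakk>linear2 R T T G \<beta>; x \<in> carrier T\<rbrakk> \<Longrightarrow>
      tsum G \<rho> x (\<lambda>a b c. \<beta> (a \<otimes>\<^bsub>T\<^esub> b) c) = \<beta> \<one>\<^bsub>T\<^esub> x"
    and contract_right: "\<lbrakk>linear2 R T T G \<beta>; x \<in> carrier T\<rbrakk> \<Longrightarrow>
      tsum G \<rho> x (\<lambda>a b c. \<beta> a (b \<otimes>\<^bsub>T\<^esub> c)) = \<beta> x \<one>\<^bsub>T\<^esub>"
    and mult: "\<lbrakk>linear3 R T T T G \<phi>; x \<in> carrier T; y \<in> carrier T\<rbrakk> \<Longrightarrow>
      tsum G \<rho> (x \<otimes>\<^bsub>T\<^esub> y) \<phi> =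
      tsum G \<rho> x (\<lambda>a b c. tsum G \<rho> y (\<lambda>p q r. \<phi> (a \<otimes>\<^bsub>T\<^esub> p) (q \<otimes>\<^bsub>T\<^esub> b) (c \<otimes>\<^bsub>T\<^esub> r)))"
    and one: "linear3 R T T T G \<phi> \<Longrightarrow> tsum G \<rho> \<one>\<^bsub>T\<^esub> \<phi> = \<phi> \<one>\<^bsub>T\<^esub> \<one>\<^bsub>T\<^esub> \<one>\<^bsub>T\<^esub>"
begin

abbreviation S where "S \<equiv> tsum G \<rho>"
abbreviation tmult (infixl "\<cdot>" 70) where "x \<cdot> y \<equiv> x \<otimes>\<^bsub>T\<^esub> y"
abbreviation tone ("\<e>") where "\<e> \<equiv> \<one>\<^bsub>T\<^esub>"
abbreviation tcarrier ("\<T>") where "\<T> \<equiv> carrier T"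

lemma S_cong:
  assumes "x \<in> \<T>" "\<And>a b c. \<lbrakk>a \<in> \<T>; b \<in> \<T>; c \<in> \<T>\<rbrakk> \<Longrightarrow> \<phi> a b c = \<psi> a b c"
  shows "S x \<phi> = S x \<psi>"
  using assms(2) by (rule tsum_congI[of \<rho> x, OF rho_closed[OF assms(1)]])

lemma S_closed:
  assumes "x \<in> \<T>" "\<And>a b c. \<lbrakk>a \<in> \<T>; b \<in> \<T>; c \<in> \<T>\<rbrakk> \<Longrightarrow> \<phi> a b c \<in> carrier G"
  shows "S x \<phi> \<in> carrier G"
  using assms(2) by (rule tsum_closedI[of G \<rho> x, OF G.abelian_group_axioms rho_closed[OF assms(1)]])

lemma S_swap:
  assumes "x \<in> \<T>" "y \<in> \<T>"
    "\<And>a b c p q r. \<lbrakk>a \<in> \<T>; b \<in> \<T>; c \<in> \<T>; p \<in> \<T>; q \<in> \<T>; r \<in> \<T>\<rbrakk> \<Longrightarrow> \<phi> a b c p q r \<in> carrier G"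
  shows "S x (\<lambda>a b c. S y (\<lambda>p q r. \<phi> a b c p q r)) = S y (\<lambda>p q r. S x (\<lambda>a b c. \<phi> a b c p q r))"
  using G.lsum_swap[of "\<rho> x" "\<rho> y" "\<lambda>(a, b, c) (p, q, r). \<phi> a b c p q r"]
    rho_closed[OF assms(1)] rho_closed[OF assms(2)] assms(3)
  by (auto simp: tsum_def split_beta subset_iff cong: map_cong)

lemma linear_mult_left: "\<lbrakk>f \<in> linear_maps R K T; b \<in> \<T>\<rbrakk> \<Longrightarrow> (\<lambda>x. f x \<cdot> b) \<in> linear_maps R K T"
  by (rule linear_maps_comp) (auto intro!: linear_mapsI simp: T.l_distr T.smult_mult_left)

lemma linear_mult_right: "\<lbrakk>f \<in> linear_maps R K T; b \<in> \<T>\<rbrakk> \<Longrightarrow> (\<lambda>x. b \<cdot> f x) \<in> linear_maps R K T"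
  by (rule linear_maps_comp) (auto intro!: linear_mapsI simp: T.r_distr T.smult_mult_right)

text \<open>Linearity in the argument of \<open>S\<close> cannot be read off from
  \<open>\<rho>\<close>, an arbitrary choice of decompositions; it is the locale assumption
  \<open>linear\<close>. In \<open>linear_S_body\<close>, by contrast, the argument is fixed and the
  sum is a finite sum of linear maps.\<close>

lemma linear_S_arg:
  "\<lbrakk>f \<in> linear_maps R T T; linear3 R T T T G \<phi>\<rbrakk> \<Longrightarrow> (\<lambda>x. S (f x) \<phi>) \<in> linear_maps R T G"
  by (rule linear_maps_comp[OF _ linear])

lemma linear_S_body:
  assumes y: "y \<in> \<T>"
    and \<phi>: "\<And>a b c. \<lbrakk>a \<in> \<T>; b \<in> \<T>; c \<in> \<T>\<rbrakk> \<Longrightarrow> (\<lambda>x. \<phi> x a b c) \<in> linear_maps R T G"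
  shows "(\<lambda>x. S y (\<phi> x)) \<in> linear_maps R T G"
proof -
  have "(\<lambda>x. lsum G (map (\<lambda>(a, b, c). \<phi> x a b c) zs)) \<in> linear_maps R T G"
    if "set zs \<subseteq> \<T> \<times> \<T> \<times> \<T>" for zs
    using that
  proof (induction zs)
    case Nil
    show ?case using linear_maps_const_zero[OF G.module_axioms] by simp
  next
    case (Cons z zs)
    obtain a b c where z: "z = (a, b, c)" by (cases z)
    have abc: "a \<in> \<T>" "b \<in> \<T>" "c \<in> \<T>" using Cons.prems z by auto
    show ?case
      using linear_maps_sum[OF G.module_axioms \<phi>[OF abc] Cons.IH] Cons.prems by (simp add: z)
  qed
  then show ?thesis unfolding tsum_def using rho_closed[OF y] by blast
qed

lemmas multilinear_intros =
  linear2I linear3I linear4I linear5I linear_S_arg linear_S_body linear_mult_left linear_mult_right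
  linear_maps_id S_closed T.m_closed T.one_closed

text \<open>Coassociativity moves the inner \<open>\<mu>\<close> from the third leg to the first,
  where \<open>contract_right\<close> collapses the product. In Sweedler notation: \<open>x\<^sub>1
  \<otimes> x\<^sub>2x\<^sub>3\<^sub>1 \<otimes> x\<^sub>3\<^sub>2 \<otimes> x\<^sub>3\<^sub>3 =
  x\<^sub>1 \<otimes> 1 \<otimes> x\<^sub>2 \<otimes> x\<^sub>3\<close>.\<close>

lemma coinvariant:
  assumes \<phi>: "linear4 R T T T T G \<phi>" and x: "x \<in> \<T>"
  shows "S x (\<lambda>a b c. S c (\<lambda>p q r. \<phi> a (b \<cdot> p) q r)) = S x (\<lambda>a b c. \<phi> a \<e> b c)"
proof -
  note lin = linear4_comp[OF \<phi>] multilinear_intros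
  have "S x (\<lambda>a b c. S c (\<lambda>p q r. \<phi> a (b \<cdot> p) q r)) = S x (\<lambda>a b c. S a (\<lambda>p q r. \<phi> p (q \<cdot> r) b c))"
    by (rule coassoc[symmetric, OF _ x, of "\<lambda>p q r b c. \<phi> p (q \<cdot> r) b c"]) (intro lin)
  also have "\<dots> = S x (\<lambda>a b c. \<phi> a \<e> b c)"
  proof (rule S_cong[OF x])
    fix a b c assume abc: "a \<in> \<T>" "b \<in> \<T>" "c \<in> \<T>"
    show "S a (\<lambda>p q r. \<phi> p (q \<cdot> r) b c) = \<phi> a \<e> b c"
      by (rule contract_right[OF _ abc(1), of "\<lambda>p y. \<phi> p y b c"]) (intro lin abc)
  qed
  finally show ?thesis .
qed

text \<open>Both sides arise from
  \<open>x\<^sub>1 \<otimes> a\<^sub>1b\<^sub>1 \<otimes> b\<^sub>2a\<^sub>2 \<otimes> a\<^sub>3b\<^sub>3\<^sub>1 \<otimes> b\<^sub>3\<^sub>2 \<otimes> b\<^sub>3\<^sub>3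
    = x\<^sub>1 \<otimes> 1 \<otimes> 1 \<otimes> 1 \<otimes> a \<otimes> b\<close>, where \<open>a \<otimes> b = x\<^sub>2 \<otimes> x\<^sub>3\<close>, by applying
  \<open>s \<otimes> t \<otimes> p \<otimes> q \<otimes> c \<otimes> d \<mapsto> s \<otimes> t \<otimes> p(qc)\<^sub>1d \<otimes> (qc)\<^sub>2 \<otimes> (qc)\<^sub>3\<close>.\<close>

lemma descent_right:
  assumes \<phi>: "linear5 R T T T T T G \<phi>" and x: "x \<in> \<T>"
  shows "S x (\<lambda>a b c. S b (\<lambda>p q r. \<phi> a (p \<cdot> c) \<e> q r)) = S x (\<lambda>a b c. S b (\<lambda>p q r. \<phi> a \<e> (p \<cdot> c) q r))"
proof -
  note lin = linear5_comp[OF \<phi>] multilinear_intros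
  let ?\<Gamma> = "\<lambda>s t p q c d. S (q \<cdot> c) (\<lambda>u v w. \<phi> s t (p \<cdot> u \<cdot> d) v w)"
  let ?M = "\<lambda>s a b. S a (\<lambda>a1 a2 a3. S b (\<lambda>b1 b2 b3. S b3 (\<lambda>c1 c2 c3.
      ?\<Gamma> s (a1 \<cdot> b1) (b2 \<cdot> a2) (a3 \<cdot> c1) c2 c3)))"
  \<comment> \<open>First evaluation of \<open>?M\<close>: coassociativity puts the inner
    \<open>\<mu>\<close> on \<open>b1\<close>, so the products of legs of \<open>a\<close> and
    \<open>b1\<close> form \<open>\<mu> (a \<cdot> b1)\<close>. Below, \<open>coinvariant\<close>
    for \<open>x\<close> turns \<open>a \<cdot> b1\<close> into the unit, whose image under
    \<open>\<mu>\<close> consists of units.\<close>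
  have "?M s a b = S b (\<lambda>b1 b2 b3. S (a \<cdot> b1) (\<lambda>u v w. ?\<Gamma> s u v w b2 b3))"
    if sab: "s \<in> \<T>" "a \<in> \<T>" "b \<in> \<T>" for s a b
  proof -
    have "?M s a b = S a (\<lambda>a1 a2 a3. S b (\<lambda>b1 b2 b3. S b1 (\<lambda>p q r.
        ?\<Gamma> s (a1 \<cdot> p) (q \<cdot> a2) (a3 \<cdot> r) b2 b3)))"
      by (rule S_cong[OF sab(2)], rule coassoc[symmetric, OF _ sab(3), of "\<lambda>p q r b c. ?\<Gamma> s (_ \<cdot> p) (q \<cdot> _) (_ \<cdot> r) b c"])
        (intro lin sab; assumption)
    also have "\<dots> = S b (\<lambda>b1 b2 b3. S a (\<lambda>a1 a2 a3. S b1 (\<lambda>p q r.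
        ?\<Gamma> s (a1 \<cdot> p) (q \<cdot> a2) (a3 \<cdot> r) b2 b3)))"
      by (rule S_swap) (assumption | intro lin sab)+
    also have "\<dots> = S b (\<lambda>b1 b2 b3. S (a \<cdot> b1) (\<lambda>u v w. ?\<Gamma> s u v w b2 b3))"
      by (rule S_cong[OF sab(3)], rule mult[symmetric]) (assumption | intro lin sab)+
    finally show ?thesis .
  qed
  then have "S x ?M = S x (\<lambda>s a b. S b (\<lambda>b1 b2 b3. S (a \<cdot> b1) (\<lambda>u v w. ?\<Gamma> s u v w b2 b3)))"
    by (rule S_cong[OF x])
  also have "\<dots> = S x (\<lambda>s a b. S \<e> (\<lambda>u v w. ?\<Gamma> s u v w a b))"
    by (rule coinvariant[OF _ x, of "\<lambda>s y c d. S y (\<lambda>u v w. ?\<Gamma> s u v w c d)"]) (intro lin; assumption)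
  also have "\<dots> = S x (\<lambda>s a b. ?\<Gamma> s \<e> \<e> \<e> a b)"
    by (rule S_cong[OF x], rule one) (intro lin; assumption)
  also have "\<dots> = S x (\<lambda>s a b. S a (\<lambda>p q r. \<phi> s \<e> (\<e> \<cdot> p \<cdot> b) q r))"
    by (rule S_cong[OF x]) simp
  also have "\<dots> = S x (\<lambda>s a b. S a (\<lambda>p q r. \<phi> s \<e> (p \<cdot> b) q r))"
    by (intro S_cong x) simp_all
  finally have right: "S x ?M = S x (\<lambda>s a b. S a (\<lambda>p q r. \<phi> s \<e> (p \<cdot> b) q r))" .
  \<comment> \<open>Second evaluation: three products collapse in turn, first
    \<open>c1 \<cdot> c2\<close>, then \<open>a2 \<cdot> u\<close> with \<open>u\<close> the first
    leg of \<open>a3\<close>, and finally \<open>b2 \<cdot> b3\<close>.\<close>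
  have "?M s a b = S a (\<lambda>p q r. \<phi> s (p \<cdot> b) \<e> q r)" if sab: "s \<in> \<T>" "a \<in> \<T>" "b \<in> \<T>" for s a b
  proof -
    have "S b3 (\<lambda>c1 c2 c3. ?\<Gamma> s (a1 \<cdot> b1) (b2 \<cdot> a2) (a3 \<cdot> c1) c2 c3) =
        S a3 (\<lambda>u v w. \<phi> s (a1 \<cdot> b1) (b2 \<cdot> (a2 \<cdot> u \<cdot> b3)) v w)"
      if ab: "a1 \<in> \<T>" "a2 \<in> \<T>" "a3 \<in> \<T>" "b1 \<in> \<T>" "b2 \<in> \<T>" "b3 \<in> \<T>" for a1 a2 a3 b1 b2 b3
    proof -
      have "S b3 (\<lambda>c1 c2 c3. ?\<Gamma> s (a1 \<cdot> b1) (b2 \<cdot> a2) (a3 \<cdot> c1) c2 c3) =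
          S b3 (\<lambda>c1 c2 c3. S (a3 \<cdot> (c1 \<cdot> c2)) (\<lambda>u v w. \<phi> s (a1 \<cdot> b1) (b2 \<cdot> a2 \<cdot> u \<cdot> c3) v w))"
        by (rule S_cong[OF ab(6)]) (simp add: T.m_assoc ab)
      also have "\<dots> = S (a3 \<cdot> \<e>) (\<lambda>u v w. \<phi> s (a1 \<cdot> b1) (b2 \<cdot> a2 \<cdot> u \<cdot> b3) v w)"
        by (rule contract_left[OF _ ab(6), of "\<lambda>y d. S (a3 \<cdot> y) (\<lambda>u v w. \<phi> s (a1 \<cdot> b1) (b2 \<cdot> a2 \<cdot> u \<cdot> d) v w)"])
          (intro lin sab ab; assumption)
      also have "\<dots> = S a3 (\<lambda>u v w. \<phi> s (a1 \<cdot> b1) (b2 \<cdot> (a2 \<cdot> u \<cdot> b3)) v w)"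
        unfolding T.r_one[OF ab(3)] by (rule S_cong[OF ab(3)]) (simp add: T.m_assoc ab)
      finally show ?thesis .
    qed
    then have "?M s a b = S a (\<lambda>a1 a2 a3. S b (\<lambda>b1 b2 b3. S a3 (\<lambda>u v w. \<phi> s (a1 \<cdot> b1) (b2 \<cdot> (a2 \<cdot> u \<cdot> b3)) v w)))"
      by (intro S_cong sab)
    also have "\<dots> = S a (\<lambda>a1 a2 a3. S a3 (\<lambda>u v w. S b (\<lambda>b1 b2 b3. \<phi> s (a1 \<cdot> b1) (b2 \<cdot> (a2 \<cdot> u \<cdot> b3)) v w)))"
      by (rule S_cong[OF sab(2)], rule S_swap[OF sab(3)]) (assumption | intro lin sab)+
    also have "\<dots> = S a (\<lambda>a1 a2 a3. S b (\<lambda>b1 b2 b3. \<phi> s (a1 \<cdot> b1) (b2 \<cdot> (\<e> \<cdot> b3)) a2 a3))"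
      by (rule coinvariant[OF _ sab(2), of "\<lambda>a1 y v w. S b (\<lambda>b1 b2 b3. \<phi> s (a1 \<cdot> b1) (b2 \<cdot> (y \<cdot> b3)) v w)"])
        (intro lin sab; assumption)
    also have "\<dots> = S a (\<lambda>a1 a2 a3. S b (\<lambda>b1 b2 b3. \<phi> s (a1 \<cdot> b1) (b2 \<cdot> b3) a2 a3))"
      by (intro S_cong sab) simp
    also have "\<dots> = S a (\<lambda>a1 a2 a3. \<phi> s (a1 \<cdot> b) \<e> a2 a3)"
      by (rule S_cong[OF sab(2)], rule contract_right[OF _ sab(3), of "\<lambda>b1 y. \<phi> s (_ \<cdot> b1) y _ _"])
        (intro lin sab; assumption)
    finally show ?thesis .
  qed
  then have "S x ?M = S x (\<lambda>s a b. S a (\<lambda>p q r. \<phi> s (p \<cdot> b) \<e> q r))"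
    by (rule S_cong[OF x])
  with right show ?thesis by simp
qed

end

text \<open>Reversing the three legs exchanges the two contraction axioms and the two sides of
  coassociativity, so the axioms as a whole are symmetric. Every identity derived from them
  therefore has a mirror image.\<close>

lemma (in torsor_sums) torsor_sums_opp: "torsor_sums R (opp T) G (\<lambda>x. map (\<lambda>(a, b, c). (c, b, a)) (\<rho> x))"
proof -
  let ?\<rho> = "\<lambda>x. map (\<lambda>(a, b, c). (c, b, a)) (\<rho> x)"
  have S': "tsum G ?\<rho> x \<phi> = S x (\<lambda>a b c. \<phi> c b a)" for x \<phi>
    by (simp add: tsum_def comp_def case_prod_unfold)
  show ?thesis
  proof (intro torsor_sums.intro torsor_sums_axioms.intro assoc_algebra_opp T.assoc_algebra_axioms
      G.module_axioms, unfold S' multilinear_opp linear_maps_opp opp_simps)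
    show "set (?\<rho> x) \<subseteq> \<T> \<times> \<T> \<times> \<T>" if "x \<in> \<T>" for x
      using rho_closed[OF that] by auto
    show "(\<lambda>x. S x (\<lambda>a b c. \<phi> c b a)) \<in> linear_maps R T G" if "linear3 R T T T G \<phi>" for \<phi>
      by (intro linear_S_arg linear_maps_id linear3I linear3_comp[OF that])
    show "S x (\<lambda>c b a. S a (\<lambda>r q p. \<psi> p q r b c)) = S x (\<lambda>c b a. S c (\<lambda>r q p. \<psi> a b p q r))"
      if "linear5 R T T T T T G \<psi>" "x \<in> \<T>" for \<psi> x
      by (rule coassoc[OF _ that(2), symmetric, of "\<lambda>r q p b a. \<psi> a b p q r"])
        (intro linear5I linear5_comp[OF that(1)] linear_maps_id)
    show "S x (\<lambda>c b a. \<beta> (b \<cdot> a) c) = \<beta> \<e> x" if "linear2 R T T G \<beta>" "x \<in> \<T>" for \<beta> x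
      by (rule contract_right[OF _ that(2), of "\<lambda>a b. \<beta> b a"])
        (intro linear2I linear2_comp[OF that(1)] linear_maps_id)
    show "S x (\<lambda>c b a. \<beta> a (c \<cdot> b)) = \<beta> x \<e>" if "linear2 R T T G \<beta>" "x \<in> \<T>" for \<beta> x
      by (rule contract_left[OF _ that(2), of "\<lambda>a b. \<beta> b a"])
        (intro linear2I linear2_comp[OF that(1)] linear_maps_id)
    show "S (y \<cdot> x) (\<lambda>a b c. \<phi> c b a) =
        S x (\<lambda>c b a. S y (\<lambda>r q p. \<phi> (p \<cdot> a) (b \<cdot> q) (r \<cdot> c)))"
      if "linear3 R T T T G \<phi>" "x \<in> \<T>" "y \<in> \<T>" for \<phi> x y
    proof -
      note lin = linear3_comp[OF that(1)] multilinear_intros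
      \<comment> \<open>The product of \<open>x\<close> and \<open>y\<close> in the opposite algebra
        is \<open>y \<cdot> x\<close>, so the two sums come out in the other order and have to be
        exchanged.\<close>
      have "S (y \<cdot> x) (\<lambda>a b c. \<phi> c b a) = S y (\<lambda>r q p. S x (\<lambda>c b a. \<phi> (p \<cdot> a) (b \<cdot> q) (r \<cdot> c)))"
        by (rule mult[OF _ that(3,2)]) (intro lin)
      also have "\<dots> = S x (\<lambda>c b a. S y (\<lambda>r q p. \<phi> (p \<cdot> a) (b \<cdot> q) (r \<cdot> c)))"
        by (rule S_swap[OF that(3,2)]) (intro lin)
      finally show ?thesis .
    qed
    show "S \<e> (\<lambda>a b c. \<phi> c b a) = \<phi> \<e> \<e> \<e>" if "linear3 R T T T G \<phi>" for \<phi>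
      by (rule one) (intro linear3I linear3_comp[OF that] linear_maps_id)
  qed
qed

context torsor_sums
begin

text \<open>The mirror image of \<open>descent_right\<close>, read off in the opposite torsor; the
  arguments of \<open>\<phi>\<close> are permuted accordingly.\<close>

lemma descent_left:
  assumes \<phi>: "linear5 R T T T T T G \<phi>" and x: "x \<in> \<T>"
  shows "S x (\<lambda>a b c. S b (\<lambda>p q r. \<phi> (a \<cdot> r) \<e> q p c)) = S x (\<lambda>a b c. S b (\<lambda>p q r. \<phi> \<e> (a \<cdot> r) q p c))"
proof -
  interpret op: torsor_sums R "opp T" G "\<lambda>x. map (\<lambda>(a, b, c). (c, b, a)) (\<rho> x)"
    by (rule torsor_sums_opp)
  have S': "op.S x \<phi> = S x (\<lambda>a b c. \<phi> c b a)" for x \<phi>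
    by (simp add: tsum_def comp_def case_prod_unfold)
  have "linear5 R T T T T T G (\<lambda>c a b q p. \<phi> a b q p c)"
    by (intro linear5I linear5_comp[OF \<phi>] linear_maps_id)
  from op.descent_right[unfolded S' multilinear_opp opp_simps, OF this x] show ?thesis .
qed

end

section \<open>Identities that follow from
  \<open>E x = 1 \<otimes> \<theta> x \<otimes> 1\<close>\<close>

locale torsor_sums_theta = torsor_sums +
  fixes \<theta>
  assumes theta_linear: "\<theta> \<in> linear_maps R T T"
    and theta: "\<lbrakk>linear3 R T T T G \<phi>; x \<in> carrier T\<rbrakk> \<Longrightarrow>
      tsum G \<rho> x (\<lambda>a b c. tsum G \<rho> b (\<lambda>p q r. \<phi> (a \<otimes>\<^bsub>T\<^esub> r) q (p \<otimes>\<^bsub>T\<^esub> c))) = \<phi> \<one>\<^bsub>T\<^esub> (\<theta> x) \<one>\<^bsub>T\<^esub>"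
begin

lemma linear_theta: "f \<in> linear_maps R K T \<Longrightarrow> (\<lambda>x. \<theta> (f x)) \<in> linear_maps R K T"
  by (rule linear_maps_comp[OF _ theta_linear])

lemma theta_closed: "x \<in> \<T> \<Longrightarrow> \<theta> x \<in> \<T>"
  by (rule linear_maps_closed[OF theta_linear])

lemmas theta_intros = linear_theta theta_closed multilinear_intros

text \<open>Apply the defining property of \<open>\<theta>\<close> to the first leg and multiply its
  last unit by \<open>x\<^sub>2\<close>. After coassociativity the third factor reads
  \<open>x\<^sub>2\<^sub>1x\<^sub>3\<^sub>1x\<^sub>3\<^sub>2\<close>, and
  \<open>x\<^sub>3\<^sub>1x\<^sub>3\<^sub>2\<close> contracts. Unlike in the defining property,
  \<open>x\<^sub>2\<^sub>1\<close> and \<open>x\<^sub>3\<close> end up in separate factors.\<close>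

lemma theta_left:
  assumes \<phi>: "linear4 R T T T T G \<phi>" and x: "x \<in> \<T>"
  shows "S x (\<lambda>a b c. \<phi> \<e> (\<theta> a) b c) = S x (\<lambda>a b c. S b (\<lambda>p q r. \<phi> (a \<cdot> r) q p c))"
proof -
  note lin = linear4_comp[OF \<phi>] theta_intros
  have "S x (\<lambda>a b c. \<phi> \<e> (\<theta> a) b c) = S x (\<lambda>a b c. \<phi> \<e> (\<theta> a) (\<e> \<cdot> b) c)"
    by (rule S_cong[OF x]) simp
  also have "\<dots> = S x (\<lambda>a b c. S a (\<lambda>u v w. S v (\<lambda>p q r. \<phi> (u \<cdot> r) q (p \<cdot> w \<cdot> b) c)))"
    by (rule S_cong[OF x], rule theta[symmetric, of "\<lambda>t q v. \<phi> t q (v \<cdot> _) _"]) (assumption | intro lin)+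
  also have "\<dots> = S x (\<lambda>a b c. S c (\<lambda>u v w. S b (\<lambda>p q r. \<phi> (a \<cdot> r) q (p \<cdot> u \<cdot> v) w)))"
    by (rule coassoc[OF _ x, of "\<lambda>u v w b c. S v (\<lambda>p q r. \<phi> (u \<cdot> r) q (p \<cdot> w \<cdot> b) c)"]) (intro lin; assumption)
  also have "\<dots> = S x (\<lambda>a b c. S b (\<lambda>p q r. \<phi> (a \<cdot> r) q p c))"
  proof (rule S_cong[OF x])
    fix a b c assume abc: "a \<in> \<T>" "b \<in> \<T>" "c \<in> \<T>"
    have "S c (\<lambda>u v w. S b (\<lambda>p q r. \<phi> (a \<cdot> r) q (p \<cdot> u \<cdot> v) w)) =
        S b (\<lambda>p q r. S c (\<lambda>u v w. \<phi> (a \<cdot> r) q (p \<cdot> (u \<cdot> v)) w))"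
      by (subst S_swap[OF abc(3,2)]) (intro lin abc S_cong; simp add: T.m_assoc)+
    also have "\<dots> = S b (\<lambda>p q r. \<phi> (a \<cdot> r) q (p \<cdot> \<e>) c)"
      by (rule S_cong[OF abc(2)], rule contract_left[OF _ abc(3), of "\<lambda>y w. \<phi> _ _ (_ \<cdot> y) w"])
        (intro lin abc; assumption)
    also have "\<dots> = S b (\<lambda>p q r. \<phi> (a \<cdot> r) q p c)"
      by (rule S_cong[OF abc(2)]) simp
    finally show "S c (\<lambda>u v w. S b (\<lambda>p q r. \<phi> (a \<cdot> r) q (p \<cdot> u \<cdot> v) w)) =
        S b (\<lambda>p q r. \<phi> (a \<cdot> r) q p c)" .
  qed
  finally show ?thesis .
qed

text \<open>In the expansion for \<open>x \<cdot> y\<close> legs of \<open>x\<close> stand between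
  \<open>p'\<close> and \<open>c'\<close>, so the defining property does not apply to
  \<open>y\<close> directly. \<open>theta_left\<close>, which keeps these two factors apart,
  rewrites the sums over \<open>y\<close>; then the sums over \<open>x\<close> collapse by the
  defining property, and \<open>b' \<cdot> c'\<close> contracts.\<close>

lemma theta_mult:
  assumes \<phi>: "linear3 R T T T G \<phi>" and x: "x \<in> \<T>" and y: "y \<in> \<T>"
  shows "\<phi> \<e> (\<theta> (x \<cdot> y)) \<e> = \<phi> \<e> (\<theta> x \<cdot> \<theta> y) \<e>"
proof -
  note lin = linear3_comp[OF \<phi>] theta_intros x y
  have "\<phi> \<e> (\<theta> (x \<cdot> y)) \<e> = S (x \<cdot> y) (\<lambda>a b c. S b (\<lambda>p q r. \<phi> (a \<cdot> r) q (p \<cdot> c)))"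
    by (rule theta[symmetric]) (assumption | intro lin)+
  also have "\<dots> = S x (\<lambda>a b c. S y (\<lambda>a' b' c'. S (b' \<cdot> b) (\<lambda>p q r. \<phi> (a \<cdot> a' \<cdot> r) q (p \<cdot> (c \<cdot> c')))))"
    by (rule mult[OF _ x y]) (intro lin; assumption)
  also have "\<dots> = S x (\<lambda>a b c. S y (\<lambda>a' b' c'. S b' (\<lambda>p' q' r'. S b (\<lambda>p q r.
      \<phi> (a \<cdot> (a' \<cdot> r' \<cdot> r)) (q \<cdot> q') (p' \<cdot> (p \<cdot> c) \<cdot> c')))))"
  proof (intro S_cong x y)
    fix a b c a' b' c'
    assume h: "a \<in> \<T>" "b \<in> \<T>" "c \<in> \<T>" "a' \<in> \<T>" "b' \<in> \<T>" "c' \<in> \<T>"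
    have "S (b' \<cdot> b) (\<lambda>p q r. \<phi> (a \<cdot> a' \<cdot> r) q (p \<cdot> (c \<cdot> c'))) =
        S b' (\<lambda>p' q' r'. S b (\<lambda>p q r. \<phi> (a \<cdot> a' \<cdot> (r' \<cdot> r)) (q \<cdot> q') (p' \<cdot> p \<cdot> (c \<cdot> c'))))"
      by (rule mult[OF _ h(5,2)]) (intro lin h; assumption)
    also have "\<dots> = S b' (\<lambda>p' q' r'. S b (\<lambda>p q r. \<phi> (a \<cdot> (a' \<cdot> r' \<cdot> r)) (q \<cdot> q') (p' \<cdot> (p \<cdot> c) \<cdot> c')))"
      by (intro S_cong h) (simp add: T.m_assoc h)
    finally show "S (b' \<cdot> b) (\<lambda>p q r. \<phi> (a \<cdot> a' \<cdot> r) q (p \<cdot> (c \<cdot> c'))) = \<dots>" .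
  qed
  also have "\<dots> = S x (\<lambda>a b c. S b (\<lambda>p q r. S y (\<lambda>a' b' c'. S b' (\<lambda>p' q' r'.
      \<phi> (a \<cdot> (a' \<cdot> r' \<cdot> r)) (q \<cdot> q') (p' \<cdot> (p \<cdot> c) \<cdot> c')))))"
  proof (rule S_cong[OF x])
    fix a b c assume h: "a \<in> \<T>" "b \<in> \<T>" "c \<in> \<T>"
    have "S y (\<lambda>a' b' c'. S b' (\<lambda>p' q' r'. S b (\<lambda>p q r.
          \<phi> (a \<cdot> (a' \<cdot> r' \<cdot> r)) (q \<cdot> q') (p' \<cdot> (p \<cdot> c) \<cdot> c')))) =
        S y (\<lambda>a' b' c'. S b (\<lambda>p q r. S b' (\<lambda>p' q' r'.
          \<phi> (a \<cdot> (a' \<cdot> r' \<cdot> r)) (q \<cdot> q') (p' \<cdot> (p \<cdot> c) \<cdot> c'))))"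
      by (rule S_cong[OF y], rule S_swap) (assumption | intro lin h)+
    also have "\<dots> = S b (\<lambda>p q r. S y (\<lambda>a' b' c'. S b' (\<lambda>p' q' r'.
          \<phi> (a \<cdot> (a' \<cdot> r' \<cdot> r)) (q \<cdot> q') (p' \<cdot> (p \<cdot> c) \<cdot> c'))))"
      by (rule S_swap) (assumption | intro lin h)+
    finally show "S y (\<lambda>a' b' c'. S b' (\<lambda>p' q' r'. S b (\<lambda>p q r.
          \<phi> (a \<cdot> (a' \<cdot> r' \<cdot> r)) (q \<cdot> q') (p' \<cdot> (p \<cdot> c) \<cdot> c')))) = \<dots>" .
  qed
  also have "\<dots> = S x (\<lambda>a b c. S b (\<lambda>p q r. S y (\<lambda>a' b' c'.
      \<phi> (a \<cdot> (\<e> \<cdot> r)) (q \<cdot> \<theta> a') (b' \<cdot> (p \<cdot> c) \<cdot> c'))))"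
    by (rule S_cong[OF x], rule S_cong, assumption,
        rule theta_left[OF _ y, symmetric, of "\<lambda>t u v w. \<phi> (_ \<cdot> (t \<cdot> _)) (_ \<cdot> u) (v \<cdot> (_ \<cdot> _) \<cdot> w)"])
      (intro lin; assumption)
  also have "\<dots> = S x (\<lambda>a b c. S y (\<lambda>a' b' c'. S b (\<lambda>p q r.
      \<phi> (a \<cdot> (\<e> \<cdot> r)) (q \<cdot> \<theta> a') (b' \<cdot> (p \<cdot> c) \<cdot> c'))))"
    by (rule S_cong[OF x], rule S_swap) (assumption | intro lin)+
  also have "\<dots> = S y (\<lambda>a' b' c'. S x (\<lambda>a b c. S b (\<lambda>p q r.
      \<phi> (a \<cdot> (\<e> \<cdot> r)) (q \<cdot> \<theta> a') (b' \<cdot> (p \<cdot> c) \<cdot> c'))))"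
    by (rule S_swap) (assumption | intro lin)+
  also have "\<dots> = S y (\<lambda>a' b' c'. \<phi> \<e> (\<theta> x \<cdot> \<theta> a') (b' \<cdot> c'))"
  proof (rule S_cong[OF y])
    fix a' b' c' assume h: "a' \<in> \<T>" "b' \<in> \<T>" "c' \<in> \<T>"
    have "S x (\<lambda>a b c. S b (\<lambda>p q r. \<phi> (a \<cdot> (\<e> \<cdot> r)) (q \<cdot> \<theta> a') (b' \<cdot> (p \<cdot> c) \<cdot> c'))) =
        S x (\<lambda>a b c. S b (\<lambda>p q r. \<phi> (a \<cdot> r) (q \<cdot> \<theta> a') (b' \<cdot> (p \<cdot> c) \<cdot> c')))"
      by (intro S_cong x) simp_all
    also have "\<dots> = \<phi> \<e> (\<theta> x \<cdot> \<theta> a') (b' \<cdot> \<e> \<cdot> c')"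
      by (rule theta[OF _ x, of "\<lambda>t u v. \<phi> t (u \<cdot> \<theta> a') (b' \<cdot> v \<cdot> c')"]) (intro lin h; assumption)
    finally show "S x (\<lambda>a b c. S b (\<lambda>p q r. \<phi> (a \<cdot> (\<e> \<cdot> r)) (q \<cdot> \<theta> a') (b' \<cdot> (p \<cdot> c) \<cdot> c'))) =
        \<phi> \<e> (\<theta> x \<cdot> \<theta> a') (b' \<cdot> c')" using h by simp
  qed
  also have "\<dots> = \<phi> \<e> (\<theta> x \<cdot> \<theta> y) \<e>"
    by (rule contract_right[OF _ y, of "\<lambda>u v. \<phi> \<e> (\<theta> x \<cdot> \<theta> u) v"]) (intro lin; assumption)
  finally show ?thesis .
qed

lemma theta_one:
  assumes \<phi>: "linear3 R T T T G \<phi>"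
  shows "\<phi> \<e> (\<theta> \<e>) \<e> = \<phi> \<e> \<e> \<e>"
proof -
  note lin = linear3_comp[OF \<phi>] theta_intros
  have "\<phi> \<e> (\<theta> \<e>) \<e> = S \<e> (\<lambda>a b c. S b (\<lambda>p q r. \<phi> (a \<cdot> r) q (p \<cdot> c)))"
    by (rule theta[symmetric]) (assumption | intro lin)+
  also have "\<dots> = S \<e> (\<lambda>p q r. \<phi> (\<e> \<cdot> r) q (p \<cdot> \<e>))"
    by (rule one) (intro lin; assumption)
  also have "\<dots> = \<phi> (\<e> \<cdot> \<e>) \<e> (\<e> \<cdot> \<e>)"
    by (rule one) (intro lin; assumption)
  finally show ?thesis by simp
qed

text \<open>Coassociativity puts \<open>\<theta>\<close> on the first leg of
  \<open>x\<^sub>3\<close>. Writing \<open>x\<^sub>2\<close> as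
  \<open>x\<^sub>2 \<cdot> \<e>\<close> provides the unit that \<open>theta_left\<close> expects,
  and the product that arises between \<open>x\<^sub>2\<close> and \<open>x\<^sub>3\<^sub>1\<close>
  is removed by \<open>coinvariant\<close>.\<close>

lemma grunspan_first:
  assumes \<phi>: "linear5 R T T T T T G \<phi>" and x: "x \<in> \<T>"
  shows "S x (\<lambda>a b c. S a (\<lambda>p q r. \<phi> p q (\<theta> r) b c)) = S x (\<lambda>a b c. S b (\<lambda>p q r. \<phi> a r q p c))"
proof -
  note lin = linear5_comp[OF \<phi>] theta_intros
  have "S x (\<lambda>a b c. S a (\<lambda>p q r. \<phi> p q (\<theta> r) b c)) = S x (\<lambda>a b c. S c (\<lambda>p q r. \<phi> a b (\<theta> p) q r))"
    by (rule coassoc[OF _ x, of "\<lambda>p q r b c. \<phi> p q (\<theta> r) b c"]) (intro lin; assumption)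
  also have "\<dots> = S x (\<lambda>a b c. S c (\<lambda>p q r. \<phi> a (b \<cdot> \<e>) (\<theta> p) q r))"
    by (intro S_cong x) simp_all
  also have "\<dots> = S x (\<lambda>a b c. S c (\<lambda>u v w. S v (\<lambda>p q r. \<phi> a (b \<cdot> (u \<cdot> r)) q p w)))"
    by (rule S_cong[OF x], rule theta_left[of "\<lambda>t u v w. \<phi> _ (_ \<cdot> t) u v w"]) (assumption | intro lin)+
  also have "\<dots> = S x (\<lambda>a b c. S c (\<lambda>u v w. S v (\<lambda>p q r. \<phi> a (b \<cdot> u \<cdot> r) q p w)))"
    by (intro S_cong x) (simp_all add: T.m_assoc)
  also have "\<dots> = S x (\<lambda>a b c. S b (\<lambda>p q r. \<phi> a (\<e> \<cdot> r) q p c))"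
    by (rule coinvariant[OF _ x, of "\<lambda>a y v w. S v (\<lambda>p q r. \<phi> a (y \<cdot> r) q p w)"]) (intro lin; assumption)
  also have "\<dots> = S x (\<lambda>a b c. S b (\<lambda>p q r. \<phi> a r q p c))"
    by (intro S_cong x) simp_all
  finally show ?thesis .
qed

text \<open>Expanding the inner \<open>\<theta>\<close> of \<open>\<mu> (\<theta> x)\<close> leaves
  a \<open>\<mu>\<close> on the innermost middle leg. The copies of \<open>\<theta>\<close> then
  reappear one at a time: \<open>grunspan_first\<close> for \<open>x\<^sub>2\<close> yields the
  middle one, \<open>theta_left\<close> the first, and \<open>grunspan_first\<close> for
  \<open>x\<close> the last.\<close>

lemma grunspan_second:
  assumes \<phi>: "linear3 R T T T G \<phi>" and x: "x \<in> \<T>"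
  shows "S x (\<lambda>a b c. \<phi> (\<theta> a) (\<theta> b) (\<theta> c)) = S (\<theta> x) \<phi>"
proof -
  note lin = linear3_comp[OF \<phi>] theta_intros x
  have "S (\<theta> x) \<phi> = S (\<theta> x) (\<lambda>u v w. \<phi> (\<e> \<cdot> u) v (w \<cdot> \<e>))"
    by (rule S_cong) (simp_all add: theta_closed x)
  also have "\<dots> = S x (\<lambda>a b c. S b (\<lambda>p q r. S q (\<lambda>u v w. \<phi> (a \<cdot> r \<cdot> u) v (w \<cdot> (p \<cdot> c)))))"
    by (rule theta[OF _ x, symmetric, of "\<lambda>s t z. S t (\<lambda>u v w. \<phi> (s \<cdot> u) v (w \<cdot> z))"]) (intro lin; assumption)
  also have "\<dots> = S x (\<lambda>a b c. S b (\<lambda>b1 b2 b3. S b1 (\<lambda>p q r. \<phi> (a \<cdot> b3 \<cdot> b2) (\<theta> r) (q \<cdot> (p \<cdot> c)))))"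
    by (rule S_cong[OF x], rule grunspan_first[symmetric, of "\<lambda>p w v u r. \<phi> (_ \<cdot> r \<cdot> u) v (w \<cdot> (p \<cdot> _))"])
      (assumption | intro lin)+
  also have "\<dots> = S x (\<lambda>a b c. S b (\<lambda>p q r. \<phi> (\<e> \<cdot> \<theta> a) (\<theta> r) (q \<cdot> (p \<cdot> c))))"
    by (rule theta_left[OF _ x, symmetric, of "\<lambda>t u v w. S v (\<lambda>p q r. \<phi> (t \<cdot> u) (\<theta> r) (q \<cdot> (p \<cdot> w)))"])
      (intro lin; assumption)
  also have "\<dots> = S x (\<lambda>a b c. S b (\<lambda>p q r. \<phi> (\<theta> a) (\<theta> r) (q \<cdot> (p \<cdot> c))))"
    by (intro S_cong x) (simp_all add: theta_closed)
  also have "\<dots> = S x (\<lambda>a b c. S a (\<lambda>p q r. \<phi> (\<theta> p) (\<theta> q) (\<theta> r \<cdot> (b \<cdot> c))))"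
    by (rule grunspan_first[OF _ x, symmetric, of "\<lambda>a r q p c. \<phi> (\<theta> a) (\<theta> r) (q \<cdot> (p \<cdot> c))"])
      (intro lin; assumption)
  also have "\<dots> = S x (\<lambda>p q r. \<phi> (\<theta> p) (\<theta> q) (\<theta> r \<cdot> \<e>))"
    by (rule contract_right[OF _ x, of "\<lambda>a y. S a (\<lambda>p q r. \<phi> (\<theta> p) (\<theta> q) (\<theta> r \<cdot> y))"])
      (intro lin; assumption)
  also have "\<dots> = S x (\<lambda>a b c. \<phi> (\<theta> a) (\<theta> b) (\<theta> c))"
    by (rule S_cong[OF x]) (simp add: theta_closed)
  finally show ?thesis by (rule sym)
qed

end

section \<open>Decompositions of the torsor structure\<close>

lemma linear_maps_pure_right:
  "\<lbrakk>module R M; module R N; x \<in> carrier M\<rbrakk> \<Longrightarrow> pure_tensor R M N x \<in> linear_maps R N (tensor R M N)"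
  using linear2_right[OF linear2_pure_tensor, of R M N x] by simp

lemma linear_maps_pure_left:
  "\<lbrakk>module R M; module R N; y \<in> carrier N\<rbrakk> \<Longrightarrow> (\<lambda>x. pure_tensor R M N x y) \<in> linear_maps R M (tensor R M N)"
  using linear2_left[OF linear2_pure_tensor, of R M N y] by simp

lemma tensor3_sum_of_pures:
  assumes A: "module R A" and B: "module R B" and C: "module R C" and z: "z \<in> carrier (tensor3 R A B C)"
  shows "\<exists>ts. set ts \<subseteq> carrier A \<times> carrier B \<times> carrier C \<and>
    z = lsum (tensor3 R A B C) (map (\<lambda>(a, b, c). pure_tensor R A (tensor R B C) a (pure_tensor R B C b c)) ts)"
proof -
  let ?BC = "tensor R B C" and ?P = "tensor3 R A B C"
  let ?p = "\<lambda>(a, b, c). pure_tensor R A ?BC a (pure_tensor R B C b c)"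
  note BC = module_tensor[OF B C]
  interpret P: module R ?P by (intro module_tensor A BC)
  have closed: "set (map ?p ts) \<subseteq> carrier ?P" if "set ts \<subseteq> carrier A \<times> carrier B \<times> carrier C" for ts
    using that by (auto intro!: pure_tensor_closed A B C BC)
  from z show ?thesis
  proof (induction rule: module_pair.tensor_induct[OF module_pairI[OF A BC], consumes 1, case_names zero pure add])
    case zero
    show ?case by (intro exI[of _ "[]"]) auto
  next
    case (pure a w)
    obtain ps where ps: "set ps \<subseteq> carrier B \<times> carrier C"
      and w: "w = lsum ?BC (map (\<lambda>(b, c). pure_tensor R B C b c) ps)"
      using module_pair.tensor_sum_of_pures[OF module_pairI[OF B C] pure(2)] by blast
    have "pure_tensor R A ?BC a w = lsum ?P (map (pure_tensor R A ?BC a) (map (\<lambda>(b, c). pure_tensor R B C b c) ps))"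
      unfolding w using ps
      by (intro linear_maps_lsum[OF BC P.module_axioms] linear_maps_pure_right A BC pure(1))
        (auto intro!: pure_tensor_closed B C)
    also have "\<dots> = lsum ?P (map ?p (map (Pair a) ps))"
      by (simp add: comp_def case_prod_unfold)
    finally show ?case using ps pure(1) by (intro exI[of _ "map (Pair a) ps"]) auto
  next
    case (add z w)
    then obtain ts us where
      "set ts \<subseteq> carrier A \<times> carrier B \<times> carrier C" "z = lsum ?P (map ?p ts)"
      "set us \<subseteq> carrier A \<times> carrier B \<times> carrier C" "w = lsum ?P (map ?p us)" by blast
    then show ?case
      using P.lsum_append[OF closed closed, of ts us] by (intro exI[of _ "ts @ us"]) auto
  qed
qed

locale torsor_decomposition = torsor +
  fixes \<rho>
  assumes rho_closed: "x \<in> carrier T \<Longrightarrow> set (\<rho> x) \<subseteq> carrier T \<times> carrier T \<times> carrier T"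
    and rho_sum: "x \<in> carrier T \<Longrightarrow> \<mu> x = lsum (tensor3 R T (opp T) T)
      (map (\<lambda>(a, b, c). pure_tensor R T (tensor R (opp T) T) a (pure_tensor R (opp T) T b c)) (\<rho> x))"
begin

abbreviation P3 where "P3 \<equiv> tensor3 R T (opp T) T"
abbreviation P5 where "P5 \<equiv> tensor R T (tensor R (opp T) (tensor3 R T (opp T) T))"
abbreviation pure3 where
  "pure3 a b c \<equiv> pure_tensor R T (tensor R (opp T) T) a (pure_tensor R (opp T) T b c)"
abbreviation pure5 where
  "pure5 a b c d e \<equiv> pure_tensor R T (tensor R (opp T) P3) a (pure_tensor R (opp T) P3 b (pure3 c d e))"

lemma opp_module: "module R (opp T)"
  using assoc_algebra_opp[OF assoc_algebra_axioms] by (simp add: assoc_algebra_def)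

lemma module_T: "module R T" by (rule module_axioms)

lemmas modules = module_T opp_module module_tensor

lemma mu_linear: "\<mu> \<in> linear_maps R T P3"
  using mu_hom by (simp add: algebra_homs_def)

lemma tsum_cong:
  assumes "x \<in> carrier T"
    "\<And>a b c. \<lbrakk>a \<in> carrier T; b \<in> carrier T; c \<in> carrier T\<rbrakk> \<Longrightarrow> \<phi> a b c = \<psi> a b c"
  shows "tsum G \<rho> x \<phi> = tsum G \<rho> x \<psi>"
  using assms(2) by (rule tsum_congI[of \<rho> x, OF rho_closed[OF assms(1)]])

lemma tsum_hom:
  assumes "module R G" "module R H" "h \<in> linear_maps R G H" "x \<in> carrier T"
    "\<And>a b c. \<lbrakk>a \<in> carrier T; b \<in> carrier T; c \<in> carrier T\<rbrakk> \<Longrightarrow> \<phi> a b c \<in> carrier G"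
  shows "h (tsum G \<rho> x \<phi>) = tsum H \<rho> x (\<lambda>a b c. h (\<phi> a b c))"
  unfolding tsum_def using rho_closed[OF assms(4)] assms(5)
  by (subst linear_maps_lsum[OF assms(1-3)]) (auto simp: comp_def case_prod_unfold intro!: assms(5) simp: subset_iff)

lemma mu_tsum: "x \<in> carrier T \<Longrightarrow> \<mu> x = tsum P3 \<rho> x pure3"
  by (simp add: rho_sum tsum_def)

lemma hom_mu:
  assumes "module R G" "h \<in> linear_maps R P3 G" "x \<in> carrier T"
  shows "h (\<mu> x) = tsum G \<rho> x (\<lambda>a b c. h (pure3 a b c))"
  unfolding mu_tsum[OF assms(3)]
  by (rule tsum_hom[OF _ assms]) (auto intro!: modules pure_tensor_closed)

lemma tensor_lift3_mu:
  assumes "module R G" "presents G' G" "linear3 R T T T G \<phi>" "x \<in> carrier T"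
  shows "tensor_lift3 R T (opp T) T G' \<phi> (\<mu> x) = tsum G \<rho> x \<phi>"
proof -
  have \<phi>: "linear3 R T (opp T) T G \<phi>" using assms(3) by (simp add: multilinear_opp)
  note lift = tensor_lift3_linear[OF module_T opp_module module_T assms(1,2) \<phi>]
  show ?thesis
    by (subst hom_mu[OF assms(1) lift(1) assms(4)], rule tsum_cong[OF assms(4)]) (simp add: lift(2))
qed

text \<open>\<open>P5\<close> is the universal target for a double Sweedler sum, so both sides of
  coassociativity are written out there once; \<open>tsum_coassoc\<close> derives all other targets
  from it.\<close>

lemma left_coassoc_pure:
  assumes x: "x \<in> carrier T"
  shows "tensor_assoc3 R T (opp T) T (tensor R (opp T) T)
      (tensor_map R T (tensor R (opp T) T) P3 (tensor R (opp T) T) \<mu> id (\<mu> x)) =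
    tsum P5 \<rho> x (\<lambda>a b c. tsum P5 \<rho> a (\<lambda>p q r. pure5 p q r b c))"
proof -
  let ?Q = "tensor R (opp T) T"
  note map = tensor_map_closed[OF _ _ _ _ mu_linear linear_maps_id', of ?Q]
  note assoc = tensor_assoc3_linear[OF module_T opp_module module_T, of ?Q]
  have "tensor_assoc3 R T (opp T) T ?Q (tensor_map R T ?Q P3 ?Q \<mu> id (\<mu> x)) =
      tsum P5 \<rho> x (\<lambda>a b c. tensor_assoc3 R T (opp T) T ?Q (tensor_map R T ?Q P3 ?Q \<mu> id (pure3 a b c)))"
    by (rule hom_mu[OF _ linear_maps_comp[OF map assoc(1)] x]) (intro modules)+
  also have "\<dots> = tsum P5 \<rho> x (\<lambda>a b c. tsum P5 \<rho> a (\<lambda>p q r. pure5 p q r b c))"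
  proof (rule tsum_cong[OF x])
    fix a b c assume abc: "a \<in> carrier T" "b \<in> carrier T" "c \<in> carrier T"
    have bc: "pure_tensor R (opp T) T b c \<in> carrier ?Q"
      using abc by (intro pure_tensor_closed modules) simp_all
    have "tensor_map R T ?Q P3 ?Q \<mu> id (pure3 a b c) = pure_tensor R P3 ?Q (\<mu> a) (pure_tensor R (opp T) T b c)"
      using abc bc by (simp add: tensor_map_pure modules mu_linear linear_maps_id')
    then have "tensor_assoc3 R T (opp T) T ?Q (tensor_map R T ?Q P3 ?Q \<mu> id (pure3 a b c)) =
        tensor_assoc3 R T (opp T) T ?Q (pure_tensor R P3 ?Q (\<mu> a) (pure_tensor R (opp T) T b c))"
      by (rule arg_cong)
    also have "\<dots> =
        tsum P5 \<rho> a (\<lambda>p q r. tensor_assoc3 R T (opp T) T ?Q (pure_tensor R P3 ?Q (pure3 p q r) (pure_tensor R (opp T) T b c)))"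
      by (rule hom_mu[OF _ linear_maps_comp[OF linear_maps_pure_left[OF _ _ bc] assoc(1)] abc(1)]) (intro modules)+
    also have "\<dots> = tsum P5 \<rho> a (\<lambda>p q r. pure5 p q r b c)"
      using bc by (intro tsum_cong abc) (simp add: assoc(2) modules)
    finally show "tensor_assoc3 R T (opp T) T ?Q (tensor_map R T ?Q P3 ?Q \<mu> id (pure3 a b c)) =
      tsum P5 \<rho> a (\<lambda>p q r. pure5 p q r b c)" .
  qed
  finally show ?thesis .
qed

lemma right_coassoc_pure:
  assumes x: "x \<in> carrier T"
  shows "tensor_map R T (tensor R (opp T) T) T (tensor R (opp T) P3) id
      (tensor_map R (opp T) T (opp T) P3 id \<mu>) (\<mu> x) =
    tsum P5 \<rho> x (\<lambda>a b c. tsum P5 \<rho> c (\<lambda>p q r. pure5 a b p q r))"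
proof -
  let ?Q = "tensor R (opp T) T" and ?Q' = "tensor R (opp T) P3"
  note inner = tensor_map_closed[OF _ _ _ _ linear_maps_id' mu_linear, of "opp T"]
  note outer = tensor_map_closed[OF _ _ _ _ linear_maps_id' inner, of T]
  have "tensor_map R T ?Q T ?Q' id (tensor_map R (opp T) T (opp T) P3 id \<mu>) (\<mu> x) =
      tsum P5 \<rho> x (\<lambda>a b c. tensor_map R T ?Q T ?Q' id (tensor_map R (opp T) T (opp T) P3 id \<mu>) (pure3 a b c))"
    by (rule hom_mu[OF _ outer x]) (intro modules)+
  also have "\<dots> = tsum P5 \<rho> x (\<lambda>a b c. tsum P5 \<rho> c (\<lambda>p q r. pure5 a b p q r))"
  proof (rule tsum_cong[OF x])
    fix a b c assume abc: "a \<in> carrier T" "b \<in> carrier T" "c \<in> carrier T"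
    have "tensor_map R T ?Q T ?Q' id (tensor_map R (opp T) T (opp T) P3 id \<mu>) (pure3 a b c) =
        pure_tensor R T ?Q' a (pure_tensor R (opp T) P3 b (\<mu> c))"
      using abc by (simp add: tensor_map_pure modules mu_linear linear_maps_id' inner pure_tensor_closed)
    also have "\<dots> = tsum P5 \<rho> c (\<lambda>p q r. pure5 a b p q r)"
      using abc by (intro hom_mu[OF _ linear_maps_comp[OF linear_maps_pure_right linear_maps_pure_right] abc(3)])
        (auto intro!: modules)
    finally show "tensor_map R T ?Q T ?Q' id (tensor_map R (opp T) T (opp T) P3 id \<mu>) (pure3 a b c) =
      tsum P5 \<rho> c (\<lambda>p q r. pure5 a b p q r)" .
  qed
  finally show ?thesis .
qed

section \<open>Torsor axioms tested by multilinear maps\<close>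

lemma pure5_closed:
  "\<lbrakk>a \<in> carrier T; b \<in> carrier T; c \<in> carrier T; d \<in> carrier T; e \<in> carrier T\<rbrakk> \<Longrightarrow> pure5 a b c d e \<in> carrier P5"
  by (intro pure_tensor_closed modules) simp_all

lemma tsum_closed:
  assumes "module R G" "x \<in> carrier T"
    "\<And>a b c. \<lbrakk>a \<in> carrier T; b \<in> carrier T; c \<in> carrier T\<rbrakk> \<Longrightarrow> \<phi> a b c \<in> carrier G"
  shows "tsum G \<rho> x \<phi> \<in> carrier G"
proof -
  interpret G: module R G by fact
  show ?thesis
    using assms(3) by (rule tsum_closedI[of G \<rho> x, OF G.abelian_group_axioms rho_closed[OF assms(2)]])
qed

text \<open>The sum is the lift of \<open>\<phi>\<close> applied to \<open>\<mu> x\<close>, so it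
  does not depend on the chosen decomposition and inherits linearity from
  \<open>\<mu>\<close>.\<close>

lemma tsum_linear:
  assumes G: "module R G" and \<phi>: "linear3 R T T T G \<phi>"
  shows "(\<lambda>x. tsum G \<rho> x \<phi>) \<in> linear_maps R T G"
proof -
  have \<phi>': "linear3 R T (opp T) T G \<phi>" using \<phi> by (simp add: multilinear_opp)
  show ?thesis
    by (rule linear_maps_cong[OF module_T linear_maps_comp[OF mu_linear
            tensor_lift3_closed[OF module_T opp_module module_T G presents_add_monoid \<phi>']]])
      (simp add: tensor_lift3_mu[OF G presents_add_monoid \<phi>])
qed

text \<open>The axiom gives equality in \<open>P5\<close>; a linear map out of \<open>P5\<close>
  that takes \<open>pure5 a b c d e\<close> to \<open>\<psi> a b c d e\<close> carries it to
  \<open>G\<close>.\<close>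

lemma tsum_coassoc:
  assumes G: "module R G" and \<psi>: "linear5 R T T T T T G \<psi>" and x: "x \<in> carrier T"
  shows "tsum G \<rho> x (\<lambda>a b c. tsum G \<rho> a (\<lambda>p q r. \<psi> p q r b c)) =
    tsum G \<rho> x (\<lambda>a b c. tsum G \<rho> c (\<lambda>p q r. \<psi> a b p q r))"
proof -
  have P5: "module R P5" by (intro modules)
  have "linear5 R T (opp T) T (opp T) T G \<psi>" using \<psi> by (simp add: multilinear_opp)
  then obtain h where h: "h \<in> linear_maps R P5 G" and h_pure:
    "\<And>a b c d e. \<lbrakk>a \<in> carrier T; b \<in> carrier T; c \<in> carrier T; d \<in> carrier T; e \<in> carrier T\<rbrakk> \<Longrightarrow>
      h (pure5 a b c d e) = \<psi> a b c d e"
    using tensor5_lift_exists[OF module_T opp_module module_T opp_module module_T G] by force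
  note hom = tsum_hom[OF P5 G h]
  have "h (tsum P5 \<rho> x (\<lambda>a b c. tsum P5 \<rho> a (\<lambda>p q r. pure5 p q r b c))) =
      tsum G \<rho> x (\<lambda>a b c. tsum G \<rho> a (\<lambda>p q r. \<psi> p q r b c))"
    using x by (simp add: hom tsum_closed[OF P5] pure5_closed h_pure cong: tsum_cong)
  moreover have "h (tsum P5 \<rho> x (\<lambda>a b c. tsum P5 \<rho> c (\<lambda>p q r. pure5 a b p q r))) =
      tsum G \<rho> x (\<lambda>a b c. tsum G \<rho> c (\<lambda>p q r. \<psi> a b p q r))"
    using x by (simp add: hom tsum_closed[OF P5] pure5_closed h_pure cong: tsum_cong)
  ultimately show ?thesis
    using mu_coassoc[OF x] by (simp add: left_coassoc_pure[OF x] right_coassoc_pure[OF x])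
qed

lemma linear2_mult: "linear2 R T T T (monoid.mult T)"
  by (intro linear2I linear_mapsI) (auto simp: l_distr r_distr smult_mult_left smult_mult_right)

lemma linear2_mult_opp: "linear2 R (opp T) (opp T) (opp T) (monoid.mult (opp T))"
  unfolding multilinear_opp by (intro linear2I linear_mapsI) (auto simp: l_distr r_distr smult_mult_left smult_mult_right)

text \<open>The axiom \<open>mu_left\<close> is the case of the universal bilinear map into
  \<open>tensor R T T\<close>; the general case is its image under the lift of
  \<open>\<beta>\<close>.\<close>

lemma tsum_contract_left:
  assumes G: "module R G" and \<beta>: "linear2 R T T G \<beta>" and x: "x \<in> carrier T"
  shows "tsum G \<rho> x (\<lambda>a b c. \<beta> (a \<otimes>\<^bsub>T\<^esub> b) c) = \<beta> \<one>\<^bsub>T\<^esub> x"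
proof -
  let ?P = "tensor R T T" and ?h = "tensor_lift R T T (add_monoid G) \<beta>"
  have P: "module R ?P" by (intro modules)
  note h = tensor_lift_closed[OF module_T module_T G presents_add_monoid \<beta>]
    tensor_lift_pure[OF module_T module_T G presents_add_monoid \<beta>]
  have "linear3 R T T T ?P (\<lambda>a b c. pure_tensor R T T (a \<otimes>\<^bsub>T\<^esub> b) c)"
    by (intro linear3I linear2_comp[OF linear2_pure_tensor] linear2_comp[OF linear2_mult] linear_maps_id modules m_closed)
  from tensor_lift3_mu[OF P presents_tensor_group this x]
  have "tsum ?P \<rho> x (\<lambda>a b c. pure_tensor R T T (a \<otimes>\<^bsub>T\<^esub> b) c) = pure_tensor R T T \<one>\<^bsub>T\<^esub> x"
    using mu_left[OF x] by simp
  then have "?h (tsum ?P \<rho> x (\<lambda>a b c. pure_tensor R T T (a \<otimes>\<^bsub>T\<^esub> b) c)) = \<beta> \<one>\<^bsub>T\<^esub> x"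
    using x by (simp add: h)
  then show ?thesis
    using x by (simp add: tsum_hom[OF P G h(1)] pure_tensor_closed modules h(2) cong: tsum_cong)
qed

lemma tsum_contract_right:
  assumes G: "module R G" and \<beta>: "linear2 R T T G \<beta>" and x: "x \<in> carrier T"
  shows "tsum G \<rho> x (\<lambda>a b c. \<beta> a (b \<otimes>\<^bsub>T\<^esub> c)) = \<beta> x \<one>\<^bsub>T\<^esub>"
proof -
  let ?P = "tensor R T T" and ?h = "tensor_lift R T T (add_monoid G) \<beta>"
  have P: "module R ?P" by (intro modules)
  note h = tensor_lift_closed[OF module_T module_T G presents_add_monoid \<beta>]
    tensor_lift_pure[OF module_T module_T G presents_add_monoid \<beta>]
  have "linear3 R T T T ?P (\<lambda>a b c. pure_tensor R T T a (b \<otimes>\<^bsub>T\<^esub> c))"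
    by (intro linear3I linear2_comp[OF linear2_pure_tensor] linear2_comp[OF linear2_mult] linear_maps_id modules m_closed)
  from tensor_lift3_mu[OF P presents_tensor_group this x]
  have "tsum ?P \<rho> x (\<lambda>a b c. pure_tensor R T T a (b \<otimes>\<^bsub>T\<^esub> c)) = pure_tensor R T T x \<one>\<^bsub>T\<^esub>"
    using mu_right[OF x] by simp
  then have "?h (tsum ?P \<rho> x (\<lambda>a b c. pure_tensor R T T a (b \<otimes>\<^bsub>T\<^esub> c))) = \<beta> x \<one>\<^bsub>T\<^esub>"
    using x by (simp add: h)
  then show ?thesis
    using x by (simp add: tsum_hom[OF P G h(1)] pure_tensor_closed modules h(2) cong: tsum_cong)
qed

text \<open>Since the product of \<open>P3\<close> is bilinear, \<open>\<mu> x\<close> and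
  \<open>\<mu> y\<close> can be expanded one after the other inside it. The middle legs multiply in
  the order \<open>q\<close>, \<open>b\<close> because the middle factor is the opposite
  algebra.\<close>

lemma tsum_mult:
  assumes G: "module R G" and \<phi>: "linear3 R T T T G \<phi>" and x: "x \<in> carrier T" and y: "y \<in> carrier T"
  shows "tsum G \<rho> (x \<otimes>\<^bsub>T\<^esub> y) \<phi> =
    tsum G \<rho> x (\<lambda>a b c. tsum G \<rho> y (\<lambda>p q r. \<phi> (a \<otimes>\<^bsub>T\<^esub> p) (q \<otimes>\<^bsub>T\<^esub> b) (c \<otimes>\<^bsub>T\<^esub> r)))"
proof -
  let ?Q = "tensor R (opp T) T" and ?h = "tensor_lift3 R T (opp T) T (add_monoid G) \<phi>"
  have \<phi>': "linear3 R T (opp T) T G \<phi>" using \<phi> by (simp add: multilinear_opp)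
  note h = tensor_lift3_linear[OF module_T opp_module module_T G presents_add_monoid \<phi>']
  note multQ = tensor_mult_linear[OF opp_module module_T linear2_mult_opp linear2_mult]
  have Q: "module R ?Q" by (intro modules)
  note multP = tensor_mult_linear[OF module_T Q linear2_mult multQ(1)]
  have mu_y: "\<mu> y \<in> carrier P3" using mu_linear y by (rule linear_maps_closed)
  have "\<mu> (x \<otimes>\<^bsub>T\<^esub> y) = \<mu> x \<otimes>\<^bsub>P3\<^esub> \<mu> y"
    using mu_hom x y by (simp add: algebra_homs_def ring_hom_def)
  then have "tsum G \<rho> (x \<otimes>\<^bsub>T\<^esub> y) \<phi> = ?h (\<mu> x \<otimes>\<^bsub>P3\<^esub> \<mu> y)"
    using tensor_lift3_mu[OF G presents_add_monoid \<phi>, of "x \<otimes>\<^bsub>T\<^esub> y"] x y by simp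
  also have "\<dots> = tsum G \<rho> x (\<lambda>a b c. ?h (pure3 a b c \<otimes>\<^bsub>P3\<^esub> \<mu> y))"
    by (rule hom_mu[OF G linear_maps_comp[OF linear2_left[OF multP(1) mu_y] h(1)] x])
  also have "\<dots> = tsum G \<rho> x (\<lambda>a b c. tsum G \<rho> y (\<lambda>p q r. \<phi> (a \<otimes>\<^bsub>T\<^esub> p) (q \<otimes>\<^bsub>T\<^esub> b) (c \<otimes>\<^bsub>T\<^esub> r)))"
  proof (rule tsum_cong[OF x])
    fix a b c assume abc: "a \<in> carrier T" "b \<in> carrier T" "c \<in> carrier T"
    then have "pure3 a b c \<in> carrier P3" by (intro pure_tensor_closed modules) simp_all
    from hom_mu[OF G linear_maps_comp[OF linear2_right[OF multP(1) this] h(1)] y]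
    have "?h (pure3 a b c \<otimes>\<^bsub>P3\<^esub> \<mu> y) = tsum G \<rho> y (\<lambda>p q r. ?h (pure3 a b c \<otimes>\<^bsub>P3\<^esub> pure3 p q r))" .
    also have "\<dots> = tsum G \<rho> y (\<lambda>p q r. \<phi> (a \<otimes>\<^bsub>T\<^esub> p) (q \<otimes>\<^bsub>T\<^esub> b) (c \<otimes>\<^bsub>T\<^esub> r))"
      using abc by (intro tsum_cong y) (simp add: multP(2) multQ(2) h(2) pure_tensor_closed modules)
    finally show "?h (pure3 a b c \<otimes>\<^bsub>P3\<^esub> \<mu> y) = \<dots>" .
  qed
  finally show ?thesis .
qed

lemma tsum_one:
  assumes G: "module R G" and \<phi>: "linear3 R T T T G \<phi>"
  shows "tsum G \<rho> \<one>\<^bsub>T\<^esub> \<phi> = \<phi> \<one>\<^bsub>T\<^esub> \<one>\<^bsub>T\<^esub> \<one>\<^bsub>T\<^esub>"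
proof -
  have \<phi>': "linear3 R T (opp T) T G \<phi>" using \<phi> by (simp add: multilinear_opp)
  have "\<mu> \<one>\<^bsub>T\<^esub> = \<one>\<^bsub>P3\<^esub>"
    using mu_hom by (simp add: algebra_homs_def ring_hom_def)
  also have "\<dots> = pure3 \<one>\<^bsub>T\<^esub> \<one>\<^bsub>T\<^esub> \<one>\<^bsub>T\<^esub>"
    by (simp add: tensor_def)
  finally show ?thesis
    using tensor_lift3_mu[OF G presents_add_monoid \<phi> one_closed]
      tensor_lift3_pure[OF module_T opp_module module_T G presents_add_monoid \<phi>'] by simp
qed

lemma torsor_sums: "module R G \<Longrightarrow> torsor_sums R T G \<rho>"
  by (intro torsor_sums.intro torsor_sums_axioms.intro assoc_algebra_axioms rho_closed tsum_linear
      tsum_coassoc tsum_contract_left tsum_contract_right tsum_mult tsum_one)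

end

lemma torsor_decomposition_exists:
  assumes "torsor R T \<mu>" shows "\<exists>\<rho>. torsor_decomposition R T \<mu> \<rho>"
proof -
  interpret torsor R T \<mu> by fact
  have opp: "module R (opp T)"
    using assoc_algebra_opp[OF assoc_algebra_axioms] by (simp add: assoc_algebra_def)
  have "\<mu> x \<in> carrier (tensor3 R T (opp T) T)" if "x \<in> carrier T" for x
    using mu_hom that by (auto simp: algebra_homs_def intro: linear_maps_closed)
  from tensor3_sum_of_pures[OF module_axioms opp module_axioms this]
  have "\<forall>x\<in>carrier T. \<exists>ts. set ts \<subseteq> carrier T \<times> carrier T \<times> carrier T \<and>
      \<mu> x = lsum (tensor3 R T (opp T) T)
        (map (\<lambda>(a, b, c). pure_tensor R T (tensor R (opp T) T) a (pure_tensor R (opp T) T b c)) ts)"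
    by (simp only: opp_simps(1)) blast
  from bchoice[OF this] obtain \<rho> where \<rho>: "\<forall>x\<in>carrier T. set (\<rho> x) \<subseteq> carrier T \<times> carrier T \<times> carrier T \<and>
      \<mu> x = lsum (tensor3 R T (opp T) T)
        (map (\<lambda>(a, b, c). pure_tensor R T (tensor R (opp T) T) a (pure_tensor R (opp T) T b c)) (\<rho> x))"
    by blast
  have "torsor_decomposition R T \<mu> \<rho>"
    by (intro torsor_decomposition.intro torsor_decomposition_axioms.intro torsor_axioms) (use \<rho> in blast)+
  then show ?thesis by blast
qed

section \<open>Faithfully flat descent\<close>

text \<open>Codes a list of words as a single word: \<open>u\<close> announces a letter of the
  current word and \<open>v\<close> ends the word. Two distinct elements suffice as markers, and in
  a nonzero algebra one and zero are available.\<close>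

fun encode_words :: "'a \<Rightarrow> 'a \<Rightarrow> 'a list list \<Rightarrow> 'a list" where
  "encode_words u v [] = []"
| "encode_words u v ([] # ls) = v # encode_words u v ls"
| "encode_words u v ((x # l) # ls) = u # x # encode_words u v (l # ls)"

lemma inj_encode_words:
  assumes "u \<noteq> v" shows "inj (encode_words u v)"
proof (rule injI)
  fix ls ms show "encode_words u v ls = encode_words u v ms \<Longrightarrow> ls = ms"
    using assms
  proof (induction u v ls arbitrary: ms rule: encode_words.induct)
    case (1 u v)
    then show ?case by (cases "(u, v, ms)" rule: encode_words.cases) auto
  next
    case (2 u v ls)
    then show ?case by (cases "(u, v, ms)" rule: encode_words.cases) auto
  next
    case (3 u v x l ls)
    show ?case
    proof (cases "(u, v, ms)" rule: encode_words.cases)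
      case (3 u' v' x' l' ls')
      then have "encode_words u v (l # ls) = encode_words u v (l' # ls')" and x: "x = x'"
        using "3.prems"(1) by auto
      with 3 "3.IH"[of "l' # ls'"] "3.prems"(2) show ?thesis by auto
    qed (use "3.prems" in auto)
  qed
qed

text \<open>A module covered by \<^typ>\<open>'a list\<close> has an isomorphic copy with elements in
  \<^typ>\<open>('a list \<Rightarrow> 'k) set\<close>, the type over which \<^const>\<open>faithfully_flat\<close> quantifies.\<close>

definition list_covered :: "'a itself \<Rightarrow> ('m, 'z) partial_object_scheme \<Rightarrow> bool" where
  "list_covered _ M \<longleftrightarrow> (\<exists>g :: 'a list \<Rightarrow> 'm. carrier M \<subseteq> range g)"

lemma list_covered_self: "list_covered TYPE('a) (A :: ('a, 'z) partial_object_scheme)"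
  unfolding list_covered_def by (rule exI[of _ hd]) (auto intro: range_eqI[of _ hd "[_]"])

text \<open>An element is named by a list of pairs of words, one pair for each simple tensor. Coding
  first each pair and then the whole list yields a single word; the covering map decodes it and sums
  up.\<close>

lemma list_covered_tensor:
  fixes u v :: 'a
  assumes uv: "u \<noteq> v" and M: "module R M" and N: "module R N"
    and covered: "list_covered TYPE('a) M" "list_covered TYPE('a) N"
  shows "list_covered TYPE('a) (tensor R M N)"
proof -
  obtain g :: "'a list \<Rightarrow> _" and h :: "'a list \<Rightarrow> _" where g: "carrier M \<subseteq> range g" and h: "carrier N \<subseteq> range h"
    using covered unfolding list_covered_def by blast
  let ?enc = "\<lambda>ps. encode_words u v (map (\<lambda>(k, l). encode_words u v [k, l]) ps)"
  have "inj (\<lambda>(k, l). encode_words u v [k, l])"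
    using inj_encode_words[OF uv] by (auto simp: inj_def)
  then have inj: "inj ?enc"
    using inj_compose[OF inj_encode_words[OF uv] inj_mapI] by (simp add: comp_def)
  let ?sum = "\<lambda>ps. lsum (tensor R M N) (map (\<lambda>(k, l). pure_tensor R M N (g k) (h l)) ps)"
  have "carrier (tensor R M N) \<subseteq> range (?sum \<circ> inv_into UNIV ?enc)"
  proof
    fix z assume "z \<in> carrier (tensor R M N)"
    then obtain ps where ps: "set ps \<subseteq> carrier M \<times> carrier N"
      and z: "z = lsum (tensor R M N) (map (\<lambda>(x, y). pure_tensor R M N x y) ps)"
      using module_pair.tensor_sum_of_pures[OF module_pairI[OF M N]] by blast
    have "\<forall>p\<in>set ps. \<exists>q. p = (\<lambda>(k, l). (g k, h l)) q"
    proof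
      fix p assume "p \<in> set ps"
      then have "p \<in> carrier M \<times> carrier N" using ps by blast
      then have "fst p \<in> range g" "snd p \<in> range h" using g h by (auto simp: mem_Times_iff)
      then obtain k l where "fst p = g k" "snd p = h l" by blast
      then show "\<exists>q. p = (\<lambda>(k, l). (g k, h l)) q" by (intro exI[of _ "(k, l)"]) (simp add: prod_eq_iff)
    qed
    then obtain qs where "ps = map (\<lambda>(k, l). (g k, h l)) qs" unfolding ex_map_conv[symmetric] by blast
    then have "z = ?sum qs" by (simp add: z comp_def case_prod_unfold)
    also have "\<dots> = (?sum \<circ> inv_into UNIV ?enc) (?enc qs)" by (simp add: inv_into_f_f[OF inj])
    finally show "z \<in> range (?sum \<circ> inv_into UNIV ?enc)" by blast
  qed
  then show ?thesis unfolding list_covered_def by blast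
qed

lemma list_covered_inj:
  fixes R :: "('k, 'r) ring_scheme" and M :: "('m, 'z) partial_object_scheme"
  assumes nontriv: "\<one>\<^bsub>R\<^esub> \<noteq> \<zero>\<^bsub>R\<^esub>" and "list_covered TYPE('a) M"
  shows "\<exists>i :: 'm \<Rightarrow> ('a list \<Rightarrow> 'k) set. inj_on i (carrier M)"
proof -
  obtain g :: "'a list \<Rightarrow> 'm" where g: "carrier M \<subseteq> range g"
    using assms(2) unfolding list_covered_def by blast
  define j where "j = (\<lambda>m. SOME l. g l = m)"
  have "g (j m) = m" if "m \<in> carrier M" for m
    unfolding j_def by (rule someI_ex) (use g that in blast)
  then have "inj_on j (carrier M)" by (metis inj_onI)
  \<comment> \<open>A word becomes the singleton of its indicator function with values in
    \<open>R\<close>; different words stay different because one and zero of \<open>R\<close>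
    do.\<close>
  moreover have "inj (\<lambda>l. {\<lambda>l' :: 'a list. if l' = l then \<one>\<^bsub>R\<^esub> else \<zero>\<^bsub>R\<^esub>})"
    using nontriv by (auto simp: inj_def fun_eq_iff split: if_splits)
  ultimately have "inj_on ((\<lambda>l. {\<lambda>l' :: 'a list. if l' = l then \<one>\<^bsub>R\<^esub> else \<zero>\<^bsub>R\<^esub>}) \<circ> j) (carrier M)"
    using comp_inj_on inj_on_subset by blast
  then show ?thesis by blast
qed

section \<open>Copies of a module in another type\<close>

definition transport :: "('m \<Rightarrow> 'n) \<Rightarrow> ('k, 'm, 'z) module_scheme \<Rightarrow> ('k, 'n) module" where
  "transport i M = (let j = inv_into (carrier M) i in
     \<lparr>carrier = i ` carrier M,
      monoid.mult = (\<lambda>x y. i (j x \<otimes>\<^bsub>M\<^esub> j y)),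
      one = i \<one>\<^bsub>M\<^esub>,
      ring.zero = i \<zero>\<^bsub>M\<^esub>,
      ring.add = (\<lambda>x y. i (j x \<oplus>\<^bsub>M\<^esub> j y)),
      smult = (\<lambda>r x. i (r \<odot>\<^bsub>M\<^esub> j x))\<rparr>)"

lemma transport_module:
  assumes M: "module R M" and inj: "inj_on i (carrier M)"
  shows "module R (transport i M)"
    and "i \<in> linear_maps R M (transport i M)"
    and "inv_into (carrier M) i \<in> linear_maps R (transport i M) M"
    and "\<And>x. x \<in> carrier M \<Longrightarrow> inv_into (carrier M) i (i x) = x"
    and "\<And>y. y \<in> carrier (transport i M) \<Longrightarrow> i (inv_into (carrier M) i y) = y"
proof -
  interpret M: module R M by fact
  note simps = transport_def Let_def inv_into_f_f[OF inj]
  have "abelian_group (transport i M)"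
  proof (rule abelian_groupI)
    fix x assume "x \<in> carrier (transport i M)"
    then obtain x' where "x' \<in> carrier M" "x = i x'" by (auto simp: simps)
    then show "\<exists>y\<in>carrier (transport i M). y \<oplus>\<^bsub>transport i M\<^esub> x = \<zero>\<^bsub>transport i M\<^esub>"
      by (intro bexI[of _ "i (\<ominus>\<^bsub>M\<^esub> x')"]) (auto simp: simps M.l_neg)
  qed (auto simp: simps M.a_ac)
  then show "module R (transport i M)"
    by (rule moduleI[OF M.is_cring])
      (auto simp: simps M.smult_l_distr M.smult_r_distr M.smult_assoc1)
  show "i \<in> linear_maps R M (transport i M)"
    by (rule linear_mapsI) (auto simp: simps)
  show "inv_into (carrier M) i \<in> linear_maps R (transport i M) M"
    by (rule linear_mapsI) (auto simp: simps)
qed (auto simp: transport_def Let_def inj f_inv_into_f)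

lemma linear_maps_mem_a_kernel:
  "z \<in> a_kernel M N f \<longleftrightarrow> z \<in> carrier M \<and> f z = \<zero>\<^bsub>N\<^esub>"
  by (simp add: a_kernel_def kernel_def)

text \<open>Functoriality, with the composite named by a separate \<open>h\<close> that has to agree
  only on the carrier: inverses of transport maps cancel there, but in general not
  everywhere.\<close>

lemma tensor_map_comp:
  assumes mods: "module R M" "module R N" "module R N'" "module R N''"
    and f: "f \<in> linear_maps R N N'" and g: "g \<in> linear_maps R N' N''"
    and h: "h \<in> linear_maps R N N''" and gf: "\<And>y. y \<in> carrier N \<Longrightarrow> g (f y) = h y"
    and z: "z \<in> carrier (tensor R M N)"
  shows "tensor_map R M N' M N'' id g (tensor_map R M N M N' id f z) = tensor_map R M N M N'' id h z"
proof (rule tensor_ext[OF mods(1,2) module_tensor[OF mods(1,4)] _ _ _ z])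
  note closed = tensor_map_closed[OF _ _ _ _ linear_maps_id']
  show "(\<lambda>z. tensor_map R M N' M N'' id g (tensor_map R M N M N' id f z)) \<in>
      linear_maps R (tensor R M N) (tensor R M N'')"
    by (rule linear_maps_comp[OF closed closed]) (rule mods f g)+
  show "tensor_map R M N M N'' id h \<in> linear_maps R (tensor R M N) (tensor R M N'')"
    by (rule closed) (rule mods h)+
  show "tensor_map R M N' M N'' id g (tensor_map R M N M N' id f (pure_tensor R M N x y)) =
      tensor_map R M N M N'' id h (pure_tensor R M N x y)" if "x \<in> carrier M" "y \<in> carrier N" for x y
    using that mods f g h linear_maps_closed[OF f]
    by (simp add: tensor_map_pure linear_maps_id' gf)
qed

lemma tensor_map_identity:
  assumes mods: "module R M" "module R N" and z: "z \<in> carrier (tensor R M N)"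
  shows "tensor_map R M N M N id (\<lambda>y. y) z = z"
  by (rule tensor_ext[OF mods module_tensor[OF mods] _ linear_maps_id _ z])
    (simp_all add: mods tensor_map_closed tensor_map_pure linear_maps_id' linear_maps_id)

text \<open>A sequence of modules covered by words is isomorphic to a sequence in the type over
  which \<open>faithfully_flat\<close> quantifies. Exactness is carried to the copy after tensoring
  with \<open>T\<close>, and back from the copy without \<open>T\<close>.\<close>

lemma faithfully_flat_exact:
  fixes R :: "('k, 'r) ring_scheme" and T :: "('k, 'a, 't) module_scheme"
  assumes ff: "faithfully_flat R T" and nontriv: "\<one>\<^bsub>R\<^esub> \<noteq> \<zero>\<^bsub>R\<^esub>"
    and N: "module R N1" "module R N2" "module R N3"
    and covered: "list_covered TYPE('a) N1" "list_covered TYPE('a) N2" "list_covered TYPE('a) N3"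
    and f: "f \<in> linear_maps R N1 N2" and g: "g \<in> linear_maps R N2 N3"
    and exact: "tensor_map R T N1 T N2 id f ` carrier (tensor R T N1) =
      a_kernel (tensor R T N2) (tensor R T N3) (tensor_map R T N2 T N3 id g)"
  shows "f ` carrier N1 = a_kernel N2 N3 g"
proof -
  have T: "module R T" using ff by (simp add: faithfully_flat_def)
  obtain i1 :: "_ \<Rightarrow> ('a list \<Rightarrow> 'k) set" where inj1: "inj_on i1 (carrier N1)"
    using list_covered_inj[OF nontriv covered(1)] by blast
  obtain i2 :: "_ \<Rightarrow> ('a list \<Rightarrow> 'k) set" where inj2: "inj_on i2 (carrier N2)"
    using list_covered_inj[OF nontriv covered(2)] by blast
  obtain i3 :: "_ \<Rightarrow> ('a list \<Rightarrow> 'k) set" where inj3: "inj_on i3 (carrier N3)"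
    using list_covered_inj[OF nontriv covered(3)] by blast
  define N1' N2' N3' where N'_def: "N1' = transport i1 N1" "N2' = transport i2 N2" "N3' = transport i3 N3"
  define j1 j2 j3 where j_def: "j1 = inv_into (carrier N1) i1" "j2 = inv_into (carrier N2) i2"
    "j3 = inv_into (carrier N3) i3"
  note t1 = transport_module[OF N(1) inj1, folded N'_def j_def]
    and t2 = transport_module[OF N(2) inj2, folded N'_def j_def]
    and t3 = transport_module[OF N(3) inj3, folded N'_def j_def]
  define f' g' where f'_def: "f' = (\<lambda>x. i2 (f (j1 x)))" and g'_def: "g' = (\<lambda>x. i3 (g (j2 x)))"
  have fj: "(\<lambda>x. f (j1 x)) \<in> linear_maps R N1' N2" and gj: "(\<lambda>x. g (j2 x)) \<in> linear_maps R N2' N3"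
    by (rule linear_maps_comp[OF t1(3) f], rule linear_maps_comp[OF t2(3) g])
  have f': "f' \<in> linear_maps R N1' N2'" and g': "g' \<in> linear_maps R N2' N3'"
    unfolding f'_def g'_def by (rule linear_maps_comp[OF fj t2(2)], rule linear_maps_comp[OF gj t3(2)])
  note closed = tensor_map_closed[OF _ _ _ _ linear_maps_id', THEN linear_maps_closed]
  let ?F = "tensor_map R T N1 T N2 id f" and ?G = "tensor_map R T N2 T N3 id g"
  let ?F' = "tensor_map R T N1' T N2' id f'" and ?G' = "tensor_map R T N2' T N3' id g'"
  let ?I1 = "tensor_map R T N1 T N1' id i1" and ?J1 = "tensor_map R T N1' T N1 id j1"
  let ?I2 = "tensor_map R T N2 T N2' id i2" and ?J2 = "tensor_map R T N2' T N2 id j2"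
  let ?I3 = "tensor_map R T N3 T N3' id i3" and ?J3 = "tensor_map R T N3' T N3 id j3"
  \<comment> \<open>Naturality: under the tensored isomorphisms the transported maps correspond to
    the original ones. The squares \<open>JF'\<close> and \<open>JG'\<close> carry images and
    kernels back and forth.\<close>
  have JF': "?J2 (?F' z) = ?F (?J1 z)" if z: "z \<in> carrier (tensor R T N1')" for z
  proof -
    have "?J2 (?F' z) = tensor_map R T N1' T N2 id (\<lambda>x. f (j1 x)) z"
      by (rule tensor_map_comp[OF T t1(1) t2(1) N(2) f' t2(3) fj _ z])
        (simp add: f'_def t2(4) linear_maps_closed[OF fj])
    also have "\<dots> = ?F (?J1 z)"
      by (rule tensor_map_comp[OF T t1(1) N(1,2) t1(3) f fj refl z, symmetric])
    finally show ?thesis .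
  qed
  have JG': "?J3 (?G' z) = ?G (?J2 z)" if z: "z \<in> carrier (tensor R T N2')" for z
  proof -
    have "?J3 (?G' z) = tensor_map R T N2' T N3 id (\<lambda>x. g (j2 x)) z"
      by (rule tensor_map_comp[OF T t2(1) t3(1) N(3) g' t3(3) gj _ z])
        (simp add: g'_def t3(4) linear_maps_closed[OF gj])
    also have "\<dots> = ?G (?J2 z)"
      by (rule tensor_map_comp[OF T t2(1) N(2,3) t2(3) g gj refl z, symmetric])
    finally show ?thesis .
  qed
  have IJ: "tensor_map R T M T M' id i (tensor_map R T M' T M id j z) = z"
    if "module R M" "module R M'" "i \<in> linear_maps R M M'" "j \<in> linear_maps R M' M"
      "\<And>y. y \<in> carrier M' \<Longrightarrow> i (j y) = y" "z \<in> carrier (tensor R T M')" for M M' i j z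
    using tensor_map_comp[OF T that(2,1,2,4,3) linear_maps_id that(5,6)] tensor_map_identity[OF T that(2,6)]
    by simp
  have IJ2: "?I2 (?J2 z) = z" if "z \<in> carrier (tensor R T N2')" for z
    by (rule IJ[OF N(2) t2(1-3) _ that]) (rule t2(5))
  have IJ3: "?I3 (?J3 z) = z" if "z \<in> carrier (tensor R T N3')" for z
    by (rule IJ[OF N(3) t3(1-3) _ that]) (rule t3(5))
  have JI1: "?J1 (?I1 z) = z" if "z \<in> carrier (tensor R T N1)" for z
    by (rule IJ[OF t1(1) N(1) t1(3,2) _ that]) (rule t1(4))
  \<comment> \<open>Isomorphisms detect zero, so kernels may be compared after applying
    \<open>?J3\<close>.\<close>
  have zero: "?J3 w = \<zero>\<^bsub>tensor R T N3\<^esub> \<longleftrightarrow> w = \<zero>\<^bsub>tensor R T N3'\<^esub>" if "w \<in> carrier (tensor R T N3')" for w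
    using IJ3[OF that] linear_maps_zero[OF module_tensor[OF T N(3)] module_tensor[OF T t3(1)]
        tensor_map_closed[OF T N(3) T t3(1) linear_maps_id' t3(2)]]
      linear_maps_zero[OF module_tensor[OF T t3(1)] module_tensor[OF T N(3)]
        tensor_map_closed[OF T t3(1) T N(3) linear_maps_id' t3(3)]] by metis
  have "?F' ` carrier (tensor R T N1') = a_kernel (tensor R T N2') (tensor R T N3') ?G'"
  proof (intro equalityI subsetI)
    fix w assume "w \<in> ?F' ` carrier (tensor R T N1')"
    then obtain z where z: "z \<in> carrier (tensor R T N1')" and w: "w = ?F' z" by blast
    have wc: "w \<in> carrier (tensor R T N2')" unfolding w by (rule closed[OF T t1(1) T t2(1) f' z])
    have "?F (?J1 z) \<in> a_kernel (tensor R T N2) (tensor R T N3) ?G"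
      using exact closed[OF T t1(1) T N(1) t1(3) z] by blast
    then have "?J3 (?G' w) = \<zero>\<^bsub>tensor R T N3\<^esub>"
      using JG'[OF wc] JF'[OF z] w by (simp add: linear_maps_mem_a_kernel)
    then show "w \<in> a_kernel (tensor R T N2') (tensor R T N3') ?G'"
      using zero[OF closed[OF T t2(1) T t3(1) g' wc]] wc by (simp add: linear_maps_mem_a_kernel)
  next
    fix w assume "w \<in> a_kernel (tensor R T N2') (tensor R T N3') ?G'"
    then have w: "w \<in> carrier (tensor R T N2')" and Gw: "?G' w = \<zero>\<^bsub>tensor R T N3'\<^esub>"
      by (simp_all add: linear_maps_mem_a_kernel)
    have "?G (?J2 w) = \<zero>\<^bsub>tensor R T N3\<^esub>"
      using JG'[OF w] zero[OF closed[OF T t2(1) T t3(1) g' w]] Gw by simp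
    then have "?J2 w \<in> ?F ` carrier (tensor R T N1)"
      unfolding exact linear_maps_mem_a_kernel using closed[OF T t2(1) T N(2) t2(3) w] by simp
    then obtain z where z: "z \<in> carrier (tensor R T N1)" and wz: "?J2 w = ?F z" by blast
    have z': "?I1 z \<in> carrier (tensor R T N1')" by (rule closed[OF T N(1) T t1(1) t1(2) z])
    have "?J2 (?F' (?I1 z)) = ?J2 w" using JF'[OF z'] JI1[OF z] wz by simp
    then have "?F' (?I1 z) = w"
      using IJ2[OF w] IJ2[OF closed[OF T t1(1) T t2(1) f' z']] by metis
    then show "w \<in> ?F' ` carrier (tensor R T N1')" using z' by blast
  qed
  then have exact': "f' ` carrier N1' = a_kernel N2' N3' g'"
    using ff t1(1) t2(1) t3(1) f' g' unfolding faithfully_flat_def by blast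
  have zero3: "i3 y = \<zero>\<^bsub>N3'\<^esub> \<longleftrightarrow> y = \<zero>\<^bsub>N3\<^esub>" if "y \<in> carrier N3" for y
    using linear_maps_zero[OF N(3) t3(1,2)] linear_maps_zero[OF t3(1) N(3) t3(3)] t3(4)[OF that] by metis
  show ?thesis
  proof (intro equalityI subsetI)
    fix y assume "y \<in> f ` carrier N1"
    then obtain x where x: "x \<in> carrier N1" and y: "y = f x" by blast
    have yc: "y \<in> carrier N2" using x y linear_maps_closed[OF f] by simp
    have "i2 y = f' (i1 x)" by (simp add: f'_def t1(4)[OF x] y)
    then have "i2 y \<in> a_kernel N2' N3' g'" using exact' linear_maps_closed[OF t1(2) x] by blast
    then have "i3 (g y) = \<zero>\<^bsub>N3'\<^esub>" by (simp add: linear_maps_mem_a_kernel g'_def t2(4)[OF yc])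
    then show "y \<in> a_kernel N2 N3 g"
      using zero3 linear_maps_closed[OF g yc] yc by (simp add: linear_maps_mem_a_kernel)
  next
    fix y assume "y \<in> a_kernel N2 N3 g"
    then have y: "y \<in> carrier N2" "g y = \<zero>\<^bsub>N3\<^esub>" by (simp_all add: linear_maps_mem_a_kernel)
    then have "i2 y \<in> a_kernel N2' N3' g'"
      using linear_maps_zero[OF N(3) t3(1,2)] linear_maps_closed[OF t2(2) y(1)]
      by (simp add: linear_maps_mem_a_kernel g'_def t2(4)[OF y(1)])
    then obtain x where x: "x \<in> carrier N1'" "i2 y = f' x" using exact' by blast
    then have "y = f (j1 x)"
      using t2(4)[OF y(1)] t2(4)[OF linear_maps_closed[OF fj x(1)]] unfolding f'_def by metis
    then show "y \<in> f ` carrier N1" using linear_maps_closed[OF t1(3) x(1)] by blast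
  qed
qed

section \<open>The descent sequence and its splitting\<close>

lemma linear_maps_diff:
  assumes "module R N" "f \<in> linear_maps R M N" "g \<in> linear_maps R M N"
  shows "(\<lambda>x. f x \<ominus>\<^bsub>N\<^esub> g x) \<in> linear_maps R M N"
proof -
  interpret N: module R N by fact
  have "(\<lambda>x. \<ominus>\<^bsub>N\<^esub> g x) \<in> linear_maps R M N"
    by (rule linear_mapsI)
      (use assms(3) in \<open>auto simp: linear_maps_closed linear_maps_add linear_maps_smult N.minus_add N.smult_r_minus\<close>)
  from linear_maps_sum[OF assms(1,2) this] show ?thesis by (simp add: a_minus_def)
qed

lemma linear_maps_minus:
  assumes "module R M" "module R N" "f \<in> linear_maps R M N" "x \<in> carrier M" "y \<in> carrier M"
  shows "f (x \<ominus>\<^bsub>M\<^esub> y) = f x \<ominus>\<^bsub>N\<^esub> f y"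
proof -
  interpret M: module R M by fact
  interpret N: module R N by fact
  have "f x = f (x \<ominus>\<^bsub>M\<^esub> y \<oplus>\<^bsub>M\<^esub> y)"
    using assms(4,5) by (simp add: M.minus_eq M.a_assoc M.l_neg)
  also have "\<dots> = f (x \<ominus>\<^bsub>M\<^esub> y) \<oplus>\<^bsub>N\<^esub> f y"
    by (rule linear_maps_add[OF assms(3)]) (simp_all add: assms)
  finally show ?thesis
    using assms(4,5) linear_maps_closed[OF assms(3)] by (simp add: N.minus_eq N.a_assoc N.r_neg)
qed

lemma tensor3_ext:
  assumes mods: "module R A" "module R B" "module R C" "module R P"
    and f: "f \<in> linear_maps R (tensor3 R A B C) P" and g: "g \<in> linear_maps R (tensor3 R A B C) P"
    and eq: "\<And>a b c. \<lbrakk>a \<in> carrier A; b \<in> carrier B; c \<in> carrier C\<rbrakk> \<Longrightarrow>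
      f (pure_tensor R A (tensor R B C) a (pure_tensor R B C b c)) =
      g (pure_tensor R A (tensor R B C) a (pure_tensor R B C b c))"
    and z: "z \<in> carrier (tensor3 R A B C)"
  shows "f z = g z"
proof (rule tensor_ext[OF mods(1) module_tensor[OF mods(2,3)] mods(4) f g _ z])
  fix a w assume a: "a \<in> carrier A" and w: "w \<in> carrier (tensor R B C)"
  have pure: "pure_tensor R A (tensor R B C) a \<in> linear_maps R (tensor R B C) (tensor3 R A B C)"
    using linear2_right[OF linear2_pure_tensor[OF mods(1) module_tensor[OF mods(2,3)]] a] .
  show "f (pure_tensor R A (tensor R B C) a w) = g (pure_tensor R A (tensor R B C) a w)"
    by (rule tensor_ext[OF mods(2,3,4) linear_maps_comp[OF pure f] linear_maps_comp[OF pure g] eq[OF a] w])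
qed

text \<open>The sequence \<open>M \<rightarrow> T \<otimes> M \<rightarrow> T \<otimes> (T \<otimes> M)\<close> becomes split exact after tensoring with \<open>T\<close>.\<close>

lemma faithfully_flat_descent:
  fixes R :: "('k, 'r) ring_scheme" and T :: "('k, 'a, 't) module_scheme"
  assumes alg: "assoc_algebra R T" and ff: "faithfully_flat R T"
    and M: "module R M" and covered: "\<one>\<^bsub>T\<^esub> \<noteq> \<zero>\<^bsub>T\<^esub> \<Longrightarrow> list_covered TYPE('a) M"
    and z: "z \<in> carrier (tensor R T M)"
    and descent: "tensor_lift R T M (add_monoid (tensor3 R T T M))
        (\<lambda>t m. pure_tensor R T (tensor R T M) t (pure_tensor R T M \<one>\<^bsub>T\<^esub> m)) z =
      tensor_lift R T M (add_monoid (tensor3 R T T M))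
        (\<lambda>t m. pure_tensor R T (tensor R T M) \<one>\<^bsub>T\<^esub> (pure_tensor R T M t m)) z"
  shows "\<exists>m\<in>carrier M. z = pure_tensor R T M \<one>\<^bsub>T\<^esub> m"
proof (cases "\<one>\<^bsub>T\<^esub> = \<zero>\<^bsub>T\<^esub>")
  \<comment> \<open>In the zero algebra \<open>tensor R T M\<close> vanishes and any
    \<open>m\<close> will do. The case is split off because the coding of words takes one and zero
    of \<open>T\<close> as its two distinct markers.\<close>
  case True
  interpret T: assoc_algebra R T by fact
  interpret M: module R M by fact
  interpret TM: module R "tensor R T M" by (rule module_tensor[OF T.module_axioms M])
  have "t = \<zero>\<^bsub>T\<^esub>" if "t \<in> carrier T" for t
    using T.l_one[OF that] T.l_null[OF that] True by simp
  then have "pure_tensor R T M t m = \<zero>\<^bsub>tensor R T M\<^esub>" if "t \<in> carrier T" "m \<in> carrier M" for t m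
    using module_pair.pure_zero_left[OF module_pairI[OF T.module_axioms M] that(2)] that(1) by metis
  note zero = this
  from z have "z = \<zero>\<^bsub>tensor R T M\<^esub>"
    by (induction rule: module_pair.tensor_induct[OF module_pairI[OF T.module_axioms M], consumes 1])
      (simp_all add: zero)
  then show ?thesis using zero[of "\<one>\<^bsub>T\<^esub>" "\<zero>\<^bsub>M\<^esub>"] by (intro bexI[of _ "\<zero>\<^bsub>M\<^esub>"]) auto
next
  case False
  interpret T: assoc_algebra R T by fact
  interpret M: module R M by fact
  have T: "module R T" by (rule T.module_axioms)
  have nontriv: "\<one>\<^bsub>R\<^esub> \<noteq> \<zero>\<^bsub>R\<^esub>"
    using False T.smult_one T.smult_l_null T.one_closed by metis
  let ?M1 = "tensor R T M" let ?M2 = "tensor R T ?M1" let ?M3 = "tensor R T ?M2"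
  have M1: "module R ?M1" and M2: "module R ?M2" and M3: "module R ?M3"
    by (intro module_tensor T M)+
  interpret M1: module R ?M1 by (rule M1)
  interpret M2: module R ?M2 by (rule M2)
  let ?p1 = "pure_tensor R T M" and ?p2 = "pure_tensor R T ?M1" and ?p3 = "pure_tensor R T ?M2"
  note pure_closed = pure_tensor_closed[OF T M] pure_tensor_closed[OF T M1] pure_tensor_closed[OF T M2]
  note p1 = linear2_comp[OF linear2_pure_tensor[OF T M]] and p2 = linear2_comp[OF linear2_pure_tensor[OF T M1]]
  have lin_g1: "linear2 R T M ?M2 (\<lambda>t m. ?p2 t (?p1 \<one>\<^bsub>T\<^esub> m))"
    and lin_g0: "linear2 R T M ?M2 (\<lambda>t m. ?p2 \<one>\<^bsub>T\<^esub> (?p1 t m))"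
    by (intro linear2I p1 p2 linear_maps_id T.one_closed; assumption)+
  define g1 g0 where g_defs: "g1 = tensor_lift R T M (add_monoid ?M2) (\<lambda>t m. ?p2 t (?p1 \<one>\<^bsub>T\<^esub> m))"
    "g0 = tensor_lift R T M (add_monoid ?M2) (\<lambda>t m. ?p2 \<one>\<^bsub>T\<^esub> (?p1 t m))"
  have g1: "g1 \<in> linear_maps R ?M1 ?M2" and g0: "g0 \<in> linear_maps R ?M1 ?M2"
    unfolding g_defs by (intro tensor_lift_closed T M M2 presents_add_monoid lin_g1 lin_g0)+
  have g1_pure: "g1 (?p1 t m) = ?p2 t (?p1 \<one>\<^bsub>T\<^esub> m)" and g0_pure: "g0 (?p1 t m) = ?p2 \<one>\<^bsub>T\<^esub> (?p1 t m)"
    if "t \<in> carrier T" "m \<in> carrier M" for t m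
    unfolding g_defs by (rule tensor_lift_pure[OF T M M2 presents_add_monoid lin_g1 that],
        rule tensor_lift_pure[OF T M M2 presents_add_monoid lin_g0 that])
  define f g where "f = ?p1 \<one>\<^bsub>T\<^esub>" and g_def: "g = (\<lambda>w. g1 w \<ominus>\<^bsub>?M2\<^esub> g0 w)"
  have f: "f \<in> linear_maps R M ?M1"
    unfolding f_def using linear2_right[OF linear2_pure_tensor[OF T M] T.one_closed] by simp
  have g: "g \<in> linear_maps R ?M1 ?M2" unfolding g_def by (rule linear_maps_diff[OF M2 g1 g0])
  let ?F = "tensor_map R T M T ?M1 id f" and ?G = "tensor_map R T ?M1 T ?M2 id g"
  have F: "?F \<in> linear_maps R ?M1 ?M2" by (intro tensor_map_closed T M M1 linear_maps_id' f)
  have G: "?G \<in> linear_maps R ?M2 ?M3" by (intro tensor_map_closed T M1 M2 linear_maps_id' g)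
  have F_pure: "?F (?p1 t m) = ?p2 t (?p1 \<one>\<^bsub>T\<^esub> m)" if "t \<in> carrier T" "m \<in> carrier M" for t m
    using that by (simp add: tensor_map_pure T M M1 linear_maps_id' f) (simp add: f_def)
  have lin_c: "linear3 R T T N (tensor R T N) (\<lambda>s t n. pure_tensor R T N (s \<otimes>\<^bsub>T\<^esub> t) n)" if N: "module R N" for N
  proof -
    note pN = linear2_comp[OF linear2_pure_tensor[OF T N]]
    have mult: "(\<lambda>s. s \<otimes>\<^bsub>T\<^esub> t) \<in> linear_maps R T T" "(\<lambda>s. t \<otimes>\<^bsub>T\<^esub> s) \<in> linear_maps R T T"
      if "t \<in> carrier T" for t
      using that by (auto intro!: linear_mapsI simp: T.l_distr T.r_distr T.smult_mult_left T.smult_mult_right)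
    show ?thesis by (intro linear3I pN linear_maps_id mult T.m_closed)
  qed
  \<comment> \<open>Multiplication of the first two factors is the splitting: it gives the homotopy
    identity \<open>c (?G y) = ?F (e y) \<ominus> y\<close>, so an element \<open>y\<close> killed
    by \<open>?G\<close> equals \<open>?F (e y)\<close>.\<close>
  define e c where "e = tensor_lift3 R T T M (add_monoid ?M1) (\<lambda>s t n. ?p1 (s \<otimes>\<^bsub>T\<^esub> t) n)"
    and "c = tensor_lift3 R T T ?M1 (add_monoid ?M2) (\<lambda>s t n. ?p2 (s \<otimes>\<^bsub>T\<^esub> t) n)"
  note e = tensor_lift3_linear[OF T T M M1 presents_add_monoid lin_c[OF M], folded e_def]
    and c = tensor_lift3_linear[OF T T M1 M2 presents_add_monoid lin_c[OF M1], folded c_def]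
  have "?F ` carrier ?M1 = a_kernel ?M2 ?M3 ?G"
  proof (intro equalityI subsetI)
    fix y assume "y \<in> ?F ` carrier ?M1"
    then obtain w where w: "w \<in> carrier ?M1" and y: "y = ?F w" by blast
    have "?G (?F w) = \<zero>\<^bsub>?M3\<^esub>"
    proof (rule tensor_ext[OF T M M3 linear_maps_comp[OF F G] linear_maps_const_zero[OF M3] _ w])
      fix t m assume tm: "t \<in> carrier T" "m \<in> carrier M"
      have "g (?p1 \<one>\<^bsub>T\<^esub> m) = \<zero>\<^bsub>?M2\<^esub>"
        using tm by (simp add: g_def g1_pure g0_pure pure_closed M2.minus_eq M2.r_neg)
      then have "?G (?F (?p1 t m)) = ?p3 t \<zero>\<^bsub>?M2\<^esub>"
        using tm by (simp add: F_pure tensor_map_pure T M1 M2 linear_maps_id' g pure_closed)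
      also have "\<dots> = \<zero>\<^bsub>?M3\<^esub>"
        using linear_maps_zero[OF M2 M3 linear2_right[OF linear2_pure_tensor[OF T M2] tm(1)]] .
      finally show "?G (?F (?p1 t m)) = \<zero>\<^bsub>?M3\<^esub>" .
    qed
    then show "y \<in> a_kernel ?M2 ?M3 ?G"
      using linear_maps_closed[OF F w] y by (simp add: linear_maps_mem_a_kernel)
  next
    fix y assume "y \<in> a_kernel ?M2 ?M3 ?G"
    then have y: "y \<in> carrier ?M2" and Gy: "?G y = \<zero>\<^bsub>?M3\<^esub>" by (simp_all add: linear_maps_mem_a_kernel)
    have "c (?G y) = ?F (e y) \<ominus>\<^bsub>?M2\<^esub> y"
    proof (rule tensor3_ext[OF T T M M2 linear_maps_comp[OF G c(1)]
          linear_maps_diff[OF M2 linear_maps_comp[OF e(1) F] linear_maps_id] _ y])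
      fix s t m assume stm: "s \<in> carrier T" "t \<in> carrier T" "m \<in> carrier M"
      have "?G (?p2 s (?p1 t m)) = ?p3 s (?p2 t (?p1 \<one>\<^bsub>T\<^esub> m) \<ominus>\<^bsub>?M2\<^esub> ?p2 \<one>\<^bsub>T\<^esub> (?p1 t m))"
        using stm by (simp add: tensor_map_pure T M1 M2 linear_maps_id' g pure_closed) (simp add: g_def g1_pure g0_pure)
      moreover have "c (?p3 s (u \<ominus>\<^bsub>?M2\<^esub> v)) = c (?p3 s u) \<ominus>\<^bsub>?M2\<^esub> c (?p3 s v)"
        if "u \<in> carrier ?M2" "v \<in> carrier ?M2" for u v
        by (rule linear_maps_minus[OF M2 M2 linear_maps_comp[OF linear2_right[OF linear2_pure_tensor[OF T M2] stm(1)] c(1)] that])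
      ultimately show "c (?G (?p2 s (?p1 t m))) = ?F (e (?p2 s (?p1 t m))) \<ominus>\<^bsub>?M2\<^esub> ?p2 s (?p1 t m)"
        using stm by (simp add: c(2) e(2) F_pure pure_closed)
    qed
    moreover have "c (?G y) = \<zero>\<^bsub>?M2\<^esub>"
      unfolding Gy by (rule linear_maps_zero[OF M3 M2 c(1)])
    ultimately have "?F (e y) = y"
      using y linear_maps_closed[OF F linear_maps_closed[OF e(1) y]]
      using M2.minus_equality[of "?F (e y)" "\<ominus>\<^bsub>?M2\<^esub> y"] by (simp add: M2.minus_eq)
    then show "y \<in> ?F ` carrier ?M1" using linear_maps_closed[OF e(1) y] by (metis imageI)
  qed
  note exact = this
  have cov1: "list_covered TYPE('a) ?M1"
    by (rule list_covered_tensor[OF False T M list_covered_self covered[OF False]])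
  have cov2: "list_covered TYPE('a) ?M2"
    by (rule list_covered_tensor[OF False T M1 list_covered_self cov1])
  have "f ` carrier M = a_kernel ?M1 ?M2 g"
    by (rule faithfully_flat_exact[OF ff nontriv M M1 M2 covered[OF False] cov1 cov2 f g exact])
  moreover have "g z = \<zero>\<^bsub>?M2\<^esub>"
    unfolding g_def using descent[folded g_defs] linear_maps_closed[OF g0 z] by (simp add: M2.minus_eq M2.r_neg)
  ultimately have "z \<in> f ` carrier M" using z by (simp add: linear_maps_mem_a_kernel)
  then show ?thesis unfolding f_def by blast
qed

section \<open>The Grunspan map\<close>

context torsor_decomposition
begin

text \<open>\<open>twist G x \<psi>\<close> is \<open>\<psi>\<close> applied to
  \<open>x\<^sub>1x\<^sub>2\<^sub>3 \<otimes> x\<^sub>2\<^sub>2 \<otimes> x\<^sub>2\<^sub>1x\<^sub>3\<close>.\<close>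

definition twist where
  "twist G x \<psi> = tsum G \<rho> x (\<lambda>a b c. tsum G \<rho> b (\<lambda>p q r. \<psi> (a \<otimes>\<^bsub>T\<^esub> r) q (p \<otimes>\<^bsub>T\<^esub> c)))"

text \<open>Multiplying out sends \<open>1 \<otimes> y \<otimes> 1\<close> to \<open>y\<close>. The
  formula thus picks out the element that descent will provide, and it is visibly linear before
  descent is available.\<close>

definition theta where
  "theta x = twist T x (\<lambda>a b c. a \<otimes>\<^bsub>T\<^esub> b \<otimes>\<^bsub>T\<^esub> c)"

lemma twist_closed:
  assumes "module R G" "x \<in> carrier T"
    and "\<And>a b c. \<lbrakk>a \<in> carrier T; b \<in> carrier T; c \<in> carrier T\<rbrakk> \<Longrightarrow> \<psi> a b c \<in> carrier G"
  shows "twist G x \<psi> \<in> carrier G"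
  unfolding twist_def by (intro tsum_closed assms m_closed)

lemma twist_hom:
  assumes G: "module R G" and H: "module R H" and h: "h \<in> linear_maps R G H" and x: "x \<in> carrier T"
    and closed: "\<And>a b c. \<lbrakk>a \<in> carrier T; b \<in> carrier T; c \<in> carrier T\<rbrakk> \<Longrightarrow> \<phi> a b c \<in> carrier G"
    and eq: "\<And>a b c. \<lbrakk>a \<in> carrier T; b \<in> carrier T; c \<in> carrier T\<rbrakk> \<Longrightarrow> h (\<phi> a b c) = \<psi> a b c"
  shows "h (twist G x \<phi>) = twist H x \<psi>"
proof -
  have "h (twist G x \<phi>) = tsum H \<rho> x (\<lambda>a b c. h (tsum G \<rho> b (\<lambda>p q r. \<phi> (a \<otimes>\<^bsub>T\<^esub> r) q (p \<otimes>\<^bsub>T\<^esub> c))))"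
    unfolding twist_def by (rule tsum_hom[OF G H h x]) (intro tsum_closed G closed m_closed)
  also have "\<dots> = tsum H \<rho> x (\<lambda>a b c. tsum H \<rho> b (\<lambda>p q r. h (\<phi> (a \<otimes>\<^bsub>T\<^esub> r) q (p \<otimes>\<^bsub>T\<^esub> c))))"
    by (rule tsum_cong[OF x], rule tsum_hom[OF G H h]) (assumption | intro closed m_closed)+
  also have "\<dots> = twist H x \<psi>"
    unfolding twist_def by (intro tsum_cong x eq m_closed)
  finally show ?thesis .
qed

lemmas pure_intros = linear2_comp[OF linear2_pure_tensor]

lemma theta_linear: "theta \<in> linear_maps R T T"
proof -
  interpret S: torsor_sums R T T \<rho> by (rule torsor_sums[OF module_T])
  have "(\<lambda>x. theta x) \<in> linear_maps R T T"
    unfolding theta_def twist_def by (intro S.multilinear_intros)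
  then show ?thesis by simp
qed

text \<open>Descent recognizes a unit in the first tensor factor only. It is applied to
  \<open>E\<close> with \<open>M\<close> the tensor square of \<open>T\<close>, leaving
  \<open>E = 1 \<otimes> m\<close>, and then to the flipped \<open>m\<close>, whose first factor is
  the last factor of \<open>E\<close>.\<close>

lemma twist_pure:
  assumes ff: "faithfully_flat R T" and x: "x \<in> carrier T"
  shows "twist (tensor3 R T T T) x (\<lambda>a b c. pure_tensor R T (tensor R T T) a (pure_tensor R T T b c)) =
    pure_tensor R T (tensor R T T) \<one>\<^bsub>T\<^esub> (pure_tensor R T T (theta x) \<one>\<^bsub>T\<^esub>)"
proof -
  let ?T2 = "tensor R T T" let ?T3 = "tensor R T ?T2" let ?T4 = "tensor R T ?T3"
  let ?p2 = "pure_tensor R T T" and ?p3 = "pure_tensor R T ?T2" and ?p4 = "pure_tensor R T ?T3"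
  have T2: "module R ?T2" and T3: "module R ?T3" and T4: "module R ?T4" by (intro modules)+
  note lin = linear2I linear3I linear5I pure_intros linear2_comp[OF linear2_mult] linear_maps_id
    module_T T2 T3 T4 m_closed one_closed
  define E where "E = twist ?T3 x (\<lambda>a b c. ?p3 a (?p2 b c))"
  have E_closed: "E \<in> carrier ?T3"
    unfolding E_def by (intro twist_closed lin x)
  \<comment> \<open>A linear map is evaluated on \<open>E\<close> termwise; this is how the two
    insertions of 1 become the two sides of \<open>descent_left\<close> and, later, of
    \<open>descent_right\<close>.\<close>
  have apply_E: "h E = twist G x \<psi>"
    if "module R G" "h \<in> linear_maps R ?T3 G"
      "\<And>a b c. \<lbrakk>a \<in> carrier T; b \<in> carrier T; c \<in> carrier T\<rbrakk> \<Longrightarrow> h (?p3 a (?p2 b c)) = \<psi> a b c"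
    for G h \<psi>
    unfolding E_def by (rule twist_hom[OF T3 that(1,2) x _ that(3)]) (intro lin)
  interpret S3: torsor_sums R T ?T3 \<rho> by (rule torsor_sums[OF T3])
  interpret S4: torsor_sums R T ?T4 \<rho> by (rule torsor_sums[OF T4])
  have "\<exists>m\<in>carrier ?T2. E = ?p3 \<one>\<^bsub>T\<^esub> m"
  proof (rule faithfully_flat_descent[OF assoc_algebra_axioms ff T2 _ E_closed])
    assume "\<one>\<^bsub>T\<^esub> \<noteq> \<zero>\<^bsub>T\<^esub>"
    then show "list_covered TYPE('c) ?T2"
      by (rule list_covered_tensor[OF _ module_T module_T list_covered_self list_covered_self])
  next
    let ?l1 = "tensor_lift R T ?T2 (add_monoid ?T4) (\<lambda>t m. ?p4 t (?p3 \<one>\<^bsub>T\<^esub> m))"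
    let ?l0 = "tensor_lift R T ?T2 (add_monoid ?T4) (\<lambda>t m. ?p4 \<one>\<^bsub>T\<^esub> (?p3 t m))"
    have l1: "linear2 R T ?T2 ?T4 (\<lambda>t m. ?p4 t (?p3 \<one>\<^bsub>T\<^esub> m))" by (intro lin)
    have l0: "linear2 R T ?T2 ?T4 (\<lambda>t m. ?p4 \<one>\<^bsub>T\<^esub> (?p3 t m))" by (intro lin)
    have "?l1 E = twist ?T4 x (\<lambda>a b c. ?p4 a (?p3 \<one>\<^bsub>T\<^esub> (?p2 b c)))"
      by (rule apply_E[OF T4 tensor_lift_closed[OF module_T T2 T4 presents_add_monoid l1]],
          rule tensor_lift_pure[OF module_T T2 T4 presents_add_monoid l1]) (assumption | intro lin)+
    also have "\<dots> = twist ?T4 x (\<lambda>a b c. ?p4 \<one>\<^bsub>T\<^esub> (?p3 a (?p2 b c)))"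
      unfolding twist_def
      by (rule S4.descent_left[OF _ x, of "\<lambda>s t q p c. ?p4 s (?p3 t (?p2 q (p \<otimes>\<^bsub>T\<^esub> c)))"]) (intro lin; assumption)
    also have "\<dots> = ?l0 E"
      by (rule apply_E[OF T4 tensor_lift_closed[OF module_T T2 T4 presents_add_monoid l0], symmetric],
          rule tensor_lift_pure[OF module_T T2 T4 presents_add_monoid l0]) (assumption | intro lin)+
    finally show "?l1 E = ?l0 E" .
  qed
  then obtain m where m: "m \<in> carrier ?T2" and E_m: "E = ?p3 \<one>\<^bsub>T\<^esub> m" by blast
  have swap_lin: "linear2 R T T ?T2 (\<lambda>x y. ?p2 y x)" by (intro lin)
  define swap where "swap = tensor_lift R T T (add_monoid ?T2) (\<lambda>x y. ?p2 y x)"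
  note swap = tensor_lift_closed[OF module_T module_T T2 presents_add_monoid swap_lin, folded swap_def]
    tensor_lift_pure[OF module_T module_T T2 presents_add_monoid swap_lin, folded swap_def]
  have "\<exists>y\<in>carrier T. swap m = ?p2 \<one>\<^bsub>T\<^esub> y"
  proof (rule faithfully_flat_descent[OF assoc_algebra_axioms ff module_T list_covered_self
        linear_maps_closed[OF swap(1) m]])
    let ?l1 = "tensor_lift R T T (add_monoid ?T3) (\<lambda>t m. ?p3 t (?p2 \<one>\<^bsub>T\<^esub> m))"
    let ?l0 = "tensor_lift R T T (add_monoid ?T3) (\<lambda>t m. ?p3 \<one>\<^bsub>T\<^esub> (?p2 t m))"
    \<comment> \<open>A Sweedler formula is known for \<open>E = 1 \<otimes> m\<close> but not for
      \<open>m\<close>. So \<open>?k1\<close> and \<open>?k0\<close> are defined on all of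
      \<open>E\<close>: they multiply its first factor into the middle one, which on
      \<open>1 \<otimes> m\<close> gives the two insertions for \<open>swap m\<close>.\<close>
    let ?k1 = "tensor_lift3 R T T T (add_monoid ?T3) (\<lambda>t q v. ?p3 v (?p2 \<one>\<^bsub>T\<^esub> (t \<otimes>\<^bsub>T\<^esub> q)))"
    let ?k0 = "tensor_lift3 R T T T (add_monoid ?T3) (\<lambda>t q v. ?p3 \<one>\<^bsub>T\<^esub> (?p2 v (t \<otimes>\<^bsub>T\<^esub> q)))"
    have l1: "linear2 R T T ?T3 (\<lambda>t m. ?p3 t (?p2 \<one>\<^bsub>T\<^esub> m))" by (intro lin)
    have l0: "linear2 R T T ?T3 (\<lambda>t m. ?p3 \<one>\<^bsub>T\<^esub> (?p2 t m))" by (intro lin)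
    have k1: "linear3 R T T T ?T3 (\<lambda>t q v. ?p3 v (?p2 \<one>\<^bsub>T\<^esub> (t \<otimes>\<^bsub>T\<^esub> q)))" by (intro lin)
    have k0: "linear3 R T T T ?T3 (\<lambda>t q v. ?p3 \<one>\<^bsub>T\<^esub> (?p2 v (t \<otimes>\<^bsub>T\<^esub> q)))" by (intro lin)
    note lift = tensor_lift_closed[OF module_T module_T T3 presents_add_monoid]
      tensor_lift_pure[OF module_T module_T T3 presents_add_monoid]
    note lift3 = tensor_lift3_linear[OF module_T module_T module_T T3 presents_add_monoid]
    note p3_1 = linear2_right[OF linear2_pure_tensor[OF module_T T2] one_closed]
    have "?l1 (swap m) = ?k1 E"
      unfolding E_m
    proof (rule tensor_ext[OF module_T module_T T3 linear_maps_comp[OF swap(1) lift(1)[OF l1]]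
          linear_maps_comp[OF p3_1 lift3(1)[OF k1]] _ m])
      show "?l1 (swap (?p2 q v)) = ?k1 (?p3 \<one>\<^bsub>T\<^esub> (?p2 q v))" if "q \<in> carrier T" "v \<in> carrier T" for q v
        using that by (simp add: swap(2) lift(2)[OF l1] lift3(2)[OF k1])
    qed
    also have "\<dots> = twist ?T3 x (\<lambda>a b c. ?p3 c (?p2 \<one>\<^bsub>T\<^esub> (a \<otimes>\<^bsub>T\<^esub> b)))"
      by (rule apply_E[OF T3 lift3(1)[OF k1] lift3(2)[OF k1]])
    also have "\<dots> = twist ?T3 x (\<lambda>a b c. ?p3 \<one>\<^bsub>T\<^esub> (?p2 c (a \<otimes>\<^bsub>T\<^esub> b)))"
      unfolding twist_def
      by (rule S3.descent_right[OF _ x, of "\<lambda>a v w q r. ?p3 v (?p2 w (a \<otimes>\<^bsub>T\<^esub> r \<otimes>\<^bsub>T\<^esub> q))"]) (intro lin; assumption)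
    also have "\<dots> = ?k0 E"
      by (rule apply_E[OF T3 lift3(1)[OF k0] lift3(2)[OF k0], symmetric])
    also have "\<dots> = ?l0 (swap m)"
      unfolding E_m
    proof (rule tensor_ext[OF module_T module_T T3 linear_maps_comp[OF p3_1 lift3(1)[OF k0]]
          linear_maps_comp[OF swap(1) lift(1)[OF l0]] _ m])
      show "?k0 (?p3 \<one>\<^bsub>T\<^esub> (?p2 q v)) = ?l0 (swap (?p2 q v))" if "q \<in> carrier T" "v \<in> carrier T" for q v
        using that by (simp add: swap(2) lift(2)[OF l0] lift3(2)[OF k0])
    qed
    finally show "?l1 (swap m) = ?l0 (swap m)" .
  qed
  then obtain y where y: "y \<in> carrier T" and swap_m: "swap m = ?p2 \<one>\<^bsub>T\<^esub> y" by blast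
  have "swap (swap m) = m"
    by (rule tensor_ext[OF module_T module_T T2 linear_maps_comp[OF swap(1) swap(1)] linear_maps_id _ m])
      (simp add: swap(2))
  then have "m = ?p2 y \<one>\<^bsub>T\<^esub>" using swap(2) y by (simp add: swap_m)
  then have E_y: "E = ?p3 \<one>\<^bsub>T\<^esub> (?p2 y \<one>\<^bsub>T\<^esub>)" by (simp add: E_m)
  have prod: "linear3 R T T T T (\<lambda>a b c. a \<otimes>\<^bsub>T\<^esub> b \<otimes>\<^bsub>T\<^esub> c)" by (intro lin)
  note lift3 = tensor_lift3_linear[OF module_T module_T module_T module_T presents_add_monoid prod]
  have "theta x = tensor_lift3 R T T T (add_monoid T) (\<lambda>a b c. a \<otimes>\<^bsub>T\<^esub> b \<otimes>\<^bsub>T\<^esub> c) E"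
    unfolding theta_def by (rule apply_E[OF module_T lift3, symmetric])
  also have "\<dots> = y" unfolding E_y using y by (simp add: lift3(2))
  finally show ?thesis using E_y unfolding E_def by simp
qed

text \<open>The identity of \<open>twist_pure\<close> is the universal case of the defining property
  of \<open>theta\<close>; the lift of \<open>\<phi>\<close> carries it to \<open>G\<close>.\<close>

lemma torsor_sums_theta:
  assumes ff: "faithfully_flat R T" and G: "module R G"
  shows "torsor_sums_theta R T G \<rho> theta"
proof (intro torsor_sums_theta.intro torsor_sums_theta_axioms.intro torsor_sums[OF G] theta_linear)
  fix \<phi> x assume \<phi>: "linear3 R T T T G \<phi>" and x: "x \<in> carrier T"
  let ?h = "tensor_lift3 R T T T (add_monoid G) \<phi>"
  note h = tensor_lift3_linear[OF module_T module_T module_T G presents_add_monoid \<phi>]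
  have "twist G x \<phi> = ?h (twist (tensor3 R T T T) x (\<lambda>a b c. pure_tensor R T (tensor R T T) a (pure_tensor R T T b c)))"
    by (rule twist_hom[OF _ G h(1) x _ h(2), symmetric]) (assumption | intro modules pure_tensor_closed)+
  also have "\<dots> = \<phi> \<one>\<^bsub>T\<^esub> (theta x) \<one>\<^bsub>T\<^esub>"
    unfolding twist_pure[OF ff x] using linear_maps_closed[OF theta_linear x] by (simp add: h(2))
  finally show "tsum G \<rho> x (\<lambda>a b c. tsum G \<rho> b (\<lambda>p q r. \<phi> (a \<otimes>\<^bsub>T\<^esub> r) q (p \<otimes>\<^bsub>T\<^esub> c))) =
      \<phi> \<one>\<^bsub>T\<^esub> (theta x) \<one>\<^bsub>T\<^esub>" unfolding twist_def .
qed

text \<open>With target \<open>T\<close> and the product of three elements as test map, the outer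
  units in \<open>theta_mult\<close> and \<open>theta_one\<close> disappear.\<close>

lemma theta_algebra_hom:
  assumes ff: "faithfully_flat R T"
  shows "theta \<in> algebra_homs R T T"
proof -
  interpret S: torsor_sums_theta R T T \<rho> theta by (rule torsor_sums_theta[OF ff module_T])
  have prod: "linear3 R T T T T (\<lambda>a b c. a \<otimes>\<^bsub>T\<^esub> b \<otimes>\<^bsub>T\<^esub> c)"
    by (intro S.multilinear_intros)
  have "theta \<in> ring_hom T T"
  proof (rule ring_hom_memI)
    show "theta (x \<otimes>\<^bsub>T\<^esub> y) = theta x \<otimes>\<^bsub>T\<^esub> theta y" if "x \<in> carrier T" "y \<in> carrier T" for x y
      using S.theta_mult[OF prod that] that by (simp add: S.theta_closed)
    show "theta \<one>\<^bsub>T\<^esub> = \<one>\<^bsub>T\<^esub>"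
      using S.theta_one[OF prod] by (simp add: S.theta_closed)
  qed (simp_all add: S.theta_closed linear_maps_add[OF theta_linear])
  then show ?thesis by (simp add: algebra_homs_def theta_linear)
qed

section \<open>The Grunspan equations in the nested tensor products\<close>

lemma opp_intros:
  "x \<in> carrier T \<Longrightarrow> x \<in> carrier (opp T)"
  "f \<in> linear_maps R K T \<Longrightarrow> f \<in> linear_maps R K (opp T)"
  by (simp_all add: linear_maps_opp_target)

lemma linear5_pure5: "linear5 R T T T T T P5 pure5"
  by (intro linear5I pure_intros opp_intros linear_maps_id modules)

lemma linear3_pure3: "linear3 R T T T P3 pure3"
  by (intro linear3I pure_intros opp_intros linear_maps_id modules)

text \<open>The double sum in \<open>P5\<close> is the one already computed by
  \<open>left_coassoc_pure\<close>; \<open>\<theta>\<close> acts on its third leg.\<close>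

lemma grunspan_left_pure:
  assumes th: "\<theta> \<in> linear_maps R T T" and x: "x \<in> carrier T"
  shows "tensor_map R T (tensor R (opp T) P3) T (tensor R (opp T) P3) id
      (tensor_map R (opp T) P3 (opp T) P3 id
         (tensor_map R T (tensor R (opp T) T) T (tensor R (opp T) T) \<theta> id))
      (tensor_assoc3 R T (opp T) T (tensor R (opp T) T)
        (tensor_map R T (tensor R (opp T) T) P3 (tensor R (opp T) T) \<mu> id (\<mu> x))) =
    tsum P5 \<rho> x (\<lambda>a b c. tsum P5 \<rho> a (\<lambda>p q r. pure5 p q (\<theta> r) b c))"
proof -
  let ?Q = "tensor R (opp T) T" and ?Q' = "tensor R (opp T) P3"
  have Q: "module R ?Q" and Q': "module R ?Q'" and P3: "module R P3" and P5: "module R P5" by (intro modules)+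
  note h1 = tensor_map_closed[OF module_T Q module_T Q th linear_maps_id']
  note h2 = tensor_map_closed[OF opp_module P3 opp_module P3 linear_maps_id' h1]
  note h3 = tensor_map_closed[OF module_T Q' module_T Q' linear_maps_id' h2]
  let ?h = "tensor_map R T ?Q' T ?Q' id (tensor_map R (opp T) P3 (opp T) P3 id (tensor_map R T ?Q T ?Q \<theta> id))"
  have h_pure: "?h (pure5 a b c d e) = pure5 a b (\<theta> c) d e"
    if "a \<in> carrier T" "b \<in> carrier T" "c \<in> carrier T" "d \<in> carrier T" "e \<in> carrier T" for a b c d e
    using that by (simp add: tensor_map_pure h1 h2 th linear_maps_id' module_T opp_module Q Q' P3 pure_tensor_closed)
  show ?thesis
    unfolding left_coassoc_pure[OF x] using x
    by (simp add: tsum_hom[OF P5 P5 h3] tsum_closed[OF P5] pure5_closed h_pure cong: tsum_cong)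
qed

text \<open>Before rebracketing, \<open>mu_op\<close> puts the legs of \<open>x\<^sub>2\<close> in
  reverse order, whence the order \<open>a\<close>, \<open>r\<close>, \<open>q\<close>,
  \<open>p\<close>, \<open>c\<close>.\<close>

lemma grunspan_right_pure:
  assumes x: "x \<in> carrier T"
  shows "tensor_map R T (tensor R (tensor3 R (opp T) T (opp T)) T) T (tensor R (opp T) P3) id
      (tensor_assoc3 R (opp T) T (opp T) T)
      (tensor_map R T (tensor R (opp T) T) T (tensor R (tensor3 R (opp T) T (opp T)) T) id
         (tensor_map R (opp T) T (tensor3 R (opp T) T (opp T)) T (mu_op R T \<mu>) id) (\<mu> x)) =
    tsum P5 \<rho> x (\<lambda>a b c. tsum P5 \<rho> b (\<lambda>p q r. pure5 a r q p c))"
proof -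
  let ?Q = "tensor R (opp T) T" and ?O = "tensor3 R (opp T) T (opp T)" and ?B = "tensor R T (opp T)"
  let ?OT = "tensor R ?O T" and ?Q' = "tensor R (opp T) P3"
  have Q: "module R ?Q" and Q': "module R ?Q'" and O: "module R ?O" and B: "module R ?B"
    and OT: "module R ?OT" and P3: "module R P3" and P5: "module R P5" by (intro modules)+
  have rev: "linear3 R T T T ?O (\<lambda>a b c. pure_tensor R (opp T) ?B c (pure_tensor R T (opp T) b a))"
    by (intro linear3I pure_intros opp_intros linear_maps_id modules)
  then have rev': "linear3 R T (opp T) T ?O (\<lambda>a b c. pure_tensor R (opp T) ?B c (pure_tensor R T (opp T) b a))"
    by (simp add: multilinear_opp)
  have op_tsum: "mu_op R T \<mu> b = tsum ?O \<rho> b (\<lambda>p q r. pure_tensor R (opp T) ?B r (pure_tensor R T (opp T) q p))"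
    if "b \<in> carrier T" for b
    unfolding mu_op_def by (rule tensor_lift3_mu[OF O presents_tensor_group rev that])
  have op_lin: "mu_op R T \<mu> \<in> linear_maps R (opp T) ?O"
    unfolding linear_maps_opp
    by (rule linear_maps_cong[OF module_T linear_maps_comp[OF mu_linear
            tensor_lift3_closed[OF module_T opp_module module_T O presents_tensor_group rev']]])
      (simp add: mu_op_def)
  note h1 = tensor_map_closed[OF opp_module module_T O module_T op_lin linear_maps_id']
  note h2 = tensor_map_closed[OF module_T Q module_T OT linear_maps_id' h1]
  note a1 = tensor_assoc3_linear[OF opp_module module_T opp_module module_T]
  note a2 = tensor_map_closed[OF module_T OT module_T Q' linear_maps_id' a1(1)]
  let ?h = "\<lambda>z. tensor_map R T ?OT T ?Q' id (tensor_assoc3 R (opp T) T (opp T) T)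
      (tensor_map R T ?Q T ?OT id (tensor_map R (opp T) T ?O T (mu_op R T \<mu>) id) z)"
  have "?h (\<mu> x) = tsum P5 \<rho> x (\<lambda>a b c. ?h (pure3 a b c))"
    by (rule hom_mu[OF P5 linear_maps_comp[OF h2 a2] x])
  also have "\<dots> = tsum P5 \<rho> x (\<lambda>a b c. tsum P5 \<rho> b (\<lambda>p q r. pure5 a r q p c))"
  proof (rule tsum_cong[OF x])
    fix a b c assume abc: "a \<in> carrier T" "b \<in> carrier T" "c \<in> carrier T"
    let ?k = "\<lambda>w. pure_tensor R T ?Q' a (tensor_assoc3 R (opp T) T (opp T) T (pure_tensor R ?O T w c))"
    have k: "?k \<in> linear_maps R ?O P5"
      by (rule linear_maps_comp[OF linear_maps_comp[OF linear_maps_pure_left[OF O module_T abc(3)] a1(1)]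
            linear_maps_pure_right[OF module_T Q' abc(1)]])
    have op_b: "mu_op R T \<mu> b \<in> carrier ?O"
      using linear_maps_closed[OF op_lin] abc(2) by simp
    have "?h (pure3 a b c) = ?k (mu_op R T \<mu> b)"
      using abc op_b
      by (simp add: tensor_map_pure h1 h2 a1(1) op_lin linear_maps_id' module_T opp_module Q Q' O OT pure_tensor_closed)
    also have "\<dots> = tsum P5 \<rho> b (\<lambda>p q r. ?k (pure_tensor R (opp T) ?B r (pure_tensor R T (opp T) q p)))"
      unfolding op_tsum[OF abc(2)]
      by (rule tsum_hom[OF O P5 k abc(2)]) (intro pure_tensor_closed modules opp_intros)
    also have "\<dots> = tsum P5 \<rho> b (\<lambda>p q r. pure5 a r q p c)"
      using abc by (intro tsum_cong abc) (simp add: a1(2))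
    finally show "?h (pure3 a b c) = tsum P5 \<rho> b (\<lambda>p q r. pure5 a r q p c)" .
  qed
  finally show ?thesis .
qed

lemma cube_pure:
  assumes th: "\<theta> \<in> linear_maps R T T" and x: "x \<in> carrier T"
  shows "tensor_map R T (tensor R (opp T) T) T (tensor R (opp T) T) \<theta>
      (tensor_map R (opp T) T (opp T) T \<theta> \<theta>) (\<mu> x) = tsum P3 \<rho> x (\<lambda>a b c. pure3 (\<theta> a) (\<theta> b) (\<theta> c))"
proof -
  let ?Q = "tensor R (opp T) T"
  have Q: "module R ?Q" and P3: "module R P3" by (intro modules)+
  have th_op: "\<theta> \<in> linear_maps R (opp T) (opp T)"
    using th by (simp add: linear_maps_opp linear_maps_opp_target)
  note h1 = tensor_map_closed[OF opp_module module_T opp_module module_T th_op th]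
  note h2 = tensor_map_closed[OF module_T Q module_T Q th h1]
  show ?thesis
    unfolding hom_mu[OF P3 h2 x] using x
    by (intro tsum_cong)
      (simp_all add: tensor_map_pure th th_op h1 module_T opp_module Q pure_tensor_closed)
qed

text \<open>The universal multilinear maps \<open>pure5\<close> and \<open>pure3\<close> turn the
  identities of the Sweedler calculus back into equations in \<open>P5\<close> and
  \<open>P3\<close>.\<close>

lemma grunspan_map_theta:
  assumes ff: "faithfully_flat R T" shows "grunspan_map R T \<mu> theta"
  unfolding grunspan_map_def
proof (intro conjI ballI)
  show "theta \<in> algebra_homs R T T" by (rule theta_algebra_hom[OF ff])
next
  fix x assume x: "x \<in> carrier T"
  interpret S: torsor_sums_theta R T P5 \<rho> theta by (rule torsor_sums_theta[OF ff]) (intro modules)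
  show "tensor_map R T (tensor R (opp T) P3) T (tensor R (opp T) P3) id
      (tensor_map R (opp T) P3 (opp T) P3 id
         (tensor_map R T (tensor R (opp T) T) T (tensor R (opp T) T) theta id))
      (tensor_assoc3 R T (opp T) T (tensor R (opp T) T)
        (tensor_map R T (tensor R (opp T) T) P3 (tensor R (opp T) T) \<mu> id (\<mu> x))) =
    tensor_map R T (tensor R (tensor3 R (opp T) T (opp T)) T) T (tensor R (opp T) P3) id
      (tensor_assoc3 R (opp T) T (opp T) T)
      (tensor_map R T (tensor R (opp T) T) T (tensor R (tensor3 R (opp T) T (opp T)) T) id
         (tensor_map R (opp T) T (tensor3 R (opp T) T (opp T)) T (mu_op R T \<mu>) id) (\<mu> x))"
    unfolding grunspan_left_pure[OF theta_linear x] grunspan_right_pure[OF x]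
    by (rule S.grunspan_first[OF linear5_pure5 x])
next
  fix x assume x: "x \<in> carrier T"
  interpret S: torsor_sums_theta R T P3 \<rho> theta by (rule torsor_sums_theta[OF ff]) (intro modules)
  show "tensor_map R T (tensor R (opp T) T) T (tensor R (opp T) T) theta
      (tensor_map R (opp T) T (opp T) T theta theta) (\<mu> x) = \<mu> (theta x)"
    unfolding cube_pure[OF theta_linear x] mu_tsum[OF S.theta_closed[OF x]]
    by (rule S.grunspan_second[OF linear3_pure3 x])
qed

end

theorem corollary3p6:
  fixes R :: "('k, 'r) ring_scheme" and T :: "('k, 'a, 't) module_scheme"
  assumes "cring R"
    and "torsor R T \<mu>"
    and "faithfully_flat R T"
  shows "\<exists>\<theta>. grunspan_map R T \<mu> \<theta>"
  using torsor_decomposition_exists[OF assms(2)] torsor_decomposition.grunspan_map_theta[OF _ assms(3)]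
  by blast

end
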